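(* For a connected graph $H$, the following are equivalent: (a) $H$ is product-join-reducible; (b) $H$ is isomorphic to a subgraph of $H(G,e)$ for some $(G,e)\in\mathcal{G}'$; (c) $H$ is isomorphic to a subgraph of $H(G,e)$ for some $(G,e)\in\mathcal{G}''$.
   Context: Multigraphs may have loops and parallel edges. A series-parallel graph is a multigraph with no $K_4$ minor. $\mathcal{G}'$ is the set of pairs $(G,e)$ with $G$ a connected series-parallel multigraph and $e\in E(G)$ neither a bridge nor a loop; $\mathcal{G}''$ is the subset where $G$ is $2$-connected (at least two edges, no loops, connected after deleting any vertex). For $(G,e)\in\mathcal{G}'$, identify subsets of $E(G)\setminus\{e\}$ with vertices of $Q_{e(G)-1}$; let $X(G/e)$ be the sets $S$ with $S\cup\{e\}$ a spanning tree of $G$, and $X(G\setminus e)$ the sets $S$ that are spanning trees of $G$; $H(G,e)$ is the induced subgraph of $Q_{e(G)-1}$ on $X(G/e)\cup X(G\setminus e)$. Product-join: for connected bipartite graphs $H_1,H_2$ with bipartitions $(A_1,B_1)$, $(A_2,B_2)$, the product-join of $H_1$ and $H_2$ along $A_1$ and $A_2$ is the bipartite graph with parts $A_1\times A_2$ and $(A_1\times B_2)\sqcup(B_1\times A_2)$, where $(a_1,a_2)$ is adjacent to $(a_1,b_2)$ for every $b_2$ adjacent to $a_2$ in $H_2$ and to $(b_1,a_2)$ for every $b_1$ adjacent to $a_1$ in $H_1$, and there are no other edges. A graph is product-join-reducible if it can be obtained from copies of $K_2$ by repeatedly taking connected subgraphs and product-joins (along any choice of parts). *)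

theory Defs
  imports Main
begin

section \<open>Connectivity\<close>

text \<open>Shared by simple graphs and multigraphs: only the family of sets of endvertices matters.\<close>

definition linked :: "'v set set \<Rightarrow> 'v \<Rightarrow> 'v \<Rightarrow> bool" where
  "linked F u v \<longleftrightarrow> (u, v) \<in> {(x, y). {x, y} \<in> F}\<^sup>*"

text \<open>The empty graph does not count as connected.\<close>

definition connected_by :: "'v set \<Rightarrow> 'v set set \<Rightarrow> bool" where
  "connected_by V F \<longleftrightarrow> V \<noteq> {} \<and> (\<forall>u\<in>V. \<forall>v\<in>V. linked F u v)"


section \<open>Finite simple graphs\<close>

record 'v sgraph =
  sverts :: "'v set"
  sedges :: "'v set set"

definition simple_graph :: "'v sgraph \<Rightarrow> bool" where
  "simple_graph H \<longleftrightarrow> finite (sverts H) \<and> (\<forall>f\<in>sedges H. f \<subseteq> sverts H \<and> card f = 2)"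

definition sconnected :: "'v sgraph \<Rightarrow> bool" where
  "sconnected H \<longleftrightarrow> connected_by (sverts H) (sedges H)"

definition sub_graph :: "'v sgraph \<Rightarrow> 'v sgraph \<Rightarrow> bool" where
  "sub_graph K H \<longleftrightarrow> simple_graph K \<and> sverts K \<subseteq> sverts H \<and> sedges K \<subseteq> sedges H"

definition sinduced :: "'v sgraph \<Rightarrow> 'v set \<Rightarrow> 'v sgraph" where
  "sinduced H X = \<lparr>sverts = sverts H \<inter> X, sedges = {f \<in> sedges H. f \<subseteq> X}\<rparr>"

definition graph_iso :: "'v sgraph \<Rightarrow> 'w sgraph \<Rightarrow> bool" where
  "graph_iso H K \<longleftrightarrow>
    (\<exists>\<phi>. bij_betw \<phi> (sverts H) (sverts K) \<and> sedges K = (\<lambda>f. \<phi> ` f) ` sedges H)"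

definition iso_to_subgraph :: "'v sgraph \<Rightarrow> 'w sgraph \<Rightarrow> bool" where
  "iso_to_subgraph H H' \<longleftrightarrow> (\<exists>K. sub_graph K H' \<and> graph_iso H K)"

definition complete_graph :: "'v set \<Rightarrow> 'v sgraph" where
  "complete_graph V = \<lparr>sverts = V, sedges = {{x, y} | x y. x \<in> V \<and> y \<in> V \<and> x \<noteq> y}\<rparr>"

text \<open>The hypercube on coordinate set \<open>I\<close>, its vertices being the subsets of \<open>I\<close>.\<close>

definition hypercube :: "'i set \<Rightarrow> 'i set sgraph" where
  "hypercube I = \<lparr>sverts = Pow I,
     sedges = {{S, T} | S T. S \<subseteq> I \<and> T \<subseteq> I \<and> card (sym_diff S T) = 1}\<rparr>"


section \<open>Product-joins\<close>

text \<open>One of the two parts may be empty; for a connected graph this happens only for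
  the one-vertex graph.\<close>

definition bipartition :: "'v sgraph \<Rightarrow> 'v set \<Rightarrow> 'v set \<Rightarrow> bool" where
  "bipartition H A B \<longleftrightarrow> A \<union> B = sverts H \<and> A \<inter> B = {} \<and>
     (\<forall>f\<in>sedges H. \<exists>a\<in>A. \<exists>b\<in>B. f = {a, b})"

text \<open>The product-join along \<open>A1\<close> and \<open>A2\<close>, where \<open>(Ai, Bi)\<close> is a bipartition of \<open>Hi\<close>.\<close>

definition product_join ::
  "'v sgraph \<Rightarrow> 'v set \<Rightarrow> 'v set \<Rightarrow> 'w sgraph \<Rightarrow> 'w set \<Rightarrow> 'w set \<Rightarrow> ('v \<times> 'w) sgraph" where
  "product_join H1 A1 B1 H2 A2 B2 =
    \<lparr>sverts = A1 \<times> A2 \<union> (A1 \<times> B2 \<union> B1 \<times> A2),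
     sedges =
       {{(a1, a2), (a1, b2)} | a1 a2 b2. a1 \<in> A1 \<and> a2 \<in> A2 \<and> b2 \<in> B2 \<and> {a2, b2} \<in> sedges H2} \<union>
       {{(a1, a2), (b1, a2)} | a1 a2 b1. a1 \<in> A1 \<and> a2 \<in> A2 \<and> b1 \<in> B1 \<and> {a1, b1} \<in> sedges H1}\<rparr>"

text \<open>Graphs are taken up to isomorphism. Since a product-join changes the vertex type, the closure
  is formed among graphs with natural numbers as vertices, which represent all finite graphs, and is
  transferred to other vertex types by isomorphism.\<close>

inductive pj_reducible :: "nat sgraph \<Rightarrow> bool" where
  K2: "a \<noteq> b \<Longrightarrow> pj_reducible (complete_graph {a, b})"
| sub: "pj_reducible H \<Longrightarrow> sub_graph K H \<Longrightarrow> sconnected K \<Longrightarrow> pj_reducible K"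
| join: "pj_reducible H1 \<Longrightarrow> sconnected H1 \<Longrightarrow> bipartition H1 A1 B1 \<Longrightarrow>
    pj_reducible H2 \<Longrightarrow> sconnected H2 \<Longrightarrow> bipartition H2 A2 B2 \<Longrightarrow>
    graph_iso (product_join H1 A1 B1 H2 A2 B2) H \<Longrightarrow> pj_reducible H"

definition product_join_reducible :: "'v sgraph \<Rightarrow> bool" where
  "product_join_reducible H \<longleftrightarrow> (\<exists>H'. pj_reducible H' \<and> graph_iso H' H)"


section \<open>Finite multigraphs\<close>

text \<open>Edges are named, so parallel edges are distinct edges with the same set of endvertices;
  a loop has a single endvertex.\<close>

record ('v, 'e) mgraph =
  mverts :: "'v set"
  medges :: "'e set"
  mends :: "'e \<Rightarrow> 'v set"

definition multigraph :: "('v, 'e) mgraph \<Rightarrow> bool" where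
  "multigraph G \<longleftrightarrow> finite (mverts G) \<and> finite (medges G) \<and>
     (\<forall>f\<in>medges G. mends G f \<subseteq> mverts G \<and> card (mends G f) \<in> {1, 2})"

definition is_loop :: "('v, 'e) mgraph \<Rightarrow> 'e \<Rightarrow> bool" where
  "is_loop G f \<longleftrightarrow> f \<in> medges G \<and> card (mends G f) = 1"

definition mconnected :: "('v, 'e) mgraph \<Rightarrow> bool" where
  "mconnected G \<longleftrightarrow> connected_by (mverts G) (mends G ` medges G)"

definition minduced :: "('v, 'e) mgraph \<Rightarrow> 'v set \<Rightarrow> ('v, 'e) mgraph" where
  "minduced G X = \<lparr>mverts = mverts G \<inter> X, medges = {f \<in> medges G. mends G f \<subseteq> X}, mends = mends G\<rparr>"

definition delete_vertex :: "('v, 'e) mgraph \<Rightarrow> 'v \<Rightarrow> ('v, 'e) mgraph" where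
  "delete_vertex G v = minduced G (mverts G - {v})"

definition spanning :: "('v, 'e) mgraph \<Rightarrow> 'e set \<Rightarrow> ('v, 'e) mgraph" where
  "spanning G T = \<lparr>mverts = mverts G, medges = medges G \<inter> T, mends = mends G\<rparr>"

text \<open>An edge is a bridge if its removal separates its endvertices.\<close>

definition is_bridge :: "('v, 'e) mgraph \<Rightarrow> 'e \<Rightarrow> bool" where
  "is_bridge G f \<longleftrightarrow> f \<in> medges G \<and>
     (\<exists>u\<in>mends G f. \<exists>v\<in>mends G f. \<not> linked (mends G ` (medges G - {f})) u v)"

definition two_connected :: "('v, 'e) mgraph \<Rightarrow> bool" where
  "two_connected G \<longleftrightarrow> card (medges G) \<ge> 2 \<and> (\<forall>f\<in>medges G. \<not> is_loop G f) \<and>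
     mconnected G \<and> (\<forall>v\<in>mverts G. mconnected (delete_vertex G v))"

text \<open>A cycle lists its vertices and edges cyclically. Length one is a loop, length two a pair of
  parallel edges.\<close>

definition is_cycle :: "('v, 'e) mgraph \<Rightarrow> 'v list \<Rightarrow> 'e list \<Rightarrow> bool" where
  "is_cycle G vs es \<longleftrightarrow> vs \<noteq> [] \<and> length es = length vs \<and> distinct vs \<and> distinct es \<and>
     set vs \<subseteq> mverts G \<and> set es \<subseteq> medges G \<and>
     (\<forall>i<length vs. mends G (es ! i) = {vs ! i, vs ! (Suc i mod length vs)})"

definition is_tree :: "('v, 'e) mgraph \<Rightarrow> bool" where
  "is_tree G \<longleftrightarrow> mconnected G \<and> \<not> (\<exists>vs es. is_cycle G vs es)"

definition spanning_tree :: "('v, 'e) mgraph \<Rightarrow> 'e set \<Rightarrow> bool" where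
  "spanning_tree G T \<longleftrightarrow> T \<subseteq> medges G \<and> is_tree (spanning G T)"

text \<open>A simple graph \<open>X\<close> is a minor of \<open>G\<close> if there are pairwise disjoint connected branch sets
  in \<open>G\<close>, one for each vertex of \<open>X\<close>, with an edge of \<open>G\<close> between any two that are adjacent in \<open>X\<close>.\<close>

definition has_minor :: "('v, 'e) mgraph \<Rightarrow> 'w sgraph \<Rightarrow> bool" where
  "has_minor G X \<longleftrightarrow>
    (\<exists>\<beta>. (\<forall>x\<in>sverts X. \<beta> x \<subseteq> mverts G \<and> mconnected (minduced G (\<beta> x))) \<and>
         (\<forall>x\<in>sverts X. \<forall>y\<in>sverts X. x \<noteq> y \<longrightarrow> \<beta> x \<inter> \<beta> y = {}) \<and>
         (\<forall>x y. {x, y} \<in> sedges X \<longrightarrow> (\<exists>f\<in>medges G. \<exists>u\<in>\<beta> x. \<exists>v\<in>\<beta> y. mends G f = {u, v})))"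

definition series_parallel :: "('v, 'e) mgraph \<Rightarrow> bool" where
  "series_parallel G \<longleftrightarrow> multigraph G \<and> \<not> has_minor G (complete_graph {..<4::nat})"


section \<open>The graphs \<open>H(G, e)\<close>\<close>

definition G_prime :: "(('v, 'e) mgraph \<times> 'e) set" where
  "G_prime = {(G, e). series_parallel G \<and> mconnected G \<and> e \<in> medges G \<and>
                      \<not> is_bridge G e \<and> \<not> is_loop G e}"

definition G_dprime :: "(('v, 'e) mgraph \<times> 'e) set" where
  "G_dprime = {(G, e) \<in> G_prime. two_connected G}"

text \<open>\<open>X(G/e)\<close> and \<open>X(G\e)\<close>.\<close>

definition X_contract :: "('v, 'e) mgraph \<Rightarrow> 'e \<Rightarrow> 'e set set" where
  "X_contract G e = {S. S \<subseteq> medges G - {e} \<and> spanning_tree G (S \<union> {e})}"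

definition X_delete :: "('v, 'e) mgraph \<Rightarrow> 'e \<Rightarrow> 'e set set" where
  "X_delete G e = {S. S \<subseteq> medges G - {e} \<and> spanning_tree G S}"

definition tree_graph :: "('v, 'e) mgraph \<Rightarrow> 'e \<Rightarrow> 'e set sgraph" where
  "tree_graph G e = sinduced (hypercube (medges G - {e})) (X_contract G e \<union> X_delete G e)"

end

theory Submission
  imports Defs
begin

text \<open>A network with two terminals, the ends of \<open>e\<close>, has spanning trees and spanning forests with two
  components separating the terminals; these are \<open>X(G \ e)\<close> and \<open>X(G / e)\<close>. Composing two networks in
  parallel, the forests are the unions of two forests and the trees are the unions of a forest and a
  tree, so that the adjacency graph is the product-join along the two forest parts. Series
  composition exchanges the roles of trees and forests and is the product-join along the tree parts.
  Hence the product-join-reducible graphs are the connected subgraphs of the graphs of series-parallel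
  terms. Every term is realised by a 2-connected graph obtained from a pair of parallel edges by
  doubling and subdividing edges. Conversely, a graph without \<open>K4\<close> minor is reduced to a pair of
  parallel edges, one of them \<open>e\<close>, by deleting loops, parallel edges and pendant edges and by
  suppressing vertices of degree two away from \<open>e\<close>. Blocks that do not contain \<open>e\<close> only multiply
  both families by a common family of equally large sets, and a connected subgraph stays within one
  of the resulting copies.\<close>


section \<open>Connectivity\<close>

text \<open>Once spanning trees are recognised as minimal connecting edge sets, cycles disappear,
  and each local operation on a graph acts on the whole family of spanning trees by a set operator
  (\<open>double_in\<close>, \<open>subdivide_in\<close>, inserting an edge). These operators
  commute with contracting and deleting another edge \<open>e\<close>, so one computation serves
  \<open>X_contract\<close> and \<open>X_delete\<close> at once, and substitution of a leaf in a
  term has the same effect. Realisation and reduction read this match in opposite directions. The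
  obstacle in the reduction is that an edge to be doubled or subdivided may lie outside the current
  term. The operator then falls on the common factor, about which only the equal size of its members
  is remembered. This suffices, because nested finite sets of equal size coincide. The free choice
  of parts in a product-join is absorbed by duality: complementation exchanges forests with trees
  and series with parallel, so only parallel composition has to be compared with
  product-joins.\<close>

lemma linked_refl [simp]: "linked F u u"
  by (simp add: linked_def)

lemma linked_step: "{u, v} \<in> F \<Longrightarrow> linked F u v"
  unfolding linked_def by (rule r_into_rtrancl) simp

lemma linked_trans: "linked F u v \<Longrightarrow> linked F v w \<Longrightarrow> linked F u w"
  unfolding linked_def by (rule rtrancl_trans)

lemma linked_sym: "linked F u v \<Longrightarrow> linked F v u"
proof -
  have "sym {(x, y). {x, y} \<in> F}"
    by (auto simp: sym_def insert_commute)
  then show "linked F u v \<Longrightarrow> linked F v u"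
    unfolding linked_def by (meson sym_rtrancl symD)
qed

lemma linked_induct [consumes 1, case_names refl step]:
  assumes "linked F u v" and "P u"
    and "\<And>x y. linked F u x \<Longrightarrow> {x, y} \<in> F \<Longrightarrow> P x \<Longrightarrow> P y"
  shows "P v"
  using assms(1) unfolding linked_def
  by (induction rule: rtrancl_induct) (use assms in \<open>auto simp: linked_def\<close>)

lemma linked_map:
  assumes "linked F u v"
    and "\<And>x y. {x, y} \<in> F \<Longrightarrow> linked F' (\<phi> x) (\<phi> y)"
  shows "linked F' (\<phi> u) (\<phi> v)"
  using assms(1) by (induction rule: linked_induct) (auto intro: linked_trans assms(2))

lemma connected_byI:
  assumes "r \<in> V" and "\<And>v. v \<in> V \<Longrightarrow> linked F r v"
  shows "connected_by V F"
  unfolding connected_by_def using assms by (blast intro: linked_trans linked_sym)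

lemma connected_by_map:
  assumes "connected_by V F" and "\<phi> ` V = V'"
    and "\<And>x y. {x, y} \<in> F \<Longrightarrow> linked F' (\<phi> x) (\<phi> y)"
  shows "connected_by V' F'"
  using assms(1) unfolding connected_by_def assms(2)[symmetric]
  by (auto intro!: linked_map[OF _ assms(3)])

lemma connected_by_weaken:
  assumes "connected_by V F" and "\<And>x y. {x, y} \<in> F \<Longrightarrow> linked F' x y"
  shows "connected_by V F'"
  using connected_by_map[of V F id V F'] assms by auto

lemma connected_by_mono: "connected_by V F \<Longrightarrow> F \<subseteq> F' \<Longrightarrow> connected_by V F'"
  by (rule connected_by_weaken) (auto intro: linked_step)

lemma connected_by_extend:
  assumes "connected_by V F" and "a \<in> V" and "linked F' a w"
    and "\<And>x y. {x, y} \<in> F \<Longrightarrow> linked F' x y"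
  shows "connected_by (insert w V) F'"
proof (rule connected_byI)
  show "a \<in> insert w V" using assms by simp
  have "connected_by V F'" using assms(1,4) by (rule connected_by_weaken)
  then show "linked F' a v" if "v \<in> insert w V" for v
    using that assms(2,3) by (auto simp: connected_by_def)
qed

lemma connected_by_first_edge:
  assumes "connected_by V F" and "w \<in> V" and "z \<in> V" and "z \<noteq> w"
  obtains y where "{w, y} \<in> F" and "y \<noteq> w"
proof -
  have "linked F w z" using assms by (simp add: connected_by_def)
  then have "z = w \<or> (\<exists>y. {w, y} \<in> F \<and> y \<noteq> w)"
    by (induction rule: linked_induct) auto
  then show thesis using assms(4) that by blast
qed

lemma connected_by_loop:
  "connected_by V (insert {x} F) \<longleftrightarrow> connected_by V F"
proof
  assume "connected_by V (insert {x} F)"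
  then show "connected_by V F"
    by (rule connected_by_weaken) (auto simp: doubleton_eq_iff intro: linked_step)
qed (erule connected_by_mono, blast)

text \<open>Retracting \<open>w\<close> onto \<open>a\<close> collapses the edge from
  \<open>a\<close> to \<open>w\<close> and turns the edge from \<open>w\<close> to \<open>b\<close>
  into one from \<open>a\<close> to \<open>b\<close>. Conversely, the path through \<open>w\<close>
  replaces the edge from \<open>a\<close> to \<open>b\<close>.\<close>

lemma connected_by_subdivide:
  assumes "w \<notin> V" and "\<Union> F \<subseteq> V" and "a \<in> V" and "b \<in> V"
  shows "connected_by (insert w V) (insert {a, w} (insert {w, b} F)) \<longleftrightarrow>
    connected_by V (insert {a, b} F)"
proof
  let ?\<phi> = "\<lambda>x. if x = w then a else x"
  assume "connected_by (insert w V) (insert {a, w} (insert {w, b} F))"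
  then show "connected_by V (insert {a, b} F)"
  proof (rule connected_by_map)
    show "?\<phi> ` insert w V = V" using assms by (auto split: if_splits)
    fix x y assume "{x, y} \<in> insert {a, w} (insert {w, b} F)"
    then consider "{x, y} = {a, w}" | "{x, y} = {w, b}" | "{x, y} \<in> F" by blast
    then show "linked (insert {a, b} F) (?\<phi> x) (?\<phi> y)"
    proof cases
      case 1
      then show ?thesis using assms by (auto simp: doubleton_eq_iff)
    next
      case 2
      then show ?thesis using assms
        by (auto simp: doubleton_eq_iff insert_commute intro!: linked_step)
    next
      case 3
      then have "x \<in> V" "y \<in> V" using assms by auto
      then show ?thesis using 3 assms by (auto intro!: linked_step)
    qed
  qed
next
  let ?F' = "insert {a, w} (insert {w, b} F)"
  assume "connected_by V (insert {a, b} F)"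
  then show "connected_by (insert w V) ?F'"
  proof (rule connected_by_extend)
    show "a \<in> V" by fact
    show "linked ?F' a w" by (rule linked_step) simp
    fix x y assume xy: "{x, y} \<in> insert {a, b} F"
    have "linked ?F' a b" by (rule linked_trans[of _ a w]) (auto intro: linked_step)
    then show "linked ?F' x y"
      using xy by (auto simp: doubleton_eq_iff intro: linked_step linked_sym)
  qed
qed

text \<open>The same retraction of \<open>w\<close> onto \<open>a\<close>; this time the only edge
  at \<open>w\<close> collapses.\<close>

lemma connected_by_pendant:
  assumes "w \<notin> V" and "\<Union> F \<subseteq> V" and "a \<in> V"
  shows "connected_by (insert w V) (insert {a, w} F) \<longleftrightarrow> connected_by V F"
proof
  let ?\<phi> = "\<lambda>x. if x = w then a else x"
  assume "connected_by (insert w V) (insert {a, w} F)"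
  then show "connected_by V F"
  proof (rule connected_by_map)
    show "?\<phi> ` insert w V = V" using assms by (auto split: if_splits)
    fix x y assume "{x, y} \<in> insert {a, w} F"
    then consider "{x, y} = {a, w}" | "{x, y} \<in> F" by blast
    then show "linked F (?\<phi> x) (?\<phi> y)"
    proof cases
      case 1
      then show ?thesis using assms by (auto simp: doubleton_eq_iff)
    next
      case 2
      then have "x \<in> V" "y \<in> V" using assms by auto
      then show ?thesis using 2 assms by (auto intro!: linked_step)
    qed
  qed
next
  assume "connected_by V F"
  then show "connected_by (insert w V) (insert {a, w} F)"
    by (rule connected_by_extend) (use assms in \<open>auto intro: linked_step\<close>)
qed

lemma not_connected_by_isolated:
  assumes "w \<notin> V" and "\<Union> F \<subseteq> V" and "V \<noteq> {}"
  shows "\<not> connected_by (insert w V) F"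
proof
  assume con: "connected_by (insert w V) F"
  obtain z where z: "z \<in> V" using assms by blast
  show False
  proof (rule connected_by_first_edge[OF con])
    show "w \<in> insert w V" by simp
    show "z \<in> insert w V" "z \<noteq> w" using z assms by auto
    fix y assume "{w, y} \<in> F"
    then show False using assms by auto
  qed
qed

lemma linked_path:
  assumes "linked F u v"
  obtains p n where "p 0 = u" "p n = v" "inj_on p {..n::nat}"
    "\<forall>i<n. {p i, p (Suc i)} \<in> F"
proof -
  from assms have "\<exists>p n. p 0 = u \<and> p n = v \<and> inj_on p {..n::nat} \<and>
    (\<forall>i<n. {p i, p (Suc i)} \<in> F)"
  proof (induction rule: linked_induct)
    case refl
    show ?case by (rule exI[of _ "\<lambda>_. u"], rule exI[of _ 0]) simp
  next
    case (step x y)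
    then obtain p n where p: "p 0 = u" "p n = x" "inj_on p {..n::nat}"
      "\<forall>i<n. {p i, p (Suc i)} \<in> F" by blast
    \<comment> \<open>A walk that returns to its path is cut at the repeated vertex; otherwise the
      path grows by one vertex.\<close>
    show ?case
    proof (cases "y \<in> p ` {..n}")
      case True
      then obtain k where k: "k \<le> n" "p k = y" by auto
      have "inj_on p {..k}" using p(3) by (rule inj_on_subset) (use k in auto)
      then show ?thesis
        using p k by (intro exI[of _ p] exI[of _ k]) auto
    next
      case False
      have "inj_on (p(Suc n := y)) (insert (Suc n) {..n})"
        using p(3) False by (subst inj_on_insert) (auto intro!: inj_onI dest: inj_onD)
      then have "inj_on (p(Suc n := y)) {..Suc n}" by (simp add: atMost_Suc)
      then show ?thesis using p step.hyps
        by (intro exI[of _ "p(Suc n := y)"] exI[of _ "Suc n"]) (auto simp: less_Suc_eq fun_upd_def)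
    qed
  qed
  then show thesis using that by blast
qed


section \<open>Spanning trees as minimal connecting edge sets\<close>

lemma spanning_is_cycle:
  assumes "T \<subseteq> medges G"
  shows "is_cycle (spanning G T) vs es \<longleftrightarrow> is_cycle G vs es \<and> set es \<subseteq> T"
  using assms by (auto simp: is_cycle_def spanning_def)

text \<open>The last edge of the cycle joins the two ends of the path formed by the others, so that
  path can replace it. For a loop the path is a single vertex.\<close>

lemma cycle_edge_removable:
  assumes cyc: "is_cycle G vs es" and T: "set es \<subseteq> T"
    and con: "connected_by V (mends G ` T)"
  shows "\<exists>f\<in>T. connected_by V (mends G ` (T - {f}))"
proof -
  define n where "n = length vs - 1"
  have len: "length vs = Suc n" "length es = Suc n"
    using cyc by (auto simp: is_cycle_def n_def)
  define f where "f = es ! n"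
  let ?F = "mends G ` (T - {f})"
  have ends: "mends G (es ! i) = {vs ! i, vs ! (Suc i mod Suc n)}" if "i \<le> n" for i
    using cyc that len by (auto simp: is_cycle_def)
  have f: "f \<in> T" "mends G f = {vs ! n, vs ! 0}"
    using T len ends[of n] by (auto simp: f_def)
  have link: "linked ?F (vs ! 0) (vs ! i)" if "i \<le> n" for i
    using that
  proof (induction i)
    case (Suc i)
    have "es ! i \<noteq> f"
      using cyc Suc.prems len by (simp add: is_cycle_def f_def nth_eq_iff_index_eq)
    then have "es ! i \<in> T - {f}" using T len Suc.prems by auto
    then have "mends G (es ! i) \<in> ?F" by blast
    then have "linked ?F (vs ! i) (vs ! Suc i)"
      using ends[of i] Suc.prems by (intro linked_step) simp
    then show ?case using Suc by (auto intro: linked_trans)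
  qed simp
  have "connected_by V ?F"
    using con
  proof (rule connected_by_weaken)
    fix x y assume "{x, y} \<in> mends G ` T"
    then consider "{x, y} \<in> ?F" | "{x, y} = {vs ! n, vs ! 0}" using f by auto
    then show "linked ?F x y"
      using link[of n] by cases (auto simp: doubleton_eq_iff intro: linked_step linked_sym)
  qed
  then show ?thesis using f by blast
qed

text \<open>If \<open>T - {f}\<close> still connects, it contains a path between the ends of
  \<open>f\<close>, which \<open>f\<close> closes to a cycle. A loop gives the path with
  \<open>n = 0\<close>.\<close>

lemma removable_edge_cycle:
  assumes G: "multigraph G" and T: "T \<subseteq> medges G" "f \<in> T"
    and con: "connected_by (mverts G) (mends G ` (T - {f}))"
  shows "\<exists>vs es. is_cycle G vs es \<and> set es \<subseteq> T"
proof -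
  have f: "mends G f \<subseteq> mverts G" "card (mends G f) = 1 \<or> card (mends G f) = 2"
    using G T by (auto simp: multigraph_def)
  then obtain x y where xy: "mends G f = {x, y}" by (auto simp: card_2_iff card_1_singleton_iff)
  then have V: "x \<in> mverts G" "y \<in> mverts G" using f by auto
  then have "linked (mends G ` (T - {f})) x y" using con by (simp add: connected_by_def)
  then obtain p n where p: "p 0 = x" "p n = y" "inj_on p {..n::nat}"
    "\<forall>i<n. {p i, p (Suc i)} \<in> mends G ` (T - {f})" by (rule linked_path)
  then have "\<forall>i. \<exists>h. i < n \<longrightarrow> h \<in> T - {f} \<and> mends G h = {p i, p (Suc i)}" by blast
  then obtain q where q: "\<And>i. i < n \<Longrightarrow> q i \<in> T - {f} \<and> mends G (q i) = {p i, p (Suc i)}"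
    by metis
  define vs where "vs = map p [0..<Suc n]"
  define es where "es = map q [0..<n] @ [f]"
  \<comment> \<open>The chosen edges of the path are distinct because their pairs of ends are: the
    vertices of the path do not repeat.\<close>
  have "inj_on q {..<n}"
  proof (rule inj_onI)
    fix i j assume ij: "i \<in> {..<n}" "j \<in> {..<n}" "q i = q j"
    then have "{p i, p (Suc i)} = {p j, p (Suc j)}" using q by (metis lessThan_iff)
    moreover have "p k = p l \<longleftrightarrow> k = l" if "k \<le> n" "l \<le> n" for k l
      using p(3) that by (simp add: inj_on_eq_iff)
    ultimately show "i = j" using ij by (auto simp: doubleton_eq_iff)
  qed
  moreover have "f \<notin> q ` {..<n}" using q by blast
  ultimately have "distinct es" by (simp add: es_def distinct_map lessThan_atLeast0)
  moreover have "distinct vs"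
    using p(3) unfolding vs_def distinct_map by (simp add: atMost_upto del: upt_Suc)
  moreover have "set vs \<subseteq> mverts G"
  proof -
    have "p i \<in> mverts G" if "i \<le> n" for i
    proof (cases i)
      case (Suc j)
      then have "q j \<in> medges G" "mends G (q j) = {p j, p i}" using q[of j] that T by auto
      then show ?thesis using G unfolding multigraph_def by blast
    qed (use p V in auto)
    then show ?thesis by (auto simp: vs_def)
  qed
  moreover have "mends G (es ! i) = {vs ! i, vs ! (Suc i mod length vs)}"
    if "i < length vs" for i
    using that q[of i] p(1,2) xy
    by (cases "i = n") (auto simp: vs_def es_def nth_append nth_map_upt simp del: upt_Suc)
  moreover have "set es \<subseteq> T" using q T by (auto simp: es_def)
  ultimately have "is_cycle G vs es"
    using T by (auto simp: is_cycle_def vs_def es_def)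
  then show ?thesis using \<open>set es \<subseteq> T\<close> by blast
qed

text \<open>Only single deletions are tested, which for the monotone predicate
  \<open>connects G\<close> amounts to minimality. Keeping \<open>c\<close> abstract lets a graph
  operation enter solely through its effect on the predicate.\<close>

definition minimal_sets :: "('e set \<Rightarrow> bool) \<Rightarrow> 'e set \<Rightarrow> 'e set set" where
  "minimal_sets c E = {T. T \<subseteq> E \<and> c T \<and> (\<forall>f\<in>T. \<not> c (T - {f}))}"

abbreviation connects :: "('v, 'e) mgraph \<Rightarrow> 'e set \<Rightarrow> bool" where
  "connects G T \<equiv> connected_by (mverts G) (mends G ` T)"

definition spanning_trees :: "('v, 'e) mgraph \<Rightarrow> 'e set set" where
  "spanning_trees G = {T. spanning_tree G T}"

lemma spanning_trees_minimal:
  assumes "multigraph G"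
  shows "spanning_trees G = minimal_sets (connects G) (medges G)"
proof -
  have "spanning_tree G T \<longleftrightarrow> T \<in> minimal_sets (connects G) (medges G)" for T
  proof (cases "T \<subseteq> medges G")
    case True
    then have "medges G \<inter> T = T" by blast
    then have "spanning_tree G T \<longleftrightarrow>
      connects G T \<and> \<not> (\<exists>vs es. is_cycle G vs es \<and> set es \<subseteq> T)"
      using True spanning_is_cycle[OF True]
      by (auto simp: spanning_tree_def is_tree_def mconnected_def spanning_def)
    then show ?thesis
      using True cycle_edge_removable[of G _ _ T "mverts G"] removable_edge_cycle[OF assms True]
      by (simp add: minimal_sets_def) blast
  qed (auto simp: spanning_tree_def minimal_sets_def)
  then show ?thesis by (auto simp: spanning_trees_def)
qed

text \<open>Effect on the family of spanning trees of adding an edge \<open>g\<close> parallel to \<open>f\<close>, and of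
  subdividing \<open>f\<close> into the path \<open>f, g\<close>.\<close>

definition double_in :: "'e \<Rightarrow> 'e \<Rightarrow> 'e set set \<Rightarrow> 'e set set" where
  "double_in f g F = {T. g \<notin> T \<and> T \<in> F \<or> g \<in> T \<and> f \<notin> T \<and> insert f (T - {g}) \<in> F}"

definition subdivide_in :: "'e \<Rightarrow> 'e \<Rightarrow> 'e set set \<Rightarrow> 'e set set" where
  "subdivide_in f g F =
    {T. f \<in> T \<and> g \<in> T \<and> T - {g} \<in> F \<or> (f \<in> T) \<noteq> (g \<in> T) \<and> T - {f, g} \<in> F}"

section \<open>Minimal sets under doubling, subdivision, pendant edges and loops\<close>

lemma minimal_sets_double:
  assumes "f \<in> E" "g \<notin> E" "\<And>T. T \<subseteq> E \<Longrightarrow> c T = c0 T"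
    and c: "\<And>T. T \<subseteq> insert g E \<Longrightarrow> g \<in> T \<Longrightarrow> c T = c0 (insert f (T - {g}))"
  shows "minimal_sets c (insert g E) = double_in f g (minimal_sets c0 E)"
proof (rule set_eqI)
  fix T
  have fg: "f \<noteq> g" using assms by blast
  consider "g \<notin> T" | "g \<in> T" "f \<in> T" | "g \<in> T" "f \<notin> T" "T \<subseteq> insert g E" | "\<not> T \<subseteq> insert g E"
    by blast
  then show "T \<in> minimal_sets c (insert g E) \<longleftrightarrow> T \<in> double_in f g (minimal_sets c0 E)"
  proof cases
    case 1
    then have "T \<subseteq> insert g E \<longleftrightarrow> T \<subseteq> E" by blast
    moreover have "T \<subseteq> E \<Longrightarrow> c (T - {h}) = c0 (T - {h})" for h using assms(3) by blast
    ultimately show ?thesis using 1 assms(3) by (auto simp: minimal_sets_def double_in_def)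
  next
    case 2
    have "c (T - {g}) = c T" if "T \<subseteq> insert g E"
    proof -
      have "insert f (T - {g}) = T - {g}" using 2 fg by blast
      moreover have "c (T - {g}) = c0 (T - {g})" using that by (intro assms(3)) blast
      ultimately show ?thesis using that 2 c by simp
    qed
    then show ?thesis using 2 by (auto simp: minimal_sets_def double_in_def)
  next
    case 3
    \<comment> \<open>Exchanging \<open>g\<close> for \<open>f\<close> carries the removals from
      \<open>T\<close> to the removals from \<open>?T\<close>, with the removal of \<open>g\<close>
      becoming that of \<open>f\<close>.\<close>
    let ?T = "insert f (T - {g})"
    have "c T = c0 ?T" using 3 c by blast
    moreover have "?T \<subseteq> E" using 3 assms by blast
    moreover have "c (T - {g}) = c0 (?T - {f})"
    proof -
      have "?T - {f} = T - {g}" using 3 by blast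
      moreover have "c (T - {g}) = c0 (T - {g})" using 3 by (intro assms(3)) blast
      ultimately show ?thesis by simp
    qed
    moreover have "c (T - {h}) = c0 (?T - {h})" if "h \<in> T - {g}" for h
    proof -
      have "insert f (T - {h} - {g}) = ?T - {h}" using 3 that by blast
      moreover have "c (T - {h}) = c0 (insert f (T - {h} - {g}))"
        by (rule c) (use 3 that in auto)
      ultimately show ?thesis by simp
    qed
    moreover have "T = insert g (T - {g})" using 3 by blast
    ultimately have "(\<forall>h\<in>T. \<not> c (T - {h})) \<longleftrightarrow> (\<forall>h\<in>?T. \<not> c0 (?T - {h}))"
      by (metis (no_types, lifting) insert_iff)
    then show ?thesis
      using 3 \<open>c T = c0 ?T\<close> \<open>?T \<subseteq> E\<close> by (simp add: minimal_sets_def double_in_def)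
  next
    case 4
    then show ?thesis using assms by (auto simp: minimal_sets_def double_in_def)
  qed
qed

text \<open>The hypotheses describe the new vertex in the middle of \<open>f\<close>: with both
  halves present the path acts as \<open>f\<close>, with exactly one half the vertex is pendant and
  \<open>f\<close> counts as absent, and with none it is isolated.\<close>

lemma minimal_sets_subdivide:
  assumes "f \<in> E" "g \<notin> E"
    and c2: "\<And>T. T \<subseteq> insert g E \<Longrightarrow> f \<in> T \<Longrightarrow> g \<in> T \<Longrightarrow> c T = c0 (T - {g})"
    and c1: "\<And>T. T \<subseteq> insert g E \<Longrightarrow> (f \<in> T) \<noteq> (g \<in> T) \<Longrightarrow> c T = c0 (T - {f, g})"
    and c0: "\<And>T. T \<subseteq> insert g E \<Longrightarrow> f \<notin> T \<Longrightarrow> g \<notin> T \<Longrightarrow> \<not> c T"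
  shows "minimal_sets c (insert g E) = subdivide_in f g (minimal_sets c0 E)"
proof (rule set_eqI)
  fix T
  have fg: "f \<noteq> g" using assms by blast
  consider "\<not> T \<subseteq> insert g E" | "f \<in> T" "g \<in> T" "T \<subseteq> insert g E"
    | "(f \<in> T) \<noteq> (g \<in> T)" "T \<subseteq> insert g E" | "f \<notin> T" "g \<notin> T" "T \<subseteq> insert g E"
    by blast
  then show "T \<in> minimal_sets c (insert g E) \<longleftrightarrow> T \<in> subdivide_in f g (minimal_sets c0 E)"
  proof cases
    case 1
    then show ?thesis using assms(1) by (auto simp: minimal_sets_def subdivide_in_def)
  next
    case 2
    have sub: "T - {h} \<subseteq> insert g E" for h using 2 by blast
    have "c (T - {h}) = c0 (T - {g} - {h})" if "h \<in> T - {g}" for h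
    proof (cases "h = f")
      case True
      have "T - {f} - {f, g} = T - {g} - {f}" by blast
      then show ?thesis using c1[OF sub[of f]] 2 fg True by simp
    next
      case False
      have "T - {h} - {g} = T - {g} - {h}" by blast
      then show ?thesis using c2[OF sub[of h]] 2 False that by fastforce
    qed
    moreover have "c (T - {g}) = c0 (T - {g} - {f})"
    proof -
      have "T - {g} - {f, g} = T - {g} - {f}" by blast
      then show ?thesis using c1[OF sub[of g]] 2 fg by simp
    qed
    moreover have "T - {g} \<subseteq> E" using 2 by blast
    moreover have "c T = c0 (T - {g})" using c2 2 by blast
    ultimately show ?thesis using 2 fg
      by (simp add: minimal_sets_def subdivide_in_def) blast
  next
    case 3
    have sub: "T - {h} \<subseteq> insert g E" for h using 3 by blast
    have "c (T - {h}) = c0 (T - {f, g} - {h})" if "h \<in> T - {f, g}" for h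
    proof -
      have "T - {h} - {f, g} = T - {f, g} - {h}" by blast
      then show ?thesis using c1[OF sub[of h]] 3 that by auto
    qed
    moreover have "\<not> c (T - {h})" if "h \<in> T" "h = f \<or> h = g" for h
      using c0[OF sub[of h]] 3 that by auto
    moreover have "T - {f, g} \<subseteq> E" using 3 by blast
    moreover have "c T = c0 (T - {f, g})" using c1 3 by blast
    ultimately show ?thesis using 3 fg
      by (simp add: minimal_sets_def subdivide_in_def) blast
  next
    case 4
    then show ?thesis using c0 by (simp add: minimal_sets_def subdivide_in_def)
  qed
qed

text \<open>The predicate fails without \<open>f\<close>, so \<open>f\<close> lies in every minimal
  set and only removals of other elements have to be compared.\<close>

lemma minimal_sets_pendant:
  assumes "f \<notin> E" and "\<And>T. T \<subseteq> insert f E \<Longrightarrow> c T \<longleftrightarrow> f \<in> T \<and> c0 (T - {f})"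
  shows "minimal_sets c (insert f E) = insert f ` minimal_sets c0 E"
proof (rule set_eqI)
  fix T
  have c: "c (T - {h}) \<longleftrightarrow> f \<in> T \<and> h \<noteq> f \<and> c0 (T - {f} - {h})" if "T \<subseteq> insert f E" for h
  proof -
    have "T - {h} - {f} = T - {f} - {h}" by blast
    then show ?thesis using assms(2)[of "T - {h}"] that by auto
  qed
  have "T \<in> minimal_sets c (insert f E) \<longleftrightarrow> f \<in> T \<and> T - {f} \<in> minimal_sets c0 E"
    using c assms by (auto simp: minimal_sets_def)
  also have "\<dots> \<longleftrightarrow> T \<in> insert f ` minimal_sets c0 E"
  proof
    assume "f \<in> T \<and> T - {f} \<in> minimal_sets c0 E"
    then show "T \<in> insert f ` minimal_sets c0 E" by (metis image_eqI insert_Diff)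
  next
    assume "T \<in> insert f ` minimal_sets c0 E"
    then obtain S where "T = insert f S" "S \<in> minimal_sets c0 E" by blast
    moreover from this have "T - {f} = S" using assms(1) by (auto simp: minimal_sets_def)
    ultimately show "f \<in> T \<and> T - {f} \<in> minimal_sets c0 E" by simp
  qed
  finally show "T \<in> minimal_sets c (insert f E) \<longleftrightarrow> T \<in> insert f ` minimal_sets c0 E" .
qed

lemma minimal_sets_loop:
  assumes "f \<notin> E" and "\<And>T. T \<subseteq> insert f E \<Longrightarrow> c T \<longleftrightarrow> c0 (T - {f})"
  shows "minimal_sets c (insert f E) = minimal_sets c0 E"
proof (rule set_eqI)
  fix T
  show "T \<in> minimal_sets c (insert f E) \<longleftrightarrow> T \<in> minimal_sets c0 E"
  proof (cases "f \<in> T")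
    case True
    then have "c (T - {f}) = c T" if "T \<subseteq> insert f E"
      using assms(2)[of T] assms(2)[of "T - {f}"] that by auto
    then show ?thesis using True assms(1) by (auto simp: minimal_sets_def)
  next
    case False
    have "c (T - {h}) = c0 (T - {h})" if "T \<subseteq> E" for h
    proof -
      have "T - {h} \<subseteq> insert f E" "T - {h} - {f} = T - {h}" using that False by auto
      then show ?thesis using assms(2)[of "T - {h}"] by simp
    qed
    moreover have "c T = c0 T" if "T \<subseteq> E"
    proof -
      have "T \<subseteq> insert f E" "T - {f} = T" using that False by auto
      then show ?thesis using assms(2)[of T] by simp
    qed
    moreover have "T \<subseteq> insert f E \<longleftrightarrow> T \<subseteq> E" using False by blast
    ultimately show ?thesis by (auto simp: minimal_sets_def)
  qed
qed


section \<open>Operations on multigraphs\<close>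

text \<open>The ends are added to the vertices, so that one operation covers parallel edges, loops
  and pendant edges with a new end.\<close>

definition add_edge :: "('v, 'e) mgraph \<Rightarrow> 'e \<Rightarrow> 'v set \<Rightarrow> ('v, 'e) mgraph" where
  "add_edge G f A =
    \<lparr>mverts = mverts G \<union> A, medges = insert f (medges G), mends = (mends G)(f := A)\<rparr>"

text \<open>The name \<open>f\<close> stays with the half at \<open>a\<close>, matching the
  replacement of the leaf \<open>f\<close> by a composition of \<open>f\<close> and
  \<open>g\<close>. The ends are passed explicitly because \<open>mends G f\<close> is unordered and
  the halves have to be assigned.\<close>

definition subdivide_edge ::
    "('v, 'e) mgraph \<Rightarrow> 'e \<Rightarrow> 'v \<Rightarrow> 'v \<Rightarrow> 'e \<Rightarrow> 'v \<Rightarrow> ('v, 'e) mgraph" where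
  "subdivide_edge G f a b g w =
    \<lparr>mverts = insert w (mverts G), medges = insert g (medges G),
     mends = (mends G)(f := {a, w}, g := {w, b})\<rparr>"

lemma multigraph_ends: "multigraph G \<Longrightarrow> f \<in> medges G \<Longrightarrow> mends G f \<subseteq> mverts G"
  by (simp add: multigraph_def)

lemma multigraph_Union_ends: "multigraph G \<Longrightarrow> T \<subseteq> medges G \<Longrightarrow> \<Union> (mends G ` T) \<subseteq> mverts G"
  by (force simp: multigraph_def)

lemma multigraph_add_edge:
  assumes "multigraph G" and "card A = 1 \<or> card A = 2"
  shows "multigraph (add_edge G f A)"
  using assms by (auto simp: multigraph_def add_edge_def intro!: card_ge_0_finite)

lemma multigraph_subdivide_edge:
  assumes "multigraph G" and "a \<in> mverts G" "b \<in> mverts G" and "w \<notin> mverts G"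
  shows "multigraph (subdivide_edge G f a b g w)"
  using assms by (auto simp: multigraph_def subdivide_edge_def card_insert_if)

lemma image_mends_add_edge:
  "mends (add_edge G f A) ` T =
    (if f \<in> T then insert A (mends G ` (T - {f})) else mends G ` T)"
  by (auto simp: add_edge_def image_iff)

lemma spanning_trees_add_parallel:
  assumes G: "multigraph G" and f: "f \<in> medges G" and g: "g \<notin> medges G"
  shows "spanning_trees (add_edge G g (mends G f)) = double_in f g (spanning_trees G)"
proof -
  let ?G = "add_edge G g (mends G f)"
  have G': "multigraph ?G"
    using G f by (intro multigraph_add_edge) (auto simp: multigraph_def)
  have V: "mverts ?G = mverts G" using multigraph_ends[OF G f] by (auto simp: add_edge_def)
  have E: "medges ?G = insert g (medges G)" by (simp add: add_edge_def)
  show ?thesis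
    unfolding spanning_trees_minimal[OF G] spanning_trees_minimal[OF G'] E V
    by (rule minimal_sets_double)
      (use f g in \<open>auto simp: image_mends_add_edge\<close>)
qed

lemma spanning_trees_add_loop:
  assumes G: "multigraph G" and f: "f \<notin> medges G" and x: "x \<in> mverts G"
  shows "spanning_trees (add_edge G f {x}) = spanning_trees G"
proof -
  let ?G = "add_edge G f {x}"
  have G': "multigraph ?G" using G by (intro multigraph_add_edge) auto
  have V: "mverts ?G = mverts G" using x by (auto simp: add_edge_def)
  have E: "medges ?G = insert f (medges G)" by (simp add: add_edge_def)
  show ?thesis
    unfolding spanning_trees_minimal[OF G] spanning_trees_minimal[OF G'] E V
    by (rule minimal_sets_loop) (use f in \<open>auto simp: image_mends_add_edge connected_by_loop\<close>)
qed

lemma spanning_trees_add_pendant: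
  assumes G: "multigraph G" and f: "f \<notin> medges G" and w: "w \<notin> mverts G" and a: "a \<in> mverts G"
  shows "spanning_trees (add_edge G f {a, w}) = insert f ` spanning_trees G"
proof -
  let ?G = "add_edge G f {a, w}"
  have G': "multigraph ?G" using G a w by (intro multigraph_add_edge) (auto simp: card_insert_if)
  have V: "mverts ?G = insert w (mverts G)" using a by (auto simp: add_edge_def)
  have E: "medges ?G = insert f (medges G)" by (simp add: add_edge_def)
  show ?thesis
    unfolding spanning_trees_minimal[OF G] spanning_trees_minimal[OF G'] E V
  proof (rule minimal_sets_pendant[OF f])
    fix T assume T: "T \<subseteq> insert f (medges G)"
    then have "\<Union> (mends G ` (T - {f})) \<subseteq> mverts G"
      by (intro multigraph_Union_ends[OF G]) auto
    then show "connected_by (insert w (mverts G)) (mends ?G ` T) \<longleftrightarrow>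
        f \<in> T \<and> connects G (T - {f})"
      using connected_by_pendant[OF w _ a] not_connected_by_isolated[OF w, of "mends G ` T"] a
      by (auto simp: image_mends_add_edge)
  qed
qed

text \<open>According to which halves lie in \<open>T\<close>, the vertex \<open>w\<close> is the
  middle of a path, the end of a pendant edge, or isolated. The edges in \<open>T - {f, g}\<close>
  keep their ends.\<close>

lemma subdivide_edge_connects:
  assumes G: "multigraph G" and f: "f \<in> medges G" "mends G f = {a, b}"
    and g: "g \<notin> medges G" and w: "w \<notin> mverts G" and T: "T \<subseteq> insert g (medges G)"
  shows "connects (subdivide_edge G f a b g w) T \<longleftrightarrow>
    (if f \<in> T \<and> g \<in> T then connects G (T - {g})
     else (f \<in> T \<or> g \<in> T) \<and> connects G (T - {f, g}))"
proof -
  let ?F = "mends G ` (T - {f, g})"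
  have ab: "a \<in> mverts G" "b \<in> mverts G" using multigraph_ends[OF G f(1)] f by auto
  have fg: "f \<noteq> g" using f g by blast
  have F: "\<Union> ?F \<subseteq> mverts G" using T by (intro multigraph_Union_ends[OF G]) auto
  have V: "mverts (subdivide_edge G f a b g w) = insert w (mverts G)"
    by (simp add: subdivide_edge_def)
  have img: "mends (subdivide_edge G f a b g w) ` T =
      (if f \<in> T then {{a, w}} else {}) \<union> (if g \<in> T then {{b, w}} else {}) \<union> ?F"
    using fg by (auto simp: subdivide_edge_def image_iff insert_commute)
  consider "f \<in> T" "g \<in> T" | "f \<in> T" "g \<notin> T" | "f \<notin> T" "g \<in> T" | "f \<notin> T" "g \<notin> T" by blast
  then show ?thesis
  proof cases
    case 1
    have "T - {g} = insert f (T - {f, g})" using 1 fg by blast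
    then have "mends G ` (T - {g}) = insert {a, b} ?F" using f by simp
    moreover have "mends (subdivide_edge G f a b g w) ` T = insert {a, w} (insert {w, b} ?F)"
      using 1 unfolding img by (auto simp: insert_commute)
    ultimately show ?thesis
      using 1 connected_by_subdivide[OF w F ab] by (simp add: V)
  next
    case 2
    then show ?thesis using connected_by_pendant[OF w F ab(1)] by (simp add: V img)
  next
    case 3
    then show ?thesis using connected_by_pendant[OF w F ab(2)] by (simp add: V img)
  next
    case 4
    then show ?thesis using not_connected_by_isolated[OF w F] ab by (auto simp: V img)
  qed
qed

lemma spanning_trees_subdivide_edge:
  assumes G: "multigraph G" and f: "f \<in> medges G" "mends G f = {a, b}"
    and g: "g \<notin> medges G" and w: "w \<notin> mverts G"
  shows "spanning_trees (subdivide_edge G f a b g w) = subdivide_in f g (spanning_trees G)"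
proof -
  let ?G = "subdivide_edge G f a b g w"
  have ab: "a \<in> mverts G" "b \<in> mverts G" using multigraph_ends[OF G f(1)] f by auto
  have G': "multigraph ?G" using G ab w by (rule multigraph_subdivide_edge)
  have E: "medges ?G = insert g (medges G)" by (simp add: subdivide_edge_def)
  show ?thesis
    unfolding spanning_trees_minimal[OF G] spanning_trees_minimal[OF G'] E
    by (rule minimal_sets_subdivide)
      (use f g subdivide_edge_connects[OF G f g w] in auto)
qed

section \<open>Minors isomorphic to K4\<close>

definition has_K4 :: "'v set \<Rightarrow> 'v set set \<Rightarrow> bool" where
  "has_K4 V F \<longleftrightarrow> (\<exists>\<beta>. (\<forall>x<4::nat. \<beta> x \<subseteq> V \<and> connected_by (\<beta> x) {A \<in> F. A \<subseteq> \<beta> x}) \<and>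
     (\<forall>x<4. \<forall>y<4. x \<noteq> y \<longrightarrow> \<beta> x \<inter> \<beta> y = {} \<and> (\<exists>u\<in>\<beta> x. \<exists>v\<in>\<beta> y. {u, v} \<in> F)))"

text \<open>The minor depends only on the vertices and the set of pairs of ends. Adding a parallel
  edge therefore does not change it at all, and the remaining arguments are about families of
  sets.\<close>

lemma has_minor_K4:
  "has_minor G (complete_graph {..<4::nat}) \<longleftrightarrow> has_K4 (mverts G) (mends G ` medges G)"
proof -
  have con: "mconnected (minduced G X) \<longleftrightarrow> connected_by X {A \<in> mends G ` medges G. A \<subseteq> X}"
    if "X \<subseteq> mverts G" for X
  proof -
    have "mverts G \<inter> X = X" using that by blast
    moreover have "mends G ` {f \<in> medges G. mends G f \<subseteq> X} = {A \<in> mends G ` medges G. A \<subseteq> X}"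
      by blast
    ultimately show ?thesis by (simp add: mconnected_def minduced_def)
  qed
  have edge: "{x, y} \<in> sedges (complete_graph {..<4::nat}) \<longleftrightarrow> x < 4 \<and> y < 4 \<and> x \<noteq> y" for x y
    by (auto simp: complete_graph_def doubleton_eq_iff)
  have verts: "sverts (complete_graph {..<4::nat}) = {..<4}" by (simp add: complete_graph_def)
  have ex: "(\<exists>f\<in>medges G. \<exists>u\<in>X. \<exists>v\<in>Y. mends G f = {u, v}) \<longleftrightarrow>
      (\<exists>u\<in>X. \<exists>v\<in>Y. {u, v} \<in> mends G ` medges G)" for X Y
    by (auto simp: image_iff)
  show ?thesis
    unfolding has_minor_def has_K4_def edge verts ex Ball_def lessThan_iff
  proof (intro iff_exI)
    fix \<beta> :: "nat \<Rightarrow> 'a set"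
    have branch: "(\<beta> x \<subseteq> mverts G \<and> mconnected (minduced G (\<beta> x))) \<longleftrightarrow> (\<beta> x \<subseteq> mverts G \<and>
        connected_by (\<beta> x) {A \<in> mends G ` medges G. A \<subseteq> \<beta> x})" for x
      using con by blast
    show "((\<forall>x<4. \<beta> x \<subseteq> mverts G \<and> mconnected (minduced G (\<beta> x))) \<and>
        (\<forall>x<4. \<forall>y<4. x \<noteq> y \<longrightarrow> \<beta> x \<inter> \<beta> y = {}) \<and>
        (\<forall>x y. x < 4 \<and> y < 4 \<and> x \<noteq> y \<longrightarrow>
          (\<exists>u\<in>\<beta> x. \<exists>v\<in>\<beta> y. {u, v} \<in> mends G ` medges G))) \<longleftrightarrow>
      (\<forall>x<4. \<beta> x \<subseteq> mverts G \<and> connected_by (\<beta> x) {A \<in> mends G ` medges G. A \<subseteq> \<beta> x}) \<and>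
        (\<forall>x<4. \<forall>y<4. x \<noteq> y \<longrightarrow> \<beta> x \<inter> \<beta> y = {} \<and>
          (\<exists>u\<in>\<beta> x. \<exists>v\<in>\<beta> y. {u, v} \<in> mends G ` medges G))"
      by (simp only: branch) blast
  qed
qed

lemma series_parallel_K4:
  "series_parallel G \<longleftrightarrow> multigraph G \<and> \<not> has_K4 (mverts G) (mends G ` medges G)"
  by (simp add: series_parallel_def has_minor_K4)

lemma has_K4_mono:
  assumes "has_K4 V F" and "V \<subseteq> V'" and "F \<subseteq> F'"
  shows "has_K4 V' F'"
proof -
  obtain \<beta> where \<beta>: "\<forall>x<4::nat. \<beta> x \<subseteq> V \<and> connected_by (\<beta> x) {A \<in> F. A \<subseteq> \<beta> x}"
     "\<forall>x<4. \<forall>y<4. x \<noteq> y \<longrightarrow> \<beta> x \<inter> \<beta> y = {} \<and> (\<exists>u\<in>\<beta> x. \<exists>v\<in>\<beta> y. {u, v} \<in> F)"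
    using assms(1) unfolding has_K4_def by blast
  have "connected_by (\<beta> x) {A \<in> F'. A \<subseteq> \<beta> x}" if "x < 4" for x
    by (rule connected_by_mono[of _ "{A \<in> F. A \<subseteq> \<beta> x}"]) (use \<beta> that assms in auto)
  then show ?thesis
    unfolding has_K4_def using \<beta> assms(2,3) by (intro exI[of _ \<beta>]) blast
qed

lemma has_K4I:
  assumes "\<And>B. B \<in> {B0, B1, B2, B3} \<Longrightarrow> B \<subseteq> V \<and> connected_by B {A \<in> F. A \<subseteq> B}"
    and "B0 \<inter> B1 = {}" "B0 \<inter> B2 = {}" "B0 \<inter> B3 = {}" "B1 \<inter> B2 = {}" "B1 \<inter> B3 = {}" "B2 \<inter> B3 = {}"
    and "\<exists>u\<in>B0. \<exists>v\<in>B1. {u, v} \<in> F" "\<exists>u\<in>B0. \<exists>v\<in>B2. {u, v} \<in> F"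
      "\<exists>u\<in>B0. \<exists>v\<in>B3. {u, v} \<in> F" "\<exists>u\<in>B1. \<exists>v\<in>B2. {u, v} \<in> F"
      "\<exists>u\<in>B1. \<exists>v\<in>B3. {u, v} \<in> F" "\<exists>u\<in>B2. \<exists>v\<in>B3. {u, v} \<in> F"
  shows "has_K4 V F"
proof -
  define \<beta> where "\<beta> = (\<lambda>x::nat. [B0, B1, B2, B3] ! x)"
  have \<beta>: "\<beta> 0 = B0" "\<beta> 1 = B1" "\<beta> 2 = B2" "\<beta> 3 = B3" by (simp_all add: \<beta>_def)
  have four: "x < 4 \<longleftrightarrow> x = 0 \<or> x = 1 \<or> x = 2 \<or> x = 3" for x :: nat by auto
  have sym: "\<exists>u\<in>Y. \<exists>v\<in>X. {u, v} \<in> F" if asm: "\<exists>u\<in>X. \<exists>v\<in>Y. {u, v} \<in> F" for X Y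
  proof -
    obtain u v where uv: "u \<in> X" "v \<in> Y" "{u, v} \<in> F" using asm by blast
    then have "{v, u} \<in> F" by (simp add: insert_commute)
    then show ?thesis using uv by blast
  qed
  have 1: "\<forall>x<4. \<beta> x \<subseteq> V \<and> connected_by (\<beta> x) {A \<in> F. A \<subseteq> \<beta> x}"
  proof (intro allI impI)
    fix x :: nat assume "x < 4"
    then have "\<beta> x \<in> {B0, B1, B2, B3}" using \<beta> unfolding four by blast
    then show "\<beta> x \<subseteq> V \<and> connected_by (\<beta> x) {A \<in> F. A \<subseteq> \<beta> x}" by (rule assms(1))
  qed
  have 2: "\<beta> x \<inter> \<beta> y = {} \<and> (\<exists>u\<in>\<beta> x. \<exists>v\<in>\<beta> y. {u, v} \<in> F)" if "x < y" "y < 4" for x y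
  proof -
    have "(x, y) \<in> {(0,1), (0,2), (0,3), (1,2), (1,3), (2,3)}" using that by auto
    then consider "x = 0 \<and> y = 1" | "x = 0 \<and> y = 2" | "x = 0 \<and> y = 3"
      | "x = 1 \<and> y = 2" | "x = 1 \<and> y = 3" | "x = 2 \<and> y = 3" by blast
    then show ?thesis by cases (simp only: \<beta>, intro conjI assms)+
  qed
  have "\<beta> x \<inter> \<beta> y = {} \<and> (\<exists>u\<in>\<beta> x. \<exists>v\<in>\<beta> y. {u, v} \<in> F)" if "x < 4" "y < 4" "x \<noteq> y" for x y
  proof (cases "x < y")
    case True
    then show ?thesis using 2 that by blast
  next
    case False
    then have "\<beta> y \<inter> \<beta> x = {} \<and> (\<exists>u\<in>\<beta> y. \<exists>v\<in>\<beta> x. {u, v} \<in> F)" using 2 that by simp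
    then show ?thesis using sym by blast
  qed
  with 1 show ?thesis unfolding has_K4_def by blast
qed

text \<open>The new vertex joins the branch set of \<open>a\<close>, if there is one. It then serves
  both inside that set, when \<open>b\<close> is there too, and as the neighbour of the branch set
  containing \<open>b\<close>.\<close>

lemma has_K4_subdivide:
  assumes "w \<notin> V" and F: "\<Union> F \<subseteq> V" and "a \<in> V" "b \<in> V"
    and K4: "has_K4 V (insert {a, b} F)"
  shows "has_K4 (insert w V) (insert {a, w} (insert {w, b} F))"
proof -
  let ?F = "insert {a, b} F" and ?F' = "insert {a, w} (insert {w, b} F)"
  obtain \<beta> where con: "\<And>x. x < (4::nat) \<Longrightarrow> \<beta> x \<subseteq> V \<and> connected_by (\<beta> x) {A \<in> ?F. A \<subseteq> \<beta> x}"
    and dis: "\<And>x y. x < 4 \<Longrightarrow> y < 4 \<Longrightarrow> x \<noteq> y \<Longrightarrow> \<beta> x \<inter> \<beta> y = {}"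
    and adj: "\<And>x y. x < 4 \<Longrightarrow> y < 4 \<Longrightarrow> x \<noteq> y \<Longrightarrow> \<exists>u\<in>\<beta> x. \<exists>v\<in>\<beta> y. {u, v} \<in> ?F"
    using K4 unfolding has_K4_def by blast
  define \<gamma> where "\<gamma> x = (if a \<in> \<beta> x then insert w (\<beta> x) else \<beta> x)" for x
  have "connected_by (\<gamma> x) {A \<in> ?F'. A \<subseteq> \<gamma> x}" if x: "x < 4" for x
  proof (cases "a \<in> \<beta> x")
    case True
    let ?R = "{A \<in> ?F'. A \<subseteq> insert w (\<beta> x)}"
    have aw: "linked ?R a w" using True by (intro linked_step) auto
    have "connected_by (insert w (\<beta> x)) ?R"
      using con[OF x, THEN conjunct2] True aw
    proof (rule connected_by_extend)
      fix y z assume "{y, z} \<in> {A \<in> ?F. A \<subseteq> \<beta> x}"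
      then have yz: "y \<in> \<beta> x" "z \<in> \<beta> x" and "{y, z} = {a, b} \<or> {y, z} \<in> F" by auto
      then consider "{y, z} = {a, b}" "b \<in> \<beta> x" | "{y, z} \<in> F"
        by (auto simp: doubleton_eq_iff)
      then show "linked ?R y z"
      proof cases
        case 1
        then have "linked ?R w b" using True by (intro linked_step) auto
        with aw have "linked ?R a b" by (rule linked_trans)
        then show ?thesis using 1 by (auto simp: doubleton_eq_iff intro: linked_sym)
      qed (use yz in \<open>auto intro!: linked_step\<close>)
    qed
    then show ?thesis using True by (simp add: \<gamma>_def)
  next
    case False
    have "connected_by (\<beta> x) {A \<in> ?F'. A \<subseteq> \<beta> x}"
      by (rule connected_by_mono[OF con[OF x, THEN conjunct2]]) (use False in auto)
    then show ?thesis using False by (simp add: \<gamma>_def)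
  qed
  moreover have "\<gamma> x \<subseteq> insert w V" if "x < 4" for x
    using con[OF that] by (auto simp: \<gamma>_def)
  moreover have "\<gamma> x \<inter> \<gamma> y = {}" if "x < 4" "y < 4" "x \<noteq> y" for x y
    using dis[OF that] con[OF that(1)] con[OF that(2)] assms(1) by (auto simp: \<gamma>_def)
  moreover have "\<exists>u\<in>\<gamma> x. \<exists>v\<in>\<gamma> y. {u, v} \<in> ?F'" if xy: "x < 4" "y < 4" "x \<noteq> y" for x y
  proof -
    obtain u v where uv: "u \<in> \<beta> x" "v \<in> \<beta> y" "{u, v} \<in> ?F" using adj[OF xy] by blast
    then consider "u = a" "v = b" | "u = b" "v = a" | "{u, v} \<in> F"
      by (auto simp: doubleton_eq_iff)
    then show ?thesis
    proof cases
      case 1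
      then have "w \<in> \<gamma> x" "b \<in> \<gamma> y" using uv by (auto simp: \<gamma>_def)
      then show ?thesis by blast
    next
      case 2
      then have "b \<in> \<gamma> x" "w \<in> \<gamma> y" using uv by (auto simp: \<gamma>_def)
      moreover have "{b, w} \<in> ?F'" by (simp add: insert_commute)
      ultimately show ?thesis by blast
    next
      case 3
      moreover have "u \<in> \<gamma> x" "v \<in> \<gamma> y" using uv by (simp_all add: \<gamma>_def)
      ultimately show ?thesis by blast
    qed
  qed
  ultimately show ?thesis unfolding has_K4_def by (intro exI[of _ \<gamma>]) simp
qed

lemma has_K4_unsubdivide_strict:
  assumes w: "w \<notin> V" and F: "\<Union> F \<subseteq> V" and ab: "a \<in> V" "b \<in> V"
    and con: "\<And>x. x < (4::nat) \<Longrightarrow> \<beta> x \<subseteq> insert w V \<and>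
      connected_by (\<beta> x) {A \<in> insert {a, w} (insert {w, b} F). A \<subseteq> \<beta> x}"
    and dis: "\<And>x y. x < 4 \<Longrightarrow> y < 4 \<Longrightarrow> x \<noteq> y \<Longrightarrow> \<beta> x \<inter> \<beta> y = {}"
    and adj: "\<And>x y. x < 4 \<Longrightarrow> y < 4 \<Longrightarrow> x \<noteq> y \<Longrightarrow>
      \<exists>u\<in>\<beta> x. \<exists>v\<in>\<beta> y. {u, v} \<in> insert {a, w} (insert {w, b} F)"
    and a: "\<And>x. x < 4 \<Longrightarrow> w \<in> \<beta> x \<Longrightarrow> a \<in> \<beta> x"
  shows "has_K4 V (insert {a, b} F)"
proof -
  let ?F = "insert {a, b} F" and ?F' = "insert {a, w} (insert {w, b} F)"
  define \<phi> where "\<phi> y = (if y = w then a else y)" for y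
  have V: "y \<noteq> w" if "y \<in> V" for y using that w by blast
  have step: "linked {A \<in> ?F. A \<subseteq> \<beta> x - {w}} (\<phi> y) (\<phi> z)"
    if x: "x < 4" and yz: "{y, z} \<in> {A \<in> ?F'. A \<subseteq> \<beta> x}" for x y z
  proof -
    have sub: "y \<in> \<beta> x" "z \<in> \<beta> x" using yz by auto
    consider "{y, z} = {a, w}" | "{y, z} = {w, b}" | "{y, z} \<in> F" using yz by auto
    then show ?thesis
    proof cases
      case 1
      then show ?thesis using ab V by (auto simp: \<phi>_def doubleton_eq_iff)
    next
      case 2
      then have wb: "w \<in> \<beta> x" "b \<in> \<beta> x" using sub by (auto simp: doubleton_eq_iff)
      then have "linked {A \<in> ?F. A \<subseteq> \<beta> x - {w}} a b"
        using a[OF x] ab V by (intro linked_step) auto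
      then show ?thesis
        using 2 ab V by (auto simp: \<phi>_def doubleton_eq_iff intro: linked_sym)
    next
      case 3
      then have "y \<noteq> w" "z \<noteq> w" using F V by auto
      then show ?thesis using 3 sub by (auto simp: \<phi>_def intro!: linked_step)
    qed
  qed
  have "connected_by (\<beta> x - {w}) {A \<in> ?F. A \<subseteq> \<beta> x - {w}}" if x: "x < 4" for x
    using con[OF x, THEN conjunct2]
  proof (rule connected_by_map)
    show "\<phi> ` \<beta> x = \<beta> x - {w}"
      using a[OF x] ab V by (cases "w \<in> \<beta> x") (auto simp: \<phi>_def image_iff)
  qed (rule step[OF x])
  moreover have "\<beta> x - {w} \<subseteq> V" if "x < 4" for x using con[OF that] by blast
  moreover have "\<exists>u\<in>\<beta> x - {w}. \<exists>v\<in>\<beta> y - {w}. {u, v} \<in> ?F"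
    if xy: "x < 4" "y < 4" "x \<noteq> y" for x y
  proof -
    obtain u v where uv: "u \<in> \<beta> x" "v \<in> \<beta> y" "{u, v} \<in> ?F'" using adj[OF xy] by blast
    have "u \<noteq> w \<or> v \<noteq> w" using dis[OF xy] uv by blast
    have a_notin: "\<not> (w \<in> \<beta> x \<and> a \<in> \<beta> y)" "\<not> (w \<in> \<beta> y \<and> a \<in> \<beta> x)"
      using dis[OF xy] a xy by blast+
    consider "u = w" "v = b" | "v = w" "u = b" | "{u, v} \<in> F"
      using uv a_notin by (auto simp: doubleton_eq_iff)
    then show ?thesis
    proof cases
      case 1
      then have "a \<in> \<beta> x - {w}" "b \<in> \<beta> y - {w}" using uv a xy ab V by auto
      then show ?thesis by blast
    next
      case 2
      then have "b \<in> \<beta> x - {w}" "a \<in> \<beta> y - {w}" using uv a xy ab V by auto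
      moreover have "{b, a} \<in> ?F" by (simp add: insert_commute)
      ultimately show ?thesis by blast
    next
      case 3
      then have "u \<noteq> w" "v \<noteq> w" using F V by auto
      then show ?thesis using uv 3 by blast
    qed
  qed
  ultimately show ?thesis
    unfolding has_K4_def using dis by (intro exI[of _ "\<lambda>x. \<beta> x - {w}"]) blast
qed

text \<open>A branch set containing \<open>w\<close> also contains \<open>a\<close> or
  \<open>b\<close>. If it has further vertices, some edge leads from \<open>w\<close> to one of
  them; if it is \<open>{w}\<close>, three disjoint branch sets would each need one of the only two
  neighbours of \<open>w\<close>.\<close>

lemma has_K4_unsubdivide:
  assumes w: "w \<notin> V" and F: "\<Union> F \<subseteq> V" and ab: "a \<in> V" "b \<in> V"
    and K4: "has_K4 (insert w V) (insert {a, w} (insert {w, b} F))"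
  shows "has_K4 V (insert {a, b} F)"
proof -
  let ?F' = "insert {a, w} (insert {w, b} F)"
  obtain \<beta> where
    con: "\<And>x. x < (4::nat) \<Longrightarrow> \<beta> x \<subseteq> insert w V \<and> connected_by (\<beta> x) {A \<in> ?F'. A \<subseteq> \<beta> x}"
    and dis: "\<And>x y. x < 4 \<Longrightarrow> y < 4 \<Longrightarrow> x \<noteq> y \<Longrightarrow> \<beta> x \<inter> \<beta> y = {}"
    and adj: "\<And>x y. x < 4 \<Longrightarrow> y < 4 \<Longrightarrow> x \<noteq> y \<Longrightarrow> \<exists>u\<in>\<beta> x. \<exists>v\<in>\<beta> y. {u, v} \<in> ?F'"
    using K4 unfolding has_K4_def by blast
  have nbr: "v = a \<or> v = b" if "{w, v} \<in> ?F'" "v \<noteq> w" for v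
    using that F w by (auto simp: doubleton_eq_iff)
  have ab_in: "a \<in> \<beta> x \<or> b \<in> \<beta> x" if x: "x < 4" and wx: "w \<in> \<beta> x" for x
  proof (cases "\<beta> x = {w}")
    case True
    have ab_other: "a \<in> \<beta> y \<or> b \<in> \<beta> y" if y: "y < 4" "y \<noteq> x" for y
    proof -
      obtain v where v: "v \<in> \<beta> y" "{w, v} \<in> ?F'" using adj[OF x y(1)] y True by auto
      then have "v \<noteq> w" using dis[OF x y(1)] y wx by blast
      then show ?thesis using nbr v by blast
    qed
    \<comment> \<open>The three indices below 4 other than \<open>x\<close>.\<close>
    define i j k :: nat where "i = (if x = 0 then 1 else 0)"
      and "j = (if x \<le> 1 then 2 else 1)" and "k = (if x \<le> 2 then 3 else 2)"
    have ijk: "i < 4" "j < 4" "k < 4" "i \<noteq> x" "j \<noteq> x" "k \<noteq> x" "i \<noteq> j" "i \<noteq> k" "j \<noteq> k"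
      using x by (auto simp: i_def j_def k_def)
    have "\<beta> i \<inter> \<beta> j = {}" "\<beta> i \<inter> \<beta> k = {}" "\<beta> j \<inter> \<beta> k = {}"
      using ijk dis by auto
    then show ?thesis using ab_other[of i] ab_other[of j] ab_other[of k] ijk by blast
  next
    case False
    then obtain z where z: "z \<in> \<beta> x" "z \<noteq> w" using wx by blast
    show ?thesis
    proof (rule connected_by_first_edge[OF con[OF x, THEN conjunct2] wx z])
      fix y assume "{w, y} \<in> {A \<in> ?F'. A \<subseteq> \<beta> x}" "y \<noteq> w"
      then show ?thesis using nbr by auto
    qed
  qed
  have w_unique: "x = y" if "x < 4" "y < 4" "w \<in> \<beta> x" "w \<in> \<beta> y" for x y
    using dis that by blast
  \<comment> \<open>At most one branch set contains \<open>w\<close>, so one of \<open>a\<close> and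
    \<open>b\<close> serves for all \<open>x\<close>.\<close>
  consider "\<And>x. x < 4 \<Longrightarrow> w \<in> \<beta> x \<Longrightarrow> a \<in> \<beta> x" | "\<And>x. x < 4 \<Longrightarrow> w \<in> \<beta> x \<Longrightarrow> b \<in> \<beta> x"
    using ab_in w_unique by metis
  then show ?thesis
  proof cases
    case 1
    show ?thesis by (rule has_K4_unsubdivide_strict[OF w F ab con dis adj 1])
  next
    case 2
    have swap: "?F' = insert {b, w} (insert {w, a} F)" by (simp add: insert_commute)
    have "has_K4 V (insert {b, a} F)"
      by (rule has_K4_unsubdivide_strict[OF w F ab(2,1) con[unfolded swap] dis
          adj[unfolded swap] 2])
    then show ?thesis by (simp add: insert_commute)
  qed
qed

section \<open>A vertex with few neighbours in the absence of K4\<close>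

lemma connected_by_interval:
  assumes "a \<le> b" and edge: "\<And>i. a \<le> i \<Longrightarrow> i < b \<Longrightarrow> {p i, p (Suc i)} \<in> F"
  shows "connected_by (p ` {a..b}) {A \<in> F. A \<subseteq> p ` {a..b::nat}}"
proof (rule connected_byI)
  let ?F = "{A \<in> F. A \<subseteq> p ` {a..b}}"
  show "p a \<in> p ` {a..b}" using assms by simp
  have "linked ?F (p a) (p i)" if "a \<le> i" "i \<le> b" for i
    using that
  proof (induction i rule: dec_induct)
    case (step i)
    have "linked ?F (p i) (p (Suc i))" using step edge[of i] by (intro linked_step) auto
    then show ?case using step by (auto intro: linked_trans)
  qed simp
  then show "linked ?F (p a) v" if "v \<in> p ` {a..b}" for v using that by auto
qed

text \<open>The branch sets are the last vertex and three consecutive segments before it: one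
  containing both \<open>i\<close> and \<open>k\<close>, one ending at \<open>j\<close>, and one
  from \<open>j + 1\<close> to \<open>m - 1\<close>. The three chords supply the adjacencies that
  the path does not.\<close>

lemma path_chords_K4:
  fixes p :: "nat \<Rightarrow> 'v"
  assumes inj: "inj_on p {..m}" and V: "p ` {..m} \<subseteq> V"
    and edge: "\<And>i. i < m \<Longrightarrow> {p i, p (Suc i)} \<in> F"
    and idx: "i < j" "k < j" "Suc j < m"
    and ch: "{p m, p i} \<in> F" "{p m, p j} \<in> F" "{p (Suc j), p k} \<in> F"
  shows "has_K4 V F"
proof (rule has_K4I)
  \<comment> \<open>The chords may start in either order, even at the same vertex; the first segment
    has to span both. The vertices before \<open>l\<close> are discarded.\<close>
  define l h where "l = min i k" and "h = max i k"
  have lh: "l \<le> h" "h < j" using idx by (auto simp: l_def h_def)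
  have ik: "i \<in> {l..h}" "k \<in> {l..h}" by (auto simp: l_def h_def)
  have disj: "p ` A \<inter> p ` B = {}" if "A \<subseteq> {..m}" "B \<subseteq> {..m}" "A \<inter> B = {}" for A B
    using inj_on_image_Int[OF inj that(1,2)] that(3) by simp
  let ?B0 = "p ` {m..m}" and ?B1 = "p ` {l..h}" and ?B2 = "p ` {Suc h..j}"
    and ?B3 = "p ` {Suc j..m - 1}"
  show "B \<subseteq> V \<and> connected_by B {A \<in> F. A \<subseteq> B}" if B: "B \<in> {?B0, ?B1, ?B2, ?B3}" for B
  proof -
    consider "B = ?B0" | "B = ?B1" | "B = ?B2" | "B = ?B3" using B by blast
    then have "\<exists>s t. B = p ` {s..t} \<and> s \<le> t \<and> t \<le> m"
      by cases (rule exI, rule exI, rule conjI, assumption, use lh idx in simp)+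
    then obtain s t where st: "B = p ` {s..t}" "s \<le> t" "t \<le> m" by blast
    have "connected_by (p ` {s..t}) {A \<in> F. A \<subseteq> p ` {s..t}}"
      using st edge by (intro connected_by_interval) auto
    moreover have "p ` {s..t} \<subseteq> V" using V st by auto
    ultimately show ?thesis using st by simp
  qed
  show "?B0 \<inter> ?B1 = {}" "?B0 \<inter> ?B2 = {}" "?B0 \<inter> ?B3 = {}" "?B1 \<inter> ?B2 = {}"
    "?B1 \<inter> ?B3 = {}" "?B2 \<inter> ?B3 = {}"
    using lh idx by (intro disj; auto)+
  have bexI2: "\<exists>u\<in>p ` A. \<exists>v\<in>p ` B. {u, v} \<in> F" if "s \<in> A" "t \<in> B" "{p s, p t} \<in> F" for A B s t
    using that by blast
  show "\<exists>u\<in>?B0. \<exists>v\<in>?B1. {u, v} \<in> F" using ch(1) ik by (intro bexI2[of m _ i]) auto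
  show "\<exists>u\<in>?B0. \<exists>v\<in>?B2. {u, v} \<in> F" using ch(2) lh by (intro bexI2[of m _ j]) auto
  show "\<exists>u\<in>?B0. \<exists>v\<in>?B3. {u, v} \<in> F"
    using edge[of "m - 1"] idx by (intro bexI2[of m _ "m - 1"]) (auto simp: insert_commute)
  show "\<exists>u\<in>?B1. \<exists>v\<in>?B2. {u, v} \<in> F"
    using edge[of h] lh idx by (intro bexI2[of h _ "Suc h"]) auto
  show "\<exists>u\<in>?B1. \<exists>v\<in>?B3. {u, v} \<in> F"
    using ch(3) ik idx by (intro bexI2[of k _ "Suc j"]) (auto simp: insert_commute)
  show "\<exists>u\<in>?B2. \<exists>v\<in>?B3. {u, v} \<in> F"
    using edge[of j] lh idx by (intro bexI2[of j _ "Suc j"]) auto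
qed

lemma card_ge_3_avoid:
  assumes "\<not> card A \<le> 2"
  obtains z where "z \<in> A" "z \<noteq> x" "z \<noteq> y"
proof -
  have "\<not> A \<subseteq> {x, y}"
    using assms card_mono[of "{x, y}" A] by (auto simp: card_insert_if split: if_splits)
  then show thesis using that by blast
qed

text \<open>Take a longest path starting with the two ends of the given edge and, among these, one
  whose last vertex \<open>p m\<close> has a neighbour \<open>p j\<close> with \<open>j \<le> m - 2\<close> as late as possible. Rerouting
  the path through the edge from \<open>p j\<close> to \<open>p m\<close> makes \<open>p (j + 1)\<close> the last vertex; its third
  neighbour either contradicts the choice of \<open>j\<close> or gives two crossing chords.\<close>

lemma low_degree_vertex:
  fixes V :: "'v set"
  assumes fin: "finite V" and F: "\<Union> F \<subseteq> V" and con: "connected_by V F"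
    and uv: "u \<noteq> v" "{u, v} \<in> F" "V \<noteq> {u, v}" and K4: "\<not> has_K4 V F"
  shows "\<exists>w\<in>V - {u, v}. card {x. x \<noteq> w \<and> {w, x} \<in> F} \<le> 2"
proof (rule ccontr)
  define N where "N w = {x. x \<noteq> w \<and> {w, x} \<in> F}" for w
  assume "\<not> (\<exists>w\<in>V - {u, v}. card {x. x \<noteq> w \<and> {w, x} \<in> F} \<le> 2)"
  then have deg: "\<not> card (N w) \<le> 2" if "w \<in> V - {u, v}" for w
    using that by (simp add: N_def)
  \<comment> \<open>The path may start with \<open>u\<close> and \<open>v\<close> in either order,
    so that it can be continued from whichever of them has a neighbour elsewhere.\<close>
  define path where "path m p \<longleftrightarrow> inj_on p {..m::nat} \<and> {p 0, p 1} = {u, v} \<and> p ` {..m} \<subseteq> V \<and>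
    (\<forall>i<m. {p i, p (Suc i)} \<in> F)" for m p
  have uvV: "u \<in> V" "v \<in> V" using uv F by auto
  have "m \<le> card V" if "path m p" for m p
    using that card_inj_on_le[of p "{..m}" V] fin by (simp add: path_def)
  then have bounded: "\<forall>m. (\<exists>p. path m p) \<longrightarrow> m \<le> card V" by blast
  have path1: "path 1 (\<lambda>i. if i = 0 then a else b)" if "{a, b} = {u, v}" for a b
    using that uv uvV that[symmetric, THEN arg_cong, of "\<lambda>A. A \<in> F"]
    by (auto simp: path_def inj_on_def doubleton_eq_iff)
  define m where "m = (GREATEST m. \<exists>p. path m p)"
  have "\<exists>p. path 1 p" using path1[OF refl] by blast
  then have path_m: "\<exists>p. path m p" unfolding m_def by (rule GreatestI_nat[OF _ bounded[rule_format]])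
  have le_m: "m' \<le> m" if "path m' p" for m' p
    unfolding m_def using that bounded by (intro Greatest_le_nat) blast+
  have extend: "path (Suc m') (p(Suc m' := x))"
    if p: "path m' p" "x \<in> N (p m')" "x \<notin> p ` {..m'}" "1 \<le> m'" for m' p x
  proof -
    have "inj_on (p(Suc m' := x)) (insert (Suc m') {..m'})"
      using p by (subst inj_on_insert) (auto simp: path_def intro!: inj_onI dest: inj_onD)
    then have "inj_on (p(Suc m' := x)) {..Suc m'}" by (simp add: atMost_Suc)
    moreover have "x \<in> V" using p(2) F by (auto simp: N_def)
    ultimately show ?thesis
      using p by (auto simp: path_def N_def less_Suc_eq fun_upd_def)
  qed
  \<comment> \<open>An edge leaving \<open>{u, v}\<close> yields a path with three vertices. Hence
    the last vertex of a longest path differs from \<open>u\<close> and \<open>v\<close> and has at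
    least three neighbours.\<close>
  have "\<exists>x\<in>V - {u, v}. {u, x} \<in> F \<or> {v, x} \<in> F"
  proof (rule ccontr)
    assume *: "\<not> ?thesis"
    have "x = u \<or> x = v" if "linked F u x" for x
      using that
    proof (induction rule: linked_induct)
      case (step x y)
      then show ?case using * F by blast
    qed simp
    then show False using con uv uvV by (auto simp: connected_by_def)
  qed
  then obtain a b x where ab: "{a, b} = {u, v}" "{b, x} \<in> F" "x \<in> V - {u, v}"
    by (metis insert_commute)
  let ?p1 = "\<lambda>i::nat. if i = 0 then a else b"
  have "path (Suc 1) (?p1(Suc 1 := x))"
    by (rule extend[OF path1[OF ab(1)]]) (use ab in \<open>auto simp: N_def doubleton_eq_iff\<close>)
  then have m2: "2 \<le> m" using le_m by fastforce
  have inner: "p i \<in> V - {u, v}" if "path m p" "2 \<le> i" "i \<le> m" for p i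
  proof -
    have "p i \<noteq> p 0" "p i \<noteq> p 1" "p i \<in> V"
      using that by (auto simp: path_def inj_on_eq_iff)
    then show ?thesis using that by (auto simp: path_def doubleton_eq_iff)
  qed
  have nbr: "x \<in> p ` {..m}" if "path m p" "x \<in> N (p m)" for p x
    using extend[OF that] le_m m2 by fastforce
  define good where "good p j \<longleftrightarrow> path m p \<and> j + 2 \<le> m \<and> {p m, p j} \<in> F" for p j
  have third: "\<exists>k. k \<le> m \<and> p k \<in> N (p m) \<and> k \<noteq> m \<and> k \<noteq> m - 1 \<and> k \<noteq> i"
    if p: "path m p" for p i
  proof -
    obtain z where "z \<in> N (p m)" "z \<noteq> p (m - 1)" "z \<noteq> p i"
      using card_ge_3_avoid[OF deg[OF inner[OF p m2]]] by auto
    then show ?thesis using nbr[OF p, of z] by (auto simp: N_def)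
  qed
  obtain p0 where p0: "path m p0" using path_m by blast
  obtain k where k: "k \<le> m" "p0 k \<in> N (p0 m)" "k \<noteq> m" "k \<noteq> m - 1"
    using third[OF p0, of 0] by blast
  then have "k + 2 \<le> m" by linarith
  then have "good p0 k" using p0 k by (simp add: good_def N_def)
  then have ex_good: "\<exists>j p. good p j" by blast
  have good_bounded: "\<forall>j. (\<exists>p. good p j) \<longrightarrow> j \<le> m" by (auto simp: good_def)
  define j where "j = (GREATEST j. \<exists>p. good p j)"
  have "\<exists>p. good p j" unfolding j_def
    using GreatestI_ex_nat[of "\<lambda>j. \<exists>p. good p j", OF ex_good good_bounded[rule_format]] .
  then obtain p where p: "path m p" and j: "j + 2 \<le> m" "{p m, p j} \<in> F" by (auto simp: good_def)
  have le_j: "j' \<le> j" if "good p' j'" for j' p'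
    unfolding j_def
    using Greatest_le_nat[of "\<lambda>j. \<exists>p. good p j", OF _ good_bounded[rule_format]] that by blast
  have pF: "{p i, p (Suc i)} \<in> F" if "i < m" for i using p that by (simp add: path_def)
  have inj: "inj_on p {..m}" using p by (simp add: path_def)
  \<comment> \<open>A third neighbour of the last vertex lies before \<open>p j\<close> by the
    choice of \<open>j\<close>. In particular \<open>j\<close> is positive, so rerouting behind
    \<open>p j\<close> keeps the first two vertices.\<close>
  obtain i where "i \<le> m" "p i \<in> N (p m)" "i \<noteq> m" "i \<noteq> m - 1" "i \<noteq> j" using third[OF p] by blast
  then have i: "{p m, p i} \<in> F" "i + 2 \<le> m" "i \<noteq> j" by (auto simp: N_def)
  then have "i \<le> j" using p by (intro le_j[of p]) (simp add: good_def)
  with i have ij: "i < j" by simp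
  \<comment> \<open>The map from \<open>k\<close> to \<open>m + j + 1 - k\<close> reverses the
    indices from \<open>j + 1\<close> to \<open>m\<close>.\<close>
  define q where "q k = (if k \<le> j then p k else p (Suc (m + j) - k))" for k
  have q_end: "q m = p (Suc j)" using j by (simp add: q_def)
  have q: "path m q"
    unfolding path_def
  proof (intro conjI allI impI)
    define h where "h k = (if k \<le> j then k else Suc (m + j) - k)" for k
    have "q = p \<circ> h" by (auto simp: q_def h_def)
    moreover have "inj_on h {..m}" using j by (auto simp: h_def inj_on_def split: if_splits)
    moreover have "h ` {..m} \<subseteq> {..m}" using j by (auto simp: h_def)
    ultimately show "inj_on q {..m}" by (metis comp_inj_on inj inj_on_subset)
    show "{q 0, q 1} = {u, v}" using p ij by (simp add: q_def path_def)
    show "q ` {..m} \<subseteq> V" using p j by (auto simp: q_def path_def)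
    fix k assume k: "k < m"
    consider "k < j" | "k = j" | "j < k" by linarith
    then show "{q k, q (Suc k)} \<in> F"
    proof cases
      case 1
      then show ?thesis using pF k by (simp add: q_def)
    next
      case 2
      then show ?thesis using j by (simp add: q_def insert_commute)
    next
      case 3
      then have "Suc (m + j) - k = Suc (m + j - k)" using k by simp
      then show ?thesis using pF[of "m + j - k"] 3 k by (simp add: q_def insert_commute)
    qed
  qed
  \<comment> \<open>The vertices \<open>p j\<close> and \<open>p (j + 2)\<close> precede and follow
    the new last vertex on \<open>p\<close>. Excluding \<open>p (j + 2)\<close>, which is
    \<open>q (m - 1)\<close> when it comes after \<open>j\<close>, makes a late neighbour count for
    the choice of \<open>j\<close>.\<close>
  obtain z where z: "z \<in> N (q m)" "z \<noteq> p j" "z \<noteq> p (Suc (Suc j))"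
    using card_ge_3_avoid[OF deg[OF inner[OF q m2]]] by auto
  then have "z \<in> q ` {..m}" using nbr[OF q] by blast
  then obtain l where l: "l \<le> m" "z = q l" by auto
  show False
  proof (cases "l \<le> j")
    case True
    then have "l < j" "{p (Suc j), p l} \<in> F" using z l q_end by (auto simp: q_def N_def less_le)
    then have "has_K4 V F"
      using p j i ij by (intro path_chords_K4[of p m V F i j l]) (auto simp: path_def)
    then show False using K4 by blast
  next
    case False
    have "l \<noteq> m" using z l by (auto simp: N_def)
    moreover have "l \<noteq> m - 1"
    proof
      assume "l = m - 1"
      then have "Suc (m + j) - l = Suc (Suc j)" using j by simp
      then have "q l = p (Suc (Suc j))" using False by (simp add: q_def)
      then show False using z l by simp
    qed
    ultimately have "good q l" using q z l by (auto simp: good_def N_def)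
    then show False using le_j False by blast
  qed
qed


section \<open>Series-parallel terms\<close>

definition joint :: "'e set set \<Rightarrow> 'e set set \<Rightarrow> 'e set set" where
  "joint X Y = {S \<union> T | S T. S \<in> X \<and> T \<in> Y}"

lemma jointI: "S \<in> X \<Longrightarrow> T \<in> Y \<Longrightarrow> S \<union> T \<in> joint X Y"
  by (auto simp: joint_def)

lemma jointE:
  assumes "U \<in> joint X Y"
  obtains S T where "U = S \<union> T" "S \<in> X" "T \<in> Y"
  using assms by (auto simp: joint_def)

lemma joint_commute: "joint X Y = joint Y X"
  by (auto simp: joint_def)

lemma joint_Pow: "X \<subseteq> Pow L \<Longrightarrow> Y \<subseteq> Pow M \<Longrightarrow> joint X Y \<subseteq> Pow (L \<union> M)"
  by (auto simp: joint_def)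

datatype 'e sp = Leaf 'e | Series "'e sp" "'e sp" | Parallel "'e sp" "'e sp"

abbreviation labels :: "'e sp \<Rightarrow> 'e set" where
  "labels \<equiv> set_sp"

text \<open>A term describes a network with two terminals. Its trees are the spanning trees of the network,
  its forests are the spanning forests with two components that separate the terminals.\<close>

fun forests :: "'e sp \<Rightarrow> 'e set set" and trees :: "'e sp \<Rightarrow> 'e set set" where
  "forests (Leaf f) = {{}}"
| "forests (Series s t) = joint (forests s) (trees t) \<union> joint (trees s) (forests t)"
| "forests (Parallel s t) = joint (forests s) (forests t)"
| "trees (Leaf f) = {{f}}"
| "trees (Series s t) = joint (trees s) (trees t)"
| "trees (Parallel s t) = joint (forests s) (trees t) \<union> joint (trees s) (forests t)"

primrec read_once :: "'e sp \<Rightarrow> bool" where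
  "read_once (Leaf f) = True"
| "read_once (Series s t) = (read_once s \<and> read_once t \<and> labels s \<inter> labels t = {})"
| "read_once (Parallel s t) = (read_once s \<and> read_once t \<and> labels s \<inter> labels t = {})"

primrec dual :: "'e sp \<Rightarrow> 'e sp" where
  "dual (Leaf f) = Leaf f"
| "dual (Series s t) = Parallel (dual s) (dual t)"
| "dual (Parallel s t) = Series (dual s) (dual t)"

primrec subst_leaf :: "'e \<Rightarrow> 'e sp \<Rightarrow> 'e sp \<Rightarrow> 'e sp" where
  "subst_leaf f r (Leaf h) = (if h = f then r else Leaf h)"
| "subst_leaf f r (Series s t) = Series (subst_leaf f r s) (subst_leaf f r t)"
| "subst_leaf f r (Parallel s t) = Parallel (subst_leaf f r s) (subst_leaf f r t)"

text \<open>The number of vertices of the network other than its terminals: series composition turns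
  two terminals into one such vertex.\<close>

primrec rank :: "'e sp \<Rightarrow> nat" where
  "rank (Leaf f) = 0"
| "rank (Series s t) = Suc (rank s + rank t)"
| "rank (Parallel s t) = rank s + rank t"

lemma finite_labels [simp]: "finite (labels t)"
  by (induction t) auto

lemma forests_trees_labels: "forests t \<subseteq> Pow (labels t) \<and> trees t \<subseteq> Pow (labels t)"
  by (induction t) (simp_all add: joint_Pow)

lemma forests_labels: "S \<in> forests t \<Longrightarrow> S \<subseteq> labels t"
  and trees_labels: "S \<in> trees t \<Longrightarrow> S \<subseteq> labels t"
  using forests_trees_labels[of t] by auto

lemma forests_trees_nonempty: "forests t \<noteq> {} \<and> trees t \<noteq> {}"
  by (induction t) (auto simp: joint_def)

lemma card_joint:
  assumes "U \<in> joint X Y" "\<And>S. S \<in> X \<Longrightarrow> S \<subseteq> L \<and> card S = m" "\<And>T. T \<in> Y \<Longrightarrow> T \<subseteq> M \<and> card T = n"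
    "L \<inter> M = {}" "finite L" "finite M"
  shows "card U = m + n"
proof -
  obtain S T where ST: "U = S \<union> T" "S \<in> X" "T \<in> Y" using assms(1) by (rule jointE)
  then have "S \<subseteq> L" "T \<subseteq> M" "card S = m" "card T = n" using assms(2,3) by auto
  moreover from this have "S \<inter> T = {}" "finite S" "finite T"
    using assms(4-) by (auto intro: finite_subset)
  ultimately show ?thesis using ST by (simp add: card_Un_disjoint)
qed

text \<open>The sizes carry the bipartite structure: they separate forests from trees, make
  inclusion inside one family an equality, and turn inclusion of a forest in a tree into adjacency
  in the cube.\<close>

lemma card_forests_trees:
  "read_once t \<Longrightarrow> (\<forall>S\<in>forests t. card S = rank t) \<and> (\<forall>S\<in>trees t. card S = Suc (rank t))"
proof (induction t)
  case (Series s t)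
  then have *: "\<And>S. S \<in> forests s \<Longrightarrow> S \<subseteq> labels s \<and> card S = rank s"
    "\<And>S. S \<in> trees s \<Longrightarrow> S \<subseteq> labels s \<and> card S = Suc (rank s)"
    "\<And>S. S \<in> forests t \<Longrightarrow> S \<subseteq> labels t \<and> card S = rank t"
    "\<And>S. S \<in> trees t \<Longrightarrow> S \<subseteq> labels t \<and> card S = Suc (rank t)"
    and dis: "labels s \<inter> labels t = {}"
    by (auto dest: forests_labels trees_labels)
  show ?case
    using card_joint[OF _ *(1,4) dis] card_joint[OF _ *(2,3) dis] card_joint[OF _ *(2,4) dis]
    by auto
next
  case (Parallel s t)
  then have *: "\<And>S. S \<in> forests s \<Longrightarrow> S \<subseteq> labels s \<and> card S = rank s"
    "\<And>S. S \<in> trees s \<Longrightarrow> S \<subseteq> labels s \<and> card S = Suc (rank s)"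
    "\<And>S. S \<in> forests t \<Longrightarrow> S \<subseteq> labels t \<and> card S = rank t"
    "\<And>S. S \<in> trees t \<Longrightarrow> S \<subseteq> labels t \<and> card S = Suc (rank t)"
    and dis: "labels s \<inter> labels t = {}"
    by (auto dest: forests_labels trees_labels)
  show ?case
    using card_joint[OF _ *(1,4) dis] card_joint[OF _ *(2,3) dis] card_joint[OF _ *(1,3) dis]
    by auto
qed simp

lemma labels_dual [simp]: "labels (dual t) = labels t"
  by (induction t) auto

lemma read_once_dual [simp]: "read_once (dual t) = read_once t"
  by (induction t) auto

lemma dual_dual [simp]: "dual (dual t) = t"
  by (induction t) auto

lemma size_dual [simp]: "size (dual t) = size t"
  by (induction t) auto

lemma joint_complement:
  assumes "X \<subseteq> Pow L" "Y \<subseteq> Pow M" "L \<inter> M = {}"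
  shows "joint ((\<lambda>S. L - S) ` X) ((\<lambda>S. M - S) ` Y) = (\<lambda>S. L \<union> M - S) ` joint X Y"
proof -
  have *: "(L - S) \<union> (M - T) = L \<union> M - (S \<union> T)" if "S \<in> X" "T \<in> Y" for S T
    using assms that by blast
  show ?thesis
  proof (intro equalityI subsetI)
    fix U assume "U \<in> joint ((\<lambda>S. L - S) ` X) ((\<lambda>S. M - S) ` Y)"
    then obtain S T where "U = (L - S) \<union> (M - T)" "S \<in> X" "T \<in> Y" by (auto simp: joint_def)
    then show "U \<in> (\<lambda>S. L \<union> M - S) ` joint X Y" using * by (auto intro: jointI)
  next
    fix U assume "U \<in> (\<lambda>S. L \<union> M - S) ` joint X Y"
    then obtain S T where ST: "U = L \<union> M - (S \<union> T)" "S \<in> X" "T \<in> Y" by (auto simp: joint_def)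
    then have "U = (L - S) \<union> (M - T)" using * by simp
    then show "U \<in> joint ((\<lambda>S. L - S) ` X) ((\<lambda>S. M - S) ` Y)" using ST by (auto intro!: jointI)
  qed
qed

text \<open>Over disjoint sets of labels complementation commutes with \<open>joint\<close>, so it
  exchanges the equations for \<open>Series\<close> with those for \<open>Parallel\<close>. This is
  what reduces series composition to parallel composition.\<close>

lemma forests_trees_dual:
  "read_once t \<Longrightarrow> forests (dual t) = (\<lambda>S. labels t - S) ` trees t \<and>
    trees (dual t) = (\<lambda>S. labels t - S) ` forests t"
proof (induction t)
  case (Series s t)
  then show ?case
    using forests_trees_labels[of s] forests_trees_labels[of t]
    by (simp add: joint_complement image_Un Un_commute)
next
  case (Parallel s t)
  then show ?case
    using forests_trees_labels[of s] forests_trees_labels[of t]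
    by (simp add: joint_complement image_Un Un_commute)
qed simp

lemma joint_image: "joint ((`) h ` X) ((`) h ` Y) = (`) h ` joint X Y"
proof (intro equalityI subsetI)
  fix U assume "U \<in> joint ((`) h ` X) ((`) h ` Y)"
  then obtain S T where "U = h ` (S \<union> T)" "S \<in> X" "T \<in> Y" by (auto simp: joint_def image_Un)
  then show "U \<in> (`) h ` joint X Y" by (auto intro: jointI)
next
  fix U assume "U \<in> (`) h ` joint X Y"
  then obtain S T where "U = h ` S \<union> h ` T" "S \<in> X" "T \<in> Y" by (auto simp: joint_def image_Un)
  then show "U \<in> joint ((`) h ` X) ((`) h ` Y)" by (auto intro!: jointI)
qed

lemma forests_trees_map:
  "forests (map_sp h t) = (`) h ` forests t \<and> trees (map_sp h t) = (`) h ` trees t"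
  by (induction t) (simp_all add: joint_image image_Un)

lemma read_once_map: "inj_on h (labels t) \<Longrightarrow> read_once (map_sp h t) = read_once t"
proof (induction t)
  case (Series s t)
  have "h ` labels s \<inter> h ` labels t = h ` (labels s \<inter> labels t)"
    using Series.prems by (intro inj_on_image_Int[symmetric, of h "labels s \<union> labels t"]) auto
  then show ?case
    using Series by (auto simp: sp.set_map inj_on_Un)
next
  case (Parallel s t)
  have "h ` labels s \<inter> h ` labels t = h ` (labels s \<inter> labels t)"
    using Parallel.prems by (intro inj_on_image_Int[symmetric, of h "labels s \<union> labels t"]) auto
  then show ?case
    using Parallel by (auto simp: sp.set_map inj_on_Un)
qed simp

section \<open>Doubling and subdividing a leaf of a term\<close>

lemma double_in_Un: "double_in f g (X \<union> Y) = double_in f g X \<union> double_in f g Y"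
  by (auto simp: double_in_def)

lemma subdivide_in_Un: "subdivide_in f g (X \<union> Y) = subdivide_in f g X \<union> subdivide_in f g Y"
  by (auto simp: subdivide_in_def)

text \<open>Since \<open>f\<close> and \<open>g\<close> avoid \<open>Y\<close>, only the first
  constituent of a union can contain them, so the operator acts there alone.\<close>

lemma double_in_joint:
  assumes "f \<noteq> g" "f \<notin> \<Union> Y" "g \<notin> \<Union> Y"
  shows "double_in f g (joint X Y) = joint (double_in f g X) Y"
proof (intro equalityI subsetI)
  fix U assume "U \<in> double_in f g (joint X Y)"
  then consider "g \<notin> U" "U \<in> joint X Y"
    | "g \<in> U" "f \<notin> U" "insert f (U - {g}) \<in> joint X Y" by (auto simp: double_in_def)
  then show "U \<in> joint (double_in f g X) Y"
  proof cases
    case 1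
    from 1(2) obtain S T where "U = S \<union> T" "S \<in> X" "T \<in> Y" by (rule jointE)
    then show ?thesis using 1 by (auto simp: double_in_def intro!: jointI)
  next
    case 2
    from 2(3) obtain S T where ST: "insert f (U - {g}) = S \<union> T" "S \<in> X" "T \<in> Y"
      by (rule jointE)
    \<comment> \<open>The element \<open>f\<close> must come from \<open>S\<close>, and putting
      \<open>g\<close> back in its place changes \<open>S\<close> only.\<close>
    have "f \<in> S \<union> T" "g \<notin> S \<union> T" unfolding ST(1)[symmetric] using assms(1) by auto
    moreover have "f \<notin> T" using assms(2) ST(3) by blast
    ultimately have S: "f \<in> S" "f \<notin> T" "g \<notin> S" by auto
    then have "insert f (insert g (S - {f}) - {g}) = S" using assms(1) by auto
    then have "insert g (S - {f}) \<in> double_in f g X" using assms(1) ST(2) by (simp add: double_in_def)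
    then have "insert g (S - {f}) \<union> T \<in> joint (double_in f g X) Y" using ST(3) by (rule jointI)
    moreover have "U = insert g (insert f (U - {g}) - {f})" using 2(1,2) by auto
    moreover have "insert g (S \<union> T - {f}) = insert g (S - {f}) \<union> T" using S by auto
    ultimately show ?thesis unfolding ST(1) by simp
  qed
next
  fix U assume "U \<in> joint (double_in f g X) Y"
  then obtain S T where ST: "U = S \<union> T" "S \<in> double_in f g X" "T \<in> Y" by (rule jointE)
  then have T: "f \<notin> T" "g \<notin> T" using assms by blast+
  from ST(2) consider "g \<notin> S" "S \<in> X" | "g \<in> S" "f \<notin> S" "insert f (S - {g}) \<in> X"
    by (auto simp: double_in_def)
  then show "U \<in> double_in f g (joint X Y)"
  proof cases
    case 1
    then show ?thesis using ST T by (simp add: double_in_def jointI)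
  next
    case 2
    have "insert f (U - {g}) = insert f (S - {g}) \<union> T" using ST(1) T by auto
    moreover have "insert f (S - {g}) \<union> T \<in> joint X Y" using 2(3) ST(3) by (rule jointI)
    ultimately show ?thesis using 2 ST(1) T by (simp add: double_in_def)
  qed
qed

text \<open>Both kinds of members are described by the set \<open>D\<close> of removed elements,
  which allows one argument for both in the factorisation over \<open>joint\<close>.\<close>

lemma subdivide_in_iff:
  "U \<in> subdivide_in f g X \<longleftrightarrow>
    (\<exists>D. (D = {g} \<and> {f, g} \<subseteq> U \<or> D = {f, g} \<and> (f \<in> U) \<noteq> (g \<in> U)) \<and> U - D \<in> X)"
  by (auto simp: subdivide_in_def)

lemma subdivide_in_joint:
  assumes "f \<noteq> g" "f \<notin> \<Union> Y" "g \<notin> \<Union> Y"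
  shows "subdivide_in f g (joint X Y) = joint (subdivide_in f g X) Y"
proof (intro equalityI subsetI)
  fix U assume U: "U \<in> subdivide_in f g (joint X Y)"
  then obtain D where UD: "D = {g} \<and> {f, g} \<subseteq> U \<or> D = {f, g} \<and> (f \<in> U) \<noteq> (g \<in> U)"
    and D: "U - D \<in> joint X Y" unfolding subdivide_in_iff by blast
  from D obtain S T where ST: "U - D = S \<union> T" "S \<in> X" "T \<in> Y" by (rule jointE)
  have T: "f \<notin> T" "g \<notin> T" using assms ST(3) by blast+
  have "S \<inter> D = {}" unfolding disjoint_iff using ST(1) by blast
  moreover have "x \<in> S \<union> T \<longleftrightarrow> x \<in> U \<and> x \<notin> D" for x unfolding ST(1)[symmetric] by blast
  ultimately have S: "S \<union> (U \<inter> D) - D = S" "U = (S \<union> (U \<inter> D)) \<union> T"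
    and "f \<in> S \<union> (U \<inter> D) \<longleftrightarrow> f \<in> U" "g \<in> S \<union> (U \<inter> D) \<longleftrightarrow> g \<in> U"
    using T by blast+
  then have "S \<union> (U \<inter> D) \<in> subdivide_in f g X"
    unfolding subdivide_in_iff using UD ST(2) by (intro exI[of _ D]) simp
  then have "(S \<union> (U \<inter> D)) \<union> T \<in> joint (subdivide_in f g X) Y" using ST(3) by (rule jointI)
  then show "U \<in> joint (subdivide_in f g X) Y" unfolding S(2)[symmetric] .
next
  fix U assume "U \<in> joint (subdivide_in f g X) Y"
  then obtain S T where ST: "U = S \<union> T" "S \<in> subdivide_in f g X" "T \<in> Y" by (rule jointE)
  have T: "f \<notin> T" "g \<notin> T" using assms ST(3) by blast+
  from ST(2) obtain D where SD: "D = {g} \<and> {f, g} \<subseteq> S \<or> D = {f, g} \<and> (f \<in> S) \<noteq> (g \<in> S)"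
    and D: "S - D \<in> X" unfolding subdivide_in_iff by blast
  have "U - D = (S - D) \<union> T" using ST(1) T SD by blast
  then have "U - D \<in> joint X Y" using jointI[OF D ST(3)] by simp
  then show "U \<in> subdivide_in f g (joint X Y)"
    unfolding subdivide_in_iff using SD T ST(1) by (intro exI[of _ D]) simp
qed

lemma subst_leaf_id: "f \<notin> labels t \<Longrightarrow> subst_leaf f r t = t"
  by (induction t) auto

lemma labels_subst_leaf:
  "labels (subst_leaf f r t) = (if f \<in> labels t then labels t - {f} \<union> labels r else labels t)"
  by (induction t) auto

abbreviation double_leaf :: "'e \<Rightarrow> 'e \<Rightarrow> 'e sp \<Rightarrow> 'e sp" where
  "double_leaf f g \<equiv> subst_leaf f (Parallel (Leaf f) (Leaf g))"

abbreviation subdivide_leaf :: "'e \<Rightarrow> 'e \<Rightarrow> 'e sp \<Rightarrow> 'e sp" where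
  "subdivide_leaf f g \<equiv> subst_leaf f (Series (Leaf f) (Leaf g))"

lemma read_once_subst_leaf:
  "read_once t \<Longrightarrow> read_once r \<Longrightarrow> labels r \<inter> labels t \<subseteq> {f} \<Longrightarrow> read_once (subst_leaf f r t)"
  by (induction t) (auto simp: labels_subst_leaf)

lemma avoids_labels:
  assumes "f \<notin> labels t"
  shows "f \<notin> \<Union> (forests t)" "f \<notin> \<Union> (trees t)"
  using assms forests_labels[of _ t] trees_labels[of _ t] by blast+

lemma double_in_joint':
  assumes "f \<noteq> g" "f \<notin> \<Union> X" "g \<notin> \<Union> X"
  shows "double_in f g (joint X Y) = joint X (double_in f g Y)"
  using double_in_joint[OF assms] by (metis joint_commute)

lemma subdivide_in_joint':
  assumes "f \<noteq> g" "f \<notin> \<Union> X" "g \<notin> \<Union> X"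
  shows "subdivide_in f g (joint X Y) = joint X (subdivide_in f g Y)"
  using subdivide_in_joint[OF assms] by (metis joint_commute)

text \<open>In a read-once composition \<open>f\<close> occurs on one side only; the other factor is
  untouched by the substitution and avoids \<open>f\<close> and \<open>g\<close>, so the operator
  passes to the side of \<open>f\<close> down to the leaf itself.\<close>

lemma double_leaf_forests_trees:
  "read_once t \<Longrightarrow> f \<in> labels t \<Longrightarrow> g \<notin> labels t \<Longrightarrow>
    forests (double_leaf f g t) = double_in f g (forests t) \<and>
    trees (double_leaf f g t) = double_in f g (trees t)"
proof (induction t)
  case (Leaf h)
  have "insert f (T - {g}) = {f} \<longleftrightarrow> T = {g}" if "g \<in> T" "f \<notin> T" for T using that by blast
  then show ?case using Leaf by (auto simp: double_in_def joint_def)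
next
  case (Series s t)
  note [simp] = double_in_Un
  have fg: "f \<noteq> g" using Series.prems by auto
  show ?case
  proof (cases "f \<in> labels s")
    case True
    then have "f \<notin> labels t" using Series.prems by auto
    then show ?thesis using Series True
      by (simp add: subst_leaf_id double_in_joint[OF fg] avoids_labels del: Union_iff)
  next
    case False
    then show ?thesis using Series
      by (simp add: subst_leaf_id double_in_joint'[OF fg] avoids_labels del: Union_iff)
  qed
next
  case (Parallel s t)
  note [simp] = double_in_Un
  have fg: "f \<noteq> g" using Parallel.prems by auto
  show ?case
  proof (cases "f \<in> labels s")
    case True
    then have "f \<notin> labels t" using Parallel.prems by auto
    then show ?thesis using Parallel True
      by (simp add: subst_leaf_id double_in_joint[OF fg] avoids_labels del: Union_iff)
  next
    case False
    then show ?thesis using Parallel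
      by (simp add: subst_leaf_id double_in_joint'[OF fg] avoids_labels del: Union_iff)
  qed
qed

lemma subdivide_leaf_forests_trees:
  "read_once t \<Longrightarrow> f \<in> labels t \<Longrightarrow> g \<notin> labels t \<Longrightarrow>
    forests (subdivide_leaf f g t) = subdivide_in f g (forests t) \<and>
    trees (subdivide_leaf f g t) = subdivide_in f g (trees t)"
proof (induction t)
  case (Leaf h)
  have "T - {f, g} = {} \<and> (f \<in> T) \<noteq> (g \<in> T) \<longleftrightarrow> T = {f} \<or> T = {g}"
    "f \<in> T \<and> g \<in> T \<and> T - {g} = {f} \<longleftrightarrow> T = {f, g}" for T
    using Leaf by auto
  moreover have "T - {f, g} \<noteq> {f}" for T by blast
  ultimately show ?case using Leaf by (auto simp: subdivide_in_def joint_def)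
next
  case (Series s t)
  note [simp] = subdivide_in_Un
  have fg: "f \<noteq> g" using Series.prems by auto
  show ?case
  proof (cases "f \<in> labels s")
    case True
    then have "f \<notin> labels t" using Series.prems by auto
    then show ?thesis using Series True
      by (simp add: subst_leaf_id subdivide_in_joint[OF fg] avoids_labels del: Union_iff)
  next
    case False
    then show ?thesis using Series
      by (simp add: subst_leaf_id subdivide_in_joint'[OF fg] avoids_labels del: Union_iff)
  qed
next
  case (Parallel s t)
  note [simp] = subdivide_in_Un
  have fg: "f \<noteq> g" using Parallel.prems by auto
  show ?case
  proof (cases "f \<in> labels s")
    case True
    then have "f \<notin> labels t" using Parallel.prems by auto
    then show ?thesis using Parallel True
      by (simp add: subst_leaf_id subdivide_in_joint[OF fg] avoids_labels del: Union_iff)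
  next
    case False
    then show ?thesis using Parallel
      by (simp add: subst_leaf_id subdivide_in_joint'[OF fg] avoids_labels del: Union_iff)
  qed
qed

text \<open>Following a part that is not a leaf leads to a composition of two leaves; undoing it
  removes one label. This allows every term to be built by doubling and subdividing single edges, as
  graphs are.\<close>

lemma read_once_cases:
  assumes "read_once t"
  obtains f where "t = Leaf f"
  | f g s where "read_once s" "f \<in> labels s" "g \<notin> labels s"
      "t = subdivide_leaf f g s \<or> t = double_leaf f g s"
proof -
  have "(\<exists>f. t = Leaf f) \<or> (\<exists>f g s. read_once s \<and> f \<in> labels s \<and> g \<notin> labels s \<and>
      (t = subdivide_leaf f g s \<or> t = double_leaf f g s))"
    using assms
  proof (induction t)
    case (Series s t)
    then have st: "read_once s" "read_once t" "labels s \<inter> labels t = {}" by auto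
    show ?case
    proof (cases "(\<exists>f. s = Leaf f) \<and> (\<exists>g. t = Leaf g)")
      case True
      then obtain f g where "s = Leaf f" "t = Leaf g" by blast
      then show ?thesis using st
        by (intro disjI2 exI[of _ f] exI[of _ g] exI[of _ "Leaf f"]) simp
    next
      case False
      then consider f g r where "read_once r" "f \<in> labels r" "g \<notin> labels r"
          "s = subdivide_leaf f g r \<or> s = double_leaf f g r"
        | f g r where "read_once r" "f \<in> labels r" "g \<notin> labels r"
          "t = subdivide_leaf f g r \<or> t = double_leaf f g r"
        using Series.IH st by blast
      then show ?thesis
      proof cases
        case 1
        \<comment> \<open>The label \<open>f\<close> lies in one part only, so extending the
          recovered substitution to the whole term does not affect the other part.\<close>
        then have "labels s = insert g (labels r)" by (auto simp: labels_subst_leaf)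
        moreover from this have "f \<notin> labels t" using 1 st by blast
        ultimately have "g \<notin> labels t" "labels r \<inter> labels t = {}" "subst_leaf f u t = t" for u
          using st by (auto simp: subst_leaf_id)
        then show ?thesis using 1 st
          by (intro disjI2 exI[of _ f] exI[of _ g] exI[of _ "Series r t"])
            auto
      next
        case 2
        then have "labels t = insert g (labels r)" by (auto simp: labels_subst_leaf)
        moreover from this have "f \<notin> labels s" using 2 st by blast
        ultimately have "g \<notin> labels s" "labels s \<inter> labels r = {}" "subst_leaf f u s = s" for u
          using st by (auto simp: subst_leaf_id)
        then show ?thesis using 2 st
          by (intro disjI2 exI[of _ f] exI[of _ g] exI[of _ "Series s r"])
            auto
      qed
    qed
  next
    case (Parallel s t)
    then have st: "read_once s" "read_once t" "labels s \<inter> labels t = {}" by auto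
    show ?case
    proof (cases "(\<exists>f. s = Leaf f) \<and> (\<exists>g. t = Leaf g)")
      case True
      then obtain f g where "s = Leaf f" "t = Leaf g" by blast
      then show ?thesis using st
        by (intro disjI2 exI[of _ f] exI[of _ g] exI[of _ "Leaf f"]) simp
    next
      case False
      then consider f g r where "read_once r" "f \<in> labels r" "g \<notin> labels r"
          "s = subdivide_leaf f g r \<or> s = double_leaf f g r"
        | f g r where "read_once r" "f \<in> labels r" "g \<notin> labels r"
          "t = subdivide_leaf f g r \<or> t = double_leaf f g r"
        using Parallel.IH st by blast
      then show ?thesis
      proof cases
        case 1
        then have "labels s = insert g (labels r)" by (auto simp: labels_subst_leaf)
        moreover from this have "f \<notin> labels t" using 1 st by blast
        ultimately have "g \<notin> labels t" "labels r \<inter> labels t = {}" "subst_leaf f u t = t" for u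
          using st by (auto simp: subst_leaf_id)
        then show ?thesis using 1 st
          by (intro disjI2 exI[of _ f] exI[of _ g] exI[of _ "Parallel r t"])
            auto
      next
        case 2
        then have "labels t = insert g (labels r)" by (auto simp: labels_subst_leaf)
        moreover from this have "f \<notin> labels s" using 2 st by blast
        ultimately have "g \<notin> labels s" "labels s \<inter> labels r = {}" "subst_leaf f u s = s" for u
          using st by (auto simp: subst_leaf_id)
        then show ?thesis using 2 st
          by (intro disjI2 exI[of _ f] exI[of _ g] exI[of _ "Parallel s r"])
            auto
      qed
    qed
  qed simp
  then show thesis using that by blast
qed

definition decomposes :: "'e set \<Rightarrow> 'e set set \<Rightarrow> 'e set set \<Rightarrow> bool" where
  "decomposes E X Y \<longleftrightarrow> (\<exists>t R n. read_once t \<and> labels t \<subseteq> E \<and> \<Union> R \<subseteq> E \<and> labels t \<inter> \<Union> R = {} \<and>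
     (\<forall>r\<in>R. finite r \<and> card r = n) \<and> X = joint (forests t) R \<and> Y = joint (trees t) R)"

lemma Union_double_in: "\<Union> (double_in f g R) \<subseteq> insert g (\<Union> R)"
proof (intro Union_least)
  fix T assume "T \<in> double_in f g R"
  then consider "T \<in> R" | "insert f (T - {g}) \<in> R" by (auto simp: double_in_def)
  then show "T \<subseteq> insert g (\<Union> R)" by cases blast+
qed

lemma Union_subdivide_in: "\<Union> (subdivide_in f g R) \<subseteq> insert f (insert g (\<Union> R))"
proof (intro Union_least)
  fix T assume "T \<in> subdivide_in f g R"
  then consider "T - {g} \<in> R" | "T - {f, g} \<in> R" by (auto simp: subdivide_in_def)
  then show "T \<subseteq> insert f (insert g (\<Union> R))" by cases blast+
qed

lemma decomposesI:
  assumes "read_once t" "labels t \<subseteq> E" "\<Union> R \<subseteq> E" "labels t \<inter> \<Union> R = {}"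
    and "\<And>r. r \<in> R \<Longrightarrow> finite r \<and> card r = n"
    and "X = joint (forests t) R" "Y = joint (trees t) R"
  shows "decomposes E X Y"
  unfolding decomposes_def
  by (rule exI[of _ t], rule exI[of _ R], rule exI[of _ n]) (use assms in simp)

text \<open>Either \<open>f\<close> labels the term and its leaf is doubled, or the operator moves
  over to \<open>R\<close>. There it replaces \<open>f\<close> by \<open>g\<close> in some members,
  which keeps their size.\<close>

lemma decomposes_double:
  assumes "decomposes E X Y" "f \<in> E" "g \<notin> E"
  shows "decomposes (insert g E) (double_in f g X) (double_in f g Y)"
proof -
  obtain t R n where t: "read_once t" "labels t \<subseteq> E" "\<Union> R \<subseteq> E" "labels t \<inter> \<Union> R = {}"
    "\<forall>r\<in>R. finite r \<and> card r = n" and XY: "X = joint (forests t) R" "Y = joint (trees t) R"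
    using assms(1) unfolding decomposes_def by blast
  have fg: "f \<noteq> g" and g: "g \<notin> labels t" "g \<notin> \<Union> R" using assms t by blast+
  show ?thesis
  proof (cases "f \<in> labels t")
    case True
    then have f: "f \<notin> \<Union> R" using t by blast
    show ?thesis
    proof (rule decomposesI)
      show "read_once (double_leaf f g t)"
        using t(1) g fg by (intro read_once_subst_leaf) auto
      have "labels (double_leaf f g t) = insert g (labels t)"
        using True by (auto simp: labels_subst_leaf)
      then show "labels (double_leaf f g t) \<subseteq> insert g E" "labels (double_leaf f g t) \<inter> \<Union> R = {}"
        using t(2,4) g by auto
      show "double_in f g X = joint (forests (double_leaf f g t)) R"
        "double_in f g Y = joint (trees (double_leaf f g t)) R"
        unfolding XY double_in_joint[OF fg f g(2)]
        using double_leaf_forests_trees[OF t(1) True g(1)] by simp_all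
    qed (use t in auto)
  next
    case False
    have card: "finite T \<and> card T = n" if "T \<in> double_in f g R" for T
    proof (cases "g \<in> T")
      case True
      then have r: "insert f (T - {g}) \<in> R" "f \<notin> T" using that by (auto simp: double_in_def)
      then have fin: "finite (T - {g})" and n: "card (insert f (T - {g})) = n"
        using bspec[OF t(5) r(1)] by simp_all
      have "card (insert f (T - {g})) = Suc (card (T - {g}))"
        using fin r(2) by (intro card_insert_disjoint) simp_all
      also have "\<dots> = card T" using fin True by (intro card_Suc_Diff1) simp_all
      finally show ?thesis using fin n by simp
    qed (use that t(5) in \<open>simp add: double_in_def\<close>)
    have sub: "\<Union> (double_in f g R) \<subseteq> insert f (insert g (\<Union> R))"
      using Union_double_in by fast
    show ?thesis
    proof (rule decomposesI[OF t(1) _ _ _ card])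
      show "\<Union> (double_in f g R) \<subseteq> insert g E" using sub t(3) assms(2) by blast
      show "labels t \<inter> \<Union> (double_in f g R) = {}" using sub t(4) g False by blast
      show "labels t \<subseteq> insert g E" using t(2) by blast
      show "double_in f g X = joint (forests t) (double_in f g R)" "double_in f g Y = joint (trees t) (double_in f g R)"
        unfolding XY using double_in_joint'[OF fg] avoids_labels False g(1) by metis+
    qed
  qed
qed

text \<open>As for doubling, except that outside the term every new member of the common factor has
  exactly one element more than the old one it comes from.\<close>

lemma decomposes_subdivide:
  assumes "decomposes E X Y" "f \<in> E" "g \<notin> E"
  shows "decomposes (insert g E) (subdivide_in f g X) (subdivide_in f g Y)"
proof -
  obtain t R n where t: "read_once t" "labels t \<subseteq> E" "\<Union> R \<subseteq> E" "labels t \<inter> \<Union> R = {}"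
    "\<forall>r\<in>R. finite r \<and> card r = n" and XY: "X = joint (forests t) R" "Y = joint (trees t) R"
    using assms(1) unfolding decomposes_def by blast
  have fg: "f \<noteq> g" and g: "g \<notin> labels t" "g \<notin> \<Union> R" using assms t by blast+
  show ?thesis
  proof (cases "f \<in> labels t")
    case True
    then have f: "f \<notin> \<Union> R" using t by blast
    show ?thesis
    proof (rule decomposesI)
      show "read_once (subdivide_leaf f g t)"
        using t(1) g fg by (intro read_once_subst_leaf) auto
      have "labels (subdivide_leaf f g t) = insert g (labels t)"
        using True by (auto simp: labels_subst_leaf)
      then show "labels (subdivide_leaf f g t) \<subseteq> insert g E"
          "labels (subdivide_leaf f g t) \<inter> \<Union> R = {}"
        using t(2,4) g by auto
      show "subdivide_in f g X = joint (forests (subdivide_leaf f g t)) R"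
        "subdivide_in f g Y = joint (trees (subdivide_leaf f g t)) R"
        unfolding XY subdivide_in_joint[OF fg f g(2)]
        using subdivide_leaf_forests_trees[OF t(1) True g(1)] by simp_all
    qed (use t in auto)
  next
    case False
    have card: "finite T \<and> card T = Suc n" if T: "T \<in> subdivide_in f g R" for T
    proof -
      \<comment> \<open>In each case exactly one element \<open>h\<close> of \<open>T\<close>
        disappears: \<open>g\<close> if both halves are present, otherwise the half that is.\<close>
      obtain D where "D = {g} \<and> {f, g} \<subseteq> T \<or> D = {f, g} \<and> (f \<in> T) \<noteq> (g \<in> T)"
        and TD: "T - D \<in> R" using T unfolding subdivide_in_iff by blast
      then consider "g \<in> T" "T - D = T - {g}" | "f \<in> T" "T - D = T - {f}" by blast
      then obtain h where "h \<in> T" "T - D = T - {h}" by cases blast+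
      then have "h \<in> T" "T - {h} \<in> R" using TD by simp_all
      then have fin: "finite (T - {h})" and n: "card (T - {h}) = n"
        using bspec[OF t(5)] by blast+
      have "Suc (card (T - {h})) = card T"
        using fin \<open>h \<in> T\<close> by (intro card_Suc_Diff1) simp_all
      then show ?thesis using fin n by simp
    qed
    have sub: "\<Union> (subdivide_in f g R) \<subseteq> insert f (insert g (\<Union> R))"
      using Union_subdivide_in by fast
    show ?thesis
    proof (rule decomposesI[OF t(1) _ _ _ card])
      show "\<Union> (subdivide_in f g R) \<subseteq> insert g E" using sub t(3) assms(2) by blast
      show "labels t \<inter> \<Union> (subdivide_in f g R) = {}" using sub t(4) g False by blast
      show "labels t \<subseteq> insert g E" using t(2) by blast
      show "subdivide_in f g X = joint (forests t) (subdivide_in f g R)" "subdivide_in f g Y = joint (trees t) (subdivide_in f g R)"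
        unfolding XY using subdivide_in_joint'[OF fg] avoids_labels False g(1) by metis+
    qed
  qed
qed

text \<open>The pendant edge is charged to the common factor, never to the term.\<close>

lemma decomposes_pendant:
  assumes "decomposes E X Y" "f \<notin> E"
  shows "decomposes (insert f E) (insert f ` X) (insert f ` Y)"
proof -
  obtain t R n where t: "read_once t" "labels t \<subseteq> E" "\<Union> R \<subseteq> E" "labels t \<inter> \<Union> R = {}"
    "\<forall>r\<in>R. finite r \<and> card r = n" and XY: "X = joint (forests t) R" "Y = joint (trees t) R"
    using assms(1) unfolding decomposes_def by blast
  have *: "insert f ` joint Z R = joint Z (insert f ` R)" for Z
  proof (intro equalityI subsetI)
    fix U assume "U \<in> insert f ` joint Z R"
    then obtain S T where "U = S \<union> insert f T" "S \<in> Z" "T \<in> R" by (auto simp: joint_def)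
    then show "U \<in> joint Z (insert f ` R)" by (auto simp del: Un_insert_right intro!: jointI)
  next
    fix U assume "U \<in> joint Z (insert f ` R)"
    then obtain S T where "U = insert f (S \<union> T)" "S \<in> Z" "T \<in> R" by (auto simp: joint_def)
    then show "U \<in> insert f ` joint Z R" by (auto intro: jointI)
  qed
  have fR: "f \<notin> \<Union> R" "f \<notin> labels t" using t(2,3) assms(2) by blast+
  show ?thesis
  proof (rule decomposesI)
    show "read_once t" "labels t \<subseteq> insert f E" using t by blast+
    show "\<Union> (insert f ` R) \<subseteq> insert f E" using t(3) by blast
    show "labels t \<inter> \<Union> (insert f ` R) = {}" using t(4) fR by auto
    show "finite r \<and> card r = Suc n" if r: "r \<in> insert f ` R" for r
    proof -
      obtain r' where "r = insert f r'" "r' \<in> R" using r by blast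
      moreover from this have "f \<notin> r'" "finite r'" "card r' = n" using fR t(5) by blast+
      ultimately show ?thesis by simp
    qed
  qed (simp_all add: XY *)
qed


section \<open>Reduction of series-parallel graphs\<close>

text \<open>Contraction and deletion act on bare set families, so that interchanging them with an
  operation at edges other than \<open>e\<close> is set algebra and involves no graph.\<close>

definition contract_in :: "'e \<Rightarrow> 'e set set \<Rightarrow> 'e set set" where
  "contract_in e F = {S. e \<notin> S \<and> insert e S \<in> F}"

definition remove_in :: "'e \<Rightarrow> 'e set set \<Rightarrow> 'e set set" where
  "remove_in e F = {S. e \<notin> S \<and> S \<in> F}"

lemma X_contract_eq: "X_contract G e = contract_in e (spanning_trees G)"
  by (auto simp: X_contract_def contract_in_def spanning_trees_def spanning_tree_def)

lemma X_delete_eq: "X_delete G e = remove_in e (spanning_trees G)"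
  by (auto simp: X_delete_def remove_in_def spanning_trees_def spanning_tree_def)

lemma contract_in_double:
  assumes "e \<noteq> f" "e \<noteq> g"
  shows "contract_in e (double_in f g F) = double_in f g (contract_in e F)"
proof (rule set_eqI)
  fix S
  have "insert f (insert e S - {g}) = insert e (insert f (S - {g}))" using assms by auto
  then show "S \<in> contract_in e (double_in f g F) \<longleftrightarrow> S \<in> double_in f g (contract_in e F)"
    using assms by (auto simp: contract_in_def double_in_def)
qed

lemma remove_in_double:
  assumes "e \<noteq> f" "e \<noteq> g"
  shows "remove_in e (double_in f g F) = double_in f g (remove_in e F)"
  using assms by (auto simp: remove_in_def double_in_def)

lemma contract_in_subdivide:
  assumes "e \<noteq> f" "e \<noteq> g"
  shows "contract_in e (subdivide_in f g F) = subdivide_in f g (contract_in e F)"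
proof (rule set_eqI)
  fix S
  have "insert e S - {g} = insert e (S - {g})" "insert e S - {f, g} = insert e (S - {f, g})"
    using assms by auto
  then show "S \<in> contract_in e (subdivide_in f g F) \<longleftrightarrow> S \<in> subdivide_in f g (contract_in e F)"
    using assms by (auto simp: contract_in_def subdivide_in_def)
qed

lemma remove_in_subdivide:
  assumes "e \<noteq> f" "e \<noteq> g"
  shows "remove_in e (subdivide_in f g F) = subdivide_in f g (remove_in e F)"
  using assms by (auto simp: remove_in_def subdivide_in_def)

lemma contract_in_pendant:
  assumes "e \<noteq> f"
  shows "contract_in e (insert f ` F) = insert f ` contract_in e F"
proof (intro equalityI subsetI)
  fix S assume "S \<in> contract_in e (insert f ` F)"
  then obtain T where S: "e \<notin> S" "insert e S = insert f T" "T \<in> F"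
    by (auto simp: contract_in_def)
  then have "e \<in> T" using assms by blast
  then have "insert e (T - {e}) = T" by blast
  then have "T - {e} \<in> contract_in e F" using S(3) by (simp add: contract_in_def)
  moreover have "S = insert e S - {e}" using S(1) by blast
  then have "S = insert f (T - {e})" unfolding S(2) using assms by blast
  ultimately show "S \<in> insert f ` contract_in e F" by blast
next
  fix S assume "S \<in> insert f ` contract_in e F"
  then obtain T where T: "S = insert f T" "e \<notin> T" "insert e T \<in> F" by (auto simp: contract_in_def)
  then have "insert e S = insert f (insert e T)" by blast
  then show "S \<in> contract_in e (insert f ` F)" using T assms by (simp add: contract_in_def)
qed

lemma remove_in_pendant:
  assumes "e \<noteq> f"
  shows "remove_in e (insert f ` F) = insert f ` remove_in e F"
  using assms by (auto simp: remove_in_def)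

lemma spanning_trees_digon:
  assumes G: "multigraph G" "mverts G = {u, v}" "u \<noteq> v" "medges G = {e, f}" "e \<noteq> f"
    and ends: "mends G e = {u, v}" "mends G f = {u, v}"
  shows "spanning_trees G = {{e}, {f}}"
proof -
  have con: "connects G T \<longleftrightarrow> T \<noteq> {}" if "T \<subseteq> {e, f}" for T
  proof
    assume "connects G T"
    then have "linked (mends G ` T) u v" using G(2) by (simp add: connected_by_def)
    then show "T \<noteq> {}" using G(3) by (auto simp: linked_def)
  next
    assume "T \<noteq> {}"
    then have "{u, v} \<in> mends G ` T" using that ends by blast
    then have "linked (mends G ` T) u v" by (rule linked_step)
    then show "connects G T" unfolding G(2) by (intro connected_byI[of u]) auto
  qed
  have subs: "T \<subseteq> {e, f} \<longleftrightarrow> T = {} \<or> T = {e} \<or> T = {f} \<or> T = {e, f}" for T by blast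
  have "T \<in> minimal_sets (connects G) (medges G) \<longleftrightarrow> T = {e} \<or> T = {f}" for T
  proof (cases "T \<subseteq> {e, f}")
    case True
    then have "connects G (T - {h}) \<longleftrightarrow> T - {h} \<noteq> {}" for h by (intro con) blast
    then have "T \<in> minimal_sets (connects G) (medges G) \<longleftrightarrow>
        T \<noteq> {} \<and> (\<forall>h\<in>T. T - {h} = {})"
      by (simp add: minimal_sets_def G(4) con[OF True] True)
    also have "\<dots> \<longleftrightarrow> T = {e} \<or> T = {f}"
      using True[unfolded subs] G(5) by auto
    finally show ?thesis .
  qed (use G(4) in \<open>auto simp: minimal_sets_def\<close>)
  then show ?thesis unfolding spanning_trees_minimal[OF G(1)] by blast
qed

lemma digon_families:
  assumes "multigraph G" "mverts G = {u, v}" "u \<noteq> v" "medges G = {e, f}" "e \<noteq> f"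
    and "mends G e = {u, v}" "mends G f = {u, v}"
  shows "X_contract G e = {{}}" "X_delete G e = {{f}}"
proof -
  have "insert e S = {f} \<longleftrightarrow> False" for S using assms(5) by blast
  moreover have "insert e S = {e} \<and> e \<notin> S \<longleftrightarrow> S = {}" for S by blast
  ultimately show "X_contract G e = {{}}" "X_delete G e = {{f}}"
    unfolding X_contract_eq X_delete_eq spanning_trees_digon[OF assms]
    using assms(5) by (auto simp: contract_in_def remove_in_def)
qed

text \<open>The invariant of the reduction: two ends of \<open>e\<close> say that it is no loop, and
  connectedness without \<open>e\<close> that it is no bridge. Connectivity is stated for edge sets
  because the operations are understood in these terms.\<close>

definition reducible_at :: "('v, 'e) mgraph \<Rightarrow> 'e \<Rightarrow> bool" where
  "reducible_at G e \<longleftrightarrow> series_parallel G \<and> e \<in> medges G \<and> card (mends G e) = 2 \<and>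
    connects G (medges G) \<and> connects G (medges G - {e})"

abbreviation decomposed_at :: "('v, 'e) mgraph \<Rightarrow> 'e \<Rightarrow> bool" where
  "decomposed_at G e \<equiv> decomposes (medges G - {e}) (X_contract G e) (X_delete G e)"

definition delete_edge :: "('v, 'e) mgraph \<Rightarrow> 'e \<Rightarrow> ('v, 'e) mgraph" where
  "delete_edge G f = \<lparr>mverts = mverts G, medges = medges G - {f}, mends = mends G\<rparr>"

lemma series_parallel_sub:
  assumes "series_parallel G" "mverts G' \<subseteq> mverts G" "medges G' \<subseteq> medges G" "mends G' = mends G"
    and "\<And>f. f \<in> medges G' \<Longrightarrow> mends G f \<subseteq> mverts G'"
  shows "series_parallel G'"
proof -
  have "multigraph G'"
    using assms by (auto simp: series_parallel_def multigraph_def intro: finite_subset)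
  moreover have "\<not> has_K4 (mverts G') (mends G' ` medges G')"
    using has_K4_mono[OF _ assms(2), of "mends G' ` medges G'" "mends G ` medges G"] assms
    by (auto simp: series_parallel_K4)
  ultimately show ?thesis by (simp add: series_parallel_K4)
qed

lemma series_parallel_delete_edge: "series_parallel G \<Longrightarrow> series_parallel (delete_edge G f)"
  by (rule series_parallel_sub[of G])
    (auto simp: delete_edge_def series_parallel_def dest: multigraph_ends)

lemma decomposed_at_loop:
  assumes G: "reducible_at G e" and f: "f \<in> medges G" "mends G f = {x}"
    and IH: "reducible_at (delete_edge G f) e \<Longrightarrow> decomposed_at (delete_edge G f) e"
  shows "decomposed_at G e"
proof -
  let ?G = "delete_edge G f"
  have mg: "multigraph G" using G by (simp add: reducible_at_def series_parallel_def)
  have ef: "e \<noteq> f" using G f by (auto simp: reducible_at_def)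
  have img: "mends G ` T = insert {x} (mends G ` (T - {f}))" if "f \<in> T" for T
    using that f(2) by auto
  have x: "x \<in> mverts G" using multigraph_ends[OF mg f(1)] f by simp
  have sp: "series_parallel ?G"
    using G by (simp add: reducible_at_def series_parallel_delete_edge)
  have "connects G (medges G - {f})"
    using G connected_by_loop img[OF f(1)] by (metis reducible_at_def)
  moreover have "connects G (medges G - {e} - {f})"
    using G connected_by_loop img[of "medges G - {e}"] f ef
    by (metis Diff_iff reducible_at_def singletonD)
  moreover have "medges G - {e} - {f} = medges G - {f} - {e}" by blast
  ultimately have "reducible_at ?G e"
    using G ef sp by (simp add: reducible_at_def delete_edge_def)
  then have "decomposed_at ?G e" by (rule IH)
  \<comment> \<open>Restoring the deleted edge returns \<open>G\<close> itself, so the rules for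
    adding edges compute its spanning trees from those of the smaller graph. The other reductions
    are used backwards in the same way.\<close>
  moreover have "G = add_edge ?G f {x}"
    using f x by (simp add: add_edge_def delete_edge_def insert_absorb fun_upd_idem)
  then have "spanning_trees G = spanning_trees ?G"
    using spanning_trees_add_loop[of ?G f x] sp x
    by (simp add: delete_edge_def series_parallel_def)
  ultimately have "decomposes (medges ?G - {e}) (X_contract G e) (X_delete G e)"
    by (simp add: X_contract_eq X_delete_eq)
  then obtain t R n where "read_once t" "labels t \<subseteq> medges ?G - {e}" "\<Union> R \<subseteq> medges ?G - {e}"
    "labels t \<inter> \<Union> R = {}" "\<forall>r\<in>R. finite r \<and> card r = n"
    "X_contract G e = joint (forests t) R" "X_delete G e = joint (trees t) R"
    unfolding decomposes_def by blast
  moreover have "medges ?G - {e} \<subseteq> medges G - {e}" by (auto simp: delete_edge_def)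
  ultimately show ?thesis by (intro decomposesI[of t _ R n]) auto
qed

text \<open>Neither edge is \<open>e\<close>, so doubling commutes with contracting and deleting
  \<open>e\<close>.\<close>

lemma decomposed_at_parallel:
  assumes G: "reducible_at G e" and fg: "f \<in> medges G" "g \<in> medges G" "f \<noteq> g" "f \<noteq> e" "g \<noteq> e"
      "mends G f = mends G g"
    and IH: "reducible_at (delete_edge G g) e \<Longrightarrow> decomposed_at (delete_edge G g) e"
  shows "decomposed_at G e"
proof -
  let ?G = "delete_edge G g"
  have sp: "series_parallel ?G"
    using G by (simp add: reducible_at_def series_parallel_delete_edge)
  have img: "mends G ` T = mends G ` (T - {g})" if "f \<in> T" for T
    using that fg by (auto simp: image_iff)
  have "medges G - {e} - {g} = medges G - {g} - {e}" by blast
  then have "reducible_at ?G e"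
    using G fg sp img[of "medges G"] img[of "medges G - {e}"]
    by (simp add: reducible_at_def delete_edge_def)
  then have "decomposed_at ?G e" by (rule IH)
  then have "decomposes (insert g (medges ?G - {e}))
      (double_in f g (X_contract ?G e)) (double_in f g (X_delete ?G e))"
    by (rule decomposes_double) (use fg in \<open>auto simp: delete_edge_def\<close>)
  moreover have "insert g (medges ?G - {e}) = medges G - {e}"
    using fg by (auto simp: delete_edge_def)
  moreover have "G = add_edge ?G g (mends ?G f)"
    using fg multigraph_ends[of G f] G
    by (simp add: add_edge_def delete_edge_def insert_absorb fun_upd_idem Un_absorb2
        reducible_at_def series_parallel_def)
  then have "spanning_trees G = double_in f g (spanning_trees ?G)"
    using spanning_trees_add_parallel[of ?G f g] sp fg
    by (simp add: delete_edge_def series_parallel_def)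
  ultimately show ?thesis
    using fg by (simp add: X_contract_eq X_delete_eq contract_in_double remove_in_double)
qed

lemma decomposed_at_pendant:
  assumes G: "reducible_at G e" and f: "f \<in> medges G" "mends G f = {a, w}" "a \<noteq> w" "f \<noteq> e"
    and only: "\<And>h. h \<in> medges G \<Longrightarrow> w \<in> mends G h \<Longrightarrow> h = f"
    and G0: "G0 = \<lparr>mverts = mverts G - {w}, medges = medges G - {f}, mends = mends G\<rparr>"
    and IH: "reducible_at G0 e \<Longrightarrow> decomposed_at G0 e"
  shows "decomposed_at G e"
proof -
  have mg: "multigraph G" using G by (simp add: reducible_at_def series_parallel_def)
  have aw: "a \<in> mverts G0" "w \<notin> mverts G0" "w \<in> mverts G" "insert w (mverts G0) = mverts G"
    using multigraph_ends[OF mg f(1)] f by (auto simp: G0)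
  have ends: "mends G h \<subseteq> mverts G - {w}" if "h \<in> medges G" "h \<noteq> f" for h
    using multigraph_ends[OF mg that(1)] only that by blast
  have sp: "series_parallel G0"
    by (rule series_parallel_sub[of G]) (use G ends in \<open>auto simp: G0 reducible_at_def\<close>)
  have con: "connects G0 (T - {f})" if T: "connects G T" "f \<in> T" "T \<subseteq> medges G" for T
  proof -
    have "mends G ` T = insert {a, w} (mends G ` (T - {f}))" using T f by auto
    moreover have "\<Union> (mends G ` (T - {f})) \<subseteq> mverts G0" using ends T by (auto simp: G0)
    moreover have "mends G0 = mends G" by (simp add: G0)
    ultimately show ?thesis
      using connected_by_pendant[OF aw(2) _ aw(1), of "mends G ` (T - {f})"] T(1) aw(4) by simp
  qed
  have "medges G - {e} - {f} = medges G - {f} - {e}" by blast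
  then have "reducible_at G0 e"
    using G f sp con[of "medges G"] con[of "medges G - {e}"]
    by (simp add: reducible_at_def G0 del: Diff_insert0)
  then have "decomposed_at G0 e" by (rule IH)
  then have "decomposes (insert f (medges G0 - {e}))
      (insert f ` X_contract G0 e) (insert f ` X_delete G0 e)"
    by (rule decomposes_pendant) (simp add: G0)
  moreover have "insert f (medges G0 - {e}) = medges G - {e}"
    using f by (auto simp: G0)
  moreover have "G = add_edge G0 f {a, w}"
    using f(1,2) aw by (simp add: add_edge_def G0 insert_absorb fun_upd_idem)
  then have "spanning_trees G = insert f ` spanning_trees G0"
    using spanning_trees_add_pendant[of G0 f w a] sp aw
    by (simp add: G0 series_parallel_def)
  ultimately show ?thesis
    using f by (simp add: X_contract_eq X_delete_eq contract_in_pendant remove_in_pendant)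
qed

text \<open>Suppressing \<open>w\<close> makes \<open>f\<close> an edge from \<open>a\<close> to
  \<open>b\<close> and forgets \<open>g\<close>; subdividing \<open>f\<close> restores
  \<open>G\<close>. The two neighbours are distinct, so \<open>f\<close> does not become a
  loop.\<close>

lemma decomposed_at_series:
  assumes G: "reducible_at G e" and f: "f \<in> medges G" "mends G f = {a, w}" "a \<noteq> w" "f \<noteq> e"
    and g: "g \<in> medges G" "mends G g = {w, b}" "b \<noteq> w" "g \<noteq> e" and ab: "a \<noteq> b"
    and only: "\<And>h. h \<in> medges G \<Longrightarrow> w \<in> mends G h \<Longrightarrow> h = f \<or> h = g"
    and G0: "G0 = \<lparr>mverts = mverts G - {w}, medges = medges G - {g}, mends = (mends G)(f := {a, b})\<rparr>"
    and IH: "reducible_at G0 e \<Longrightarrow> decomposed_at G0 e"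
  shows "decomposed_at G e"
proof -
  have mg: "multigraph G" using G by (simp add: reducible_at_def series_parallel_def)
  have fg: "f \<noteq> g" using f g ab by (auto simp: doubleton_eq_iff)
  have abw: "a \<in> mverts G0" "b \<in> mverts G0" "w \<notin> mverts G0" "insert w (mverts G0) = mverts G"
    using multigraph_ends[OF mg f(1)] multigraph_ends[OF mg g(1)] f g by (auto simp: G0)
  have ends: "mends G h \<subseteq> mverts G0" if "h \<in> medges G - {f, g}" for h
    using multigraph_ends[OF mg, of h] only[of h] that by (auto simp: G0)
  have mg0: "multigraph G0"
    unfolding multigraph_def
  proof (intro conjI ballI)
    fix h assume h: "h \<in> medges G0"
    show "mends G0 h \<subseteq> mverts G0"
      using ends[of h] h abw by (cases "h = f") (simp_all add: G0)
    show "card (mends G0 h) \<in> {1, 2}"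
      using h mg ab by (cases "h = f") (auto simp: G0 multigraph_def)
  qed (use mg in \<open>simp_all add: G0 multigraph_def\<close>)
  have f0: "f \<in> medges G0" "mends G0 f = {a, b}" "g \<notin> medges G0" using f fg by (simp_all add: G0)
  have G_eq: "G = subdivide_edge G0 f a b g w"
  proof -
    have "(mends G)(f := {a, b}, f := {a, w}, g := {w, b}) = mends G"
      using f(2) g(2) fg by (auto simp: fun_eq_iff)
    then show ?thesis
      using g(1) abw(4) by (simp add: subdivide_edge_def G0 insert_absorb)
  qed
  have con: "connects G0 (T - {g})" if "connects G T" "f \<in> T" "g \<in> T" "T \<subseteq> medges G" for T
  proof -
    have "T \<subseteq> insert g (medges G0)" using that(4) by (auto simp: G0)
    from subdivide_edge_connects[OF mg0 f0 abw(3) this] show ?thesis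
      using that unfolding G_eq[symmetric] by simp
  qed
  have "medges G - {e} - {g} = medges G - {g} - {e}" by blast
  then have c2: "connects G0 (medges G0 - {e})"
    using con[of "medges G - {e}"] G f g by (simp add: reducible_at_def G0)
  have c1: "connects G0 (medges G0)"
    using con[of "medges G"] G f g by (simp add: reducible_at_def G0)
  have img: "mends G ` medges G = insert {a, w} (insert {w, b} (mends G ` (medges G - {f, g})))"
    using f(1,2) g(1,2) by auto
  have img0: "mends G0 ` medges G0 = insert {a, b} (mends G ` (medges G - {f, g}))"
    using f0 fg by (auto simp: G0 image_iff)
  \<comment> \<open>A K4 minor of the smaller graph would survive the subdivision.\<close>
  have "\<not> has_K4 (mverts G0) (mends G0 ` medges G0)"
  proof
    assume "has_K4 (mverts G0) (mends G0 ` medges G0)"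
    then have "has_K4 (insert w (mverts G0)) (mends G ` medges G)"
      unfolding img img0
      by (rule has_K4_subdivide[rotated 4]) (use ends abw in auto)
    then show False using G by (simp add: abw(4) reducible_at_def series_parallel_K4)
  qed
  then have "reducible_at G0 e"
    using G c1 c2 mg0 f g by (simp add: reducible_at_def series_parallel_K4) (simp add: G0)
  then have "decomposed_at G0 e" by (rule IH)
  then have "decomposes (insert g (medges G0 - {e}))
      (subdivide_in f g (X_contract G0 e)) (subdivide_in f g (X_delete G0 e))"
    by (rule decomposes_subdivide) (use f fg in \<open>auto simp: G0\<close>)
  moreover have "insert g (medges G0 - {e}) = medges G - {e}"
    using g by (auto simp: G0)
  moreover have "spanning_trees G = subdivide_in f g (spanning_trees G0)"
    using spanning_trees_subdivide_edge[OF mg0 f0 abw(3)] by (simp add: G_eq[symmetric])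
  ultimately show ?thesis
    using f g by (simp add: X_contract_eq X_delete_eq contract_in_subdivide remove_in_subdivide)
qed

text \<open>Induction on the number of edges. Loops and parallel edges are removed first, because
  the low-degree lemma counts neighbours whereas suppression needs to know all edges at the
  vertex.\<close>

lemma decomposed_at_if_reducible_at:
  fixes G :: "('v, 'e) mgraph"
  shows "reducible_at G e \<Longrightarrow> decomposed_at G e"
proof (induction "card (medges G)" arbitrary: G rule: less_induct)
  case less
  note G = \<open>reducible_at G e\<close>
  then have mg: "multigraph G" and e: "e \<in> medges G" "card (mends G e) = 2"
    and conE: "connects G (medges G)" and conD: "connects G (medges G - {e})"
    and K4: "\<not> has_K4 (mverts G) (mends G ` medges G)"
    by (auto simp: reducible_at_def series_parallel_K4)
  have IH: "decomposed_at G' e" if "reducible_at G' e" "medges G' = medges G - {f}" "f \<in> medges G"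
    for G' :: "('v, 'e) mgraph" and f
  proof (rule less.hyps[OF _ that(1)])
    show "card (medges G') < card (medges G)"
      unfolding that(2) using that(3) mg by (intro card_Diff1_less) (simp_all add: multigraph_def)
  qed
  consider (loop) f x where "f \<in> medges G" "mends G f = {x}"
    | (parallel) f g where "f \<in> medges G" "g \<in> medges G" "f \<noteq> g" "f \<noteq> e" "g \<noteq> e"
        "mends G f = mends G g"
    \<comment> \<open>The edge \<open>e\<close> is exempt: the reduction ends with \<open>e\<close>
      and one edge parallel to it.\<close>
    | (simple) "\<forall>f\<in>medges G. card (mends G f) = 2" "inj_on (mends G) (medges G - {e})"
  proof -
    have "card (mends G f) = 1 \<or> card (mends G f) = 2" if "f \<in> medges G" for f
      using mg that by (simp add: multigraph_def)
    then consider f where "f \<in> medges G" "card (mends G f) = 1"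
      | "\<forall>f\<in>medges G. card (mends G f) = 2" by blast
    then show thesis
    proof cases
      case 1
      then show thesis using loop by (auto simp: card_1_singleton_iff)
    next
      case 2
      then show thesis using simple parallel unfolding inj_on_def by blast
    qed
  qed
  then show ?case
  proof cases
    case loop
    have "medges (delete_edge G f) = medges G - {f}" by (simp add: delete_edge_def)
    then show ?thesis using decomposed_at_loop[OF G loop] IH loop(1) by blast
  next
    case parallel
    have "medges (delete_edge G g) = medges G - {g}" by (simp add: delete_edge_def)
    then show ?thesis using decomposed_at_parallel[OF G parallel] IH parallel(2) by blast
  next
    case simple
    obtain u v where uv: "mends G e = {u, v}" "u \<noteq> v" using e(2) by (auto simp: card_2_iff)
    have ends: "\<exists>x. mends G h = {w, x} \<and> x \<noteq> w" if h: "h \<in> medges G" "w \<in> mends G h" for h w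
    proof -
      have "card (mends G h) = 2" using simple(1) h(1) by blast
      then obtain p q where "mends G h = {p, q}" "p \<noteq> q" by (auto simp: card_2_iff)
      then show ?thesis using h(2) by (auto simp: doubleton_eq_iff)
    qed
    show ?thesis
    proof (cases "mverts G = {u, v}")
      case True
      have all: "mends G h = {u, v}" if "h \<in> medges G" for h
      proof (rule card_subset_eq)
        show "mends G h \<subseteq> {u, v}" using multigraph_ends[OF mg that] unfolding True .
        show "card (mends G h) = card {u, v}" using bspec[OF simple(1) that] uv(2) by simp
      qed simp
      have "linked (mends G ` (medges G - {e})) u v" using conD True by (simp add: connected_by_def)
      moreover have "\<not> linked {} u v" using uv(2) by (simp add: linked_def)
      ultimately have "medges G - {e} \<noteq> {}" by (metis image_empty)
      then obtain f where f: "f \<in> medges G" "f \<noteq> e" by blast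
      \<comment> \<open>On two vertices without loops all edges are parallel, so by injectivity only
        one besides \<open>e\<close> remains; at least one exists since \<open>e\<close> is no
        bridge.\<close>
      have "medges G = {e, f}"
      proof -
        have "h = f" if "h \<in> medges G" "h \<noteq> e" for h
          using simple(2) by (rule inj_onD) (use all that f in simp_all)
        then show ?thesis using e(1) f by blast
      qed
      from digon_families[OF mg True uv(2) this f(2)[symmetric] all[OF e(1)] all[OF f(1)]]
      \<comment> \<open>The common factor starts as \<open>{{}}\<close>, which is neutral for
        \<open>joint\<close>.\<close>
      show ?thesis
        using f \<open>medges G = {e, f}\<close>
        by (intro decomposesI[of "Leaf f" _ "{{}}" 0]) (auto simp: joint_def)
    next
      case False
      define F where "F = mends G ` medges G"
      have FV: "\<Union> F \<subseteq> mverts G" unfolding F_def by (rule multigraph_Union_ends[OF mg]) simp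
      have conF: "connected_by (mverts G) F" using conE by (simp add: F_def)
      have "\<exists>w\<in>mverts G - {u, v}. card {x. x \<noteq> w \<and> {w, x} \<in> F} \<le> 2"
      proof (rule low_degree_vertex)
        show "finite (mverts G)" using mg by (simp add: multigraph_def)
        show "\<Union> F \<subseteq> mverts G" by (rule FV)
        show "{u, v} \<in> F" unfolding F_def uv(1)[symmetric] using e(1) by (rule imageI)
        show "\<not> has_K4 (mverts G) F" using K4 by (simp add: F_def)
        show "connected_by (mverts G) F" by (rule conF)
      qed (use uv False in auto)
      then obtain w where w: "w \<in> mverts G" "w \<noteq> u" "w \<noteq> v"
        and deg: "card {x. x \<noteq> w \<and> {w, x} \<in> F} \<le> 2" by auto
      define N where "N = {x. x \<noteq> w \<and> {w, x} \<in> F}"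
      have N: "x \<in> N" if "h \<in> medges G" "mends G h = {w, x}" "x \<noteq> w" for h x
        using imageI[OF that(1), of "mends G"] that(2,3) by (simp add: N_def F_def)
      have "N \<subseteq> mverts G" using FV by (auto simp: N_def)
      then have finN: "finite N" using mg by (auto simp: multigraph_def intro: finite_subset)
      have "u \<in> mverts G" using multigraph_ends[OF mg e(1)] uv by auto
      then obtain a where "{w, a} \<in> F" "a \<noteq> w"
        using connected_by_first_edge[OF conF w(1) _ w(2)[symmetric]] by blast
      then obtain f where f: "f \<in> medges G" "mends G f = {w, a}" "a \<noteq> w" by (auto simp: F_def)
      have not_e: "h \<noteq> e" if "w \<in> mends G h" for h using that uv w by auto
      \<comment> \<open>As \<open>e\<close> does not meet \<open>w\<close>, edges at
        \<open>w\<close> with the same other end coincide, so the neighbours of \<open>w\<close>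
        count its edges.\<close>
      have unique: "h = h'" if "h \<in> medges G" "h' \<in> medges G" "mends G h = {w, x}" "mends G h' = {w, x}"
        for h h' x
        using simple(2) that not_e[of h] not_e[of h'] by (simp add: inj_on_def)
      have wa: "{w, a} = {a, w}" by blast
      show ?thesis
      proof (cases "N = {a}")
        case True
        have only: "h = f" if h: "h \<in> medges G" "w \<in> mends G h" for h
        proof -
          obtain x where x: "mends G h = {w, x}" "x \<noteq> w" using ends[OF h] by blast
          then have "x = a" using N[OF h(1)] True by blast
          then show ?thesis using unique[OF h(1) f(1) _ f(2)] x(1) by simp
        qed
        show ?thesis
          by (rule decomposed_at_pendant[OF G f(1) f(2)[unfolded wa] f(3) not_e only refl])
            (use f IH in simp_all)
      next
        case False
        then obtain b where b: "b \<in> N" "b \<noteq> a" using N[OF f] by blast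
        then obtain g where g: "g \<in> medges G" "mends G g = {w, b}" "b \<noteq> w"
          by (auto simp: N_def F_def)
        have "{a, b} \<subseteq> N" using N[OF f] b by blast
        moreover have "card {a, b} = 2" using b(2) by simp
        moreover have "card N \<le> 2" using deg by (simp add: N_def)
        ultimately have N_eq: "N = {a, b}" using card_seteq[OF finN, of "{a, b}"] by simp
        have only: "h = f \<or> h = g" if h: "h \<in> medges G" "w \<in> mends G h" for h
        proof -
          obtain x where x: "mends G h = {w, x}" "x \<noteq> w" using ends[OF h] by blast
          then have "x = a \<or> x = b" using N[OF h(1)] N_eq by blast
          then show ?thesis
            using unique[OF h(1) f(1) _ f(2)] unique[OF h(1) g(1) _ g(2)] x(1) by auto
        qed
        show ?thesis
          by (rule decomposed_at_series[OF G f(1) f(2)[unfolded wa] f(3) not_e g not_e b(2)[symmetric]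
                only refl]) (use f g IH in simp_all)
      qed
    qed
  qed
qed

lemma G_prime_decomposed_at:
  assumes "(G, e) \<in> G_prime"
  shows "decomposed_at G e"
proof (rule decomposed_at_if_reducible_at)
  have sp: "series_parallel G" and con: "connects G (medges G)" and e: "e \<in> medges G"
    and bridge: "\<not> is_bridge G e" and loop: "\<not> is_loop G e"
    using assms by (auto simp: G_prime_def mconnected_def)
  have "card (mends G e) = 2"
    using sp e loop by (auto simp: series_parallel_def multigraph_def is_loop_def)
  moreover have "connects G (medges G - {e})"
    using con
  proof (rule connected_by_weaken)
    fix x y assume "{x, y} \<in> mends G ` medges G"
    then have "{x, y} = mends G e \<or> {x, y} \<in> mends G ` (medges G - {e})" by auto
    then show "linked (mends G ` (medges G - {e})) x y"
    proof
      assume "{x, y} = mends G e"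
      then have "x \<in> mends G e" "y \<in> mends G e" by auto
      then show ?thesis using bridge e by (auto simp: is_bridge_def)
    qed (rule linked_step)
  qed
  ultimately show "reducible_at G e" using sp con e by (simp add: reducible_at_def)
qed

section \<open>Realising terms by 2-connected graphs\<close>

text \<open>Connectedness after deleting any edge is carried along for two reasons: for
  \<open>e\<close> it excludes a bridge, and for \<open>f\<close> it answers the deletion of the new
  vertex once \<open>f\<close> has been subdivided.\<close>

definition realizes :: "('v, 'e) mgraph \<Rightarrow> 'e \<Rightarrow> 'e sp \<Rightarrow> bool" where
  "realizes G e t \<longleftrightarrow> series_parallel G \<and> medges G = insert e (labels t) \<and>
    (\<forall>f\<in>medges G. card (mends G f) = 2) \<and> (\<forall>f\<in>medges G. connects G (medges G - {f})) \<and>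
    (\<forall>v\<in>mverts G. connected_by (mverts G - {v}) {A \<in> mends G ` medges G. A \<subseteq> mverts G - {v}}) \<and>
    X_contract G e = forests t \<and> X_delete G e = trees t"

lemma realizesD:
  assumes "realizes G e t"
  shows "series_parallel G" "medges G = insert e (labels t)"
    and "f \<in> medges G \<Longrightarrow> card (mends G f) = 2"
    and "f \<in> medges G \<Longrightarrow> connects G (medges G - {f})"
    and "v \<in> mverts G \<Longrightarrow>
      connected_by (mverts G - {v}) {A \<in> mends G ` medges G. A \<subseteq> mverts G - {v}}"
    and "X_contract G e = forests t" "X_delete G e = trees t"
  using assms unfolding realizes_def by meson+

lemma not_has_K4_doubleton:
  assumes "u \<noteq> v"
  shows "\<not> has_K4 {u, v} F"
proof
  assume "has_K4 {u, v} F"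
  then obtain \<beta> where \<beta>: "\<forall>x<4::nat. \<beta> x \<subseteq> {u, v} \<and> connected_by (\<beta> x) {A \<in> F. A \<subseteq> \<beta> x}"
    and dis: "\<forall>x<4. \<forall>y<4. x \<noteq> y \<longrightarrow> \<beta> x \<inter> \<beta> y = {} \<and> (\<exists>u\<in>\<beta> x. \<exists>v\<in>\<beta> y. {u, v} \<in> F)"
    unfolding has_K4_def by blast
  have "u \<in> \<beta> x \<or> v \<in> \<beta> x" if "x < 4" for x
    using \<beta>[rule_format, OF that] unfolding connected_by_def by blast
  from this[of 0] this[of 1] this[of 2]
  show False using dis[rule_format, of 0 1] dis[rule_format, of 0 2] dis[rule_format, of 1 2]
    by (simp add: disjoint_iff) blast
qed

lemma realizes_Leaf:
  assumes "e \<noteq> f"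
  shows "\<exists>G :: (nat, 'e) mgraph. realizes G e (Leaf f)"
proof -
  define G :: "(nat, 'e) mgraph" where
    "G = \<lparr>mverts = {0, 1}, medges = {e, f}, mends = (\<lambda>_. {0, 1})\<rparr>"
  have mg: "multigraph G" by (auto simp: multigraph_def G_def)
  have con: "connects G T" if "T \<noteq> {}" for T
    unfolding connected_by_def using that
    by (auto simp: G_def insert_commute intro!: linked_step)
  have "realizes G e (Leaf f)"
    unfolding realizes_def
  proof (intro conjI ballI)
    show "series_parallel G"
      using mg not_has_K4_doubleton[of 0 "1::nat"] by (simp add: series_parallel_K4 G_def)
    show "X_contract G e = forests (Leaf f)" "X_delete G e = trees (Leaf f)"
      using digon_families[OF mg, of 0 1 e f] assms by (simp_all add: G_def)
    fix h assume "h \<in> medges G"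
    then show "connects G (medges G - {h})" using assms by (intro con) (auto simp: G_def)
    show "card (mends G h) = 2" by (simp add: G_def)
  next
    fix v assume "v \<in> mverts G"
    then show "connected_by (mverts G - {v}) {A \<in> mends G ` medges G. A \<subseteq> mverts G - {v}}"
      by (auto simp: G_def connected_by_def)
  qed (simp add: G_def)
  then show ?thesis by blast
qed

text \<open>The vertices and the set of pairs of ends stay the same, so the absence of K4 and
  connectedness after deleting a vertex are inherited unchanged.\<close>

lemma realizes_double:
  assumes G: "realizes G e s" and f: "f \<in> labels s" and g: "g \<notin> labels s" "g \<noteq> e" and s: "read_once s"
    and e: "e \<notin> labels s"
  shows "realizes (add_edge G g (mends G f)) e (double_leaf f g s)"
proof -
  let ?G = "add_edge G g (mends G f)"
  have mg: "multigraph G" and fE: "f \<in> medges G" "f \<noteq> e" "g \<notin> medges G"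
    using G f g e by (auto simp: realizes_def series_parallel_def)
  have V: "mverts ?G = mverts G" using multigraph_ends[OF mg fE(1)] by (auto simp: add_edge_def)
  have E: "medges ?G = insert g (medges G)" by (simp add: add_edge_def)
  have img: "mends ?G ` medges ?G = mends G ` medges G"
    unfolding E image_mends_add_edge using fE by auto
  have mg': "multigraph ?G"
    using mg G fE by (intro multigraph_add_edge) (auto simp: realizes_def)
  show ?thesis
    unfolding realizes_def
  proof (intro conjI ballI)
    show "series_parallel ?G" using mg' realizesD(1)[OF G]
      unfolding series_parallel_K4 img V by blast
    show "medges ?G = insert e (labels (double_leaf f g s))"
      using G f by (auto simp: E labels_subst_leaf realizes_def)
    have st: "spanning_trees ?G = double_in f g (spanning_trees G)"
      by (rule spanning_trees_add_parallel[OF mg fE(1,3)])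
    show "X_contract ?G e = forests (double_leaf f g s)" "X_delete ?G e = trees (double_leaf f g s)"
      using realizesD(6,7)[OF G] double_leaf_forests_trees[OF s f g(1)] fE g(2)
      by (simp_all add: X_contract_eq X_delete_eq st contract_in_double remove_in_double)
    fix h assume h: "h \<in> medges ?G"
    then show "card (mends ?G h) = 2" using G fE by (auto simp: add_edge_def realizes_def)
    \<comment> \<open>Deleting \<open>g\<close> leaves all of \<open>G\<close>, so any edge may play
      \<open>h'\<close>; otherwise \<open>h'\<close> is \<open>h\<close>.\<close>
    obtain h' where h': "h' \<in> medges G" "medges G - {h'} \<subseteq> medges ?G - {h}"
      using h fE by (cases "h = g") (auto simp: E)
    have "g \<notin> medges G - {h'}" using fE by blast
    then have "mends ?G ` (medges G - {h'}) = mends G ` (medges G - {h'})"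
      unfolding image_mends_add_edge by (rule if_not_P)
    then have "mends G ` (medges G - {h'}) \<subseteq> mends ?G ` (medges ?G - {h})"
      using image_mono[OF h'(2), of "mends ?G"] by (simp only:)
    with realizesD(4)[OF G h'(1)] show "connects ?G (medges ?G - {h})"
      unfolding V by (rule connected_by_mono)
  next
    fix v assume "v \<in> mverts ?G"
    then show "connected_by (mverts ?G - {v}) {A \<in> mends ?G ` medges ?G. A \<subseteq> mverts ?G - {v}}"
      unfolding V img by (rule realizesD(5)[OF G])
  qed
qed

text \<open>Deleting an edge is read off from \<open>subdivide_edge_connects\<close>. Deleting a
  vertex depends on its position: without \<open>w\<close> there remains \<open>G\<close> without
  \<open>f\<close>, without one end of \<open>f\<close> the vertex \<open>w\<close> hangs on the
  other end, and elsewhere the path through \<open>w\<close> replaces \<open>f\<close>.\<close>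

lemma realizes_subdivide:
  assumes G: "realizes G e s" and f: "f \<in> labels s" and g: "g \<notin> labels s" "g \<noteq> e" and s: "read_once s"
    and e: "e \<notin> labels s" and ab: "mends G f = {a, b}" and w: "w \<notin> mverts G"
  shows "realizes (subdivide_edge G f a b g w) e (subdivide_leaf f g s)"
proof -
  let ?G = "subdivide_edge G f a b g w"
  have mg: "multigraph G" and fE: "f \<in> medges G" "f \<noteq> e" "g \<notin> medges G" "f \<noteq> g"
    using G f g e by (auto simp: realizes_def series_parallel_def)
  have abV: "a \<in> mverts G" "b \<in> mverts G" using multigraph_ends[OF mg fE(1)] ab by auto
  have "card (mends G f) = 2" using G fE by (simp add: realizes_def)
  then have neq: "a \<noteq> b" "a \<noteq> w" "b \<noteq> w" using ab abV w by auto
  have V: "mverts ?G = insert w (mverts G)" by (simp add: subdivide_edge_def)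
  have E: "medges ?G = insert g (medges G)" by (simp add: subdivide_edge_def)
  define F where "F = mends G ` (medges G - {f})"
  have FV: "\<Union> F \<subseteq> mverts G" unfolding F_def by (rule multigraph_Union_ends[OF mg]) blast
  have "medges G = insert f (medges G - {f})" using fE by blast
  then have img0: "mends G ` medges G = insert {a, b} F" unfolding F_def by (metis image_insert ab)
  have img: "mends ?G ` medges ?G = insert {a, w} (insert {w, b} F)"
  proof -
    have "mends ?G ` (medges G - {f}) = F"
      unfolding F_def by (rule image_cong[OF refl]) (use fE in \<open>auto simp: subdivide_edge_def\<close>)
    moreover have "mends ?G f = {a, w}" "mends ?G g = {w, b}"
      using fE by (simp_all add: subdivide_edge_def)
    moreover have "medges ?G = insert f (insert g (medges G - {f}))" using fE unfolding E by blast
    ultimately show ?thesis by simp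
  qed
  have mg': "multigraph ?G" using mg abV w by (rule multigraph_subdivide_edge)
  show ?thesis
    unfolding realizes_def
  proof (intro conjI ballI)
    have "\<not> has_K4 (mverts ?G) (mends ?G ` medges ?G)"
      using has_K4_unsubdivide[OF w FV abV] realizesD(1)[OF G]
      unfolding img V series_parallel_K4 img0 by blast
    then show "series_parallel ?G" using mg' by (simp add: series_parallel_K4)
    show "medges ?G = insert e (labels (subdivide_leaf f g s))"
      using G f by (auto simp: E labels_subst_leaf realizes_def)
    have st: "spanning_trees ?G = subdivide_in f g (spanning_trees G)"
      by (rule spanning_trees_subdivide_edge[OF mg fE(1) ab fE(3) w])
    show "X_contract ?G e = forests (subdivide_leaf f g s)" "X_delete ?G e = trees (subdivide_leaf f g s)"
      using realizesD(6,7)[OF G] subdivide_leaf_forests_trees[OF s f g(1)] fE g(2)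
      by (simp_all add: X_contract_eq X_delete_eq st contract_in_subdivide
          remove_in_subdivide)
    fix h assume h: "h \<in> medges ?G"
    then show "card (mends ?G h) = 2" using G fE neq by (auto simp: subdivide_edge_def realizes_def)
    have con: "connects G (medges G - {h})" if "h \<in> medges G" for h
      by (rule realizesD(4)[OF G that])
    have sub: "medges ?G - {h} \<subseteq> insert g (medges G)" unfolding E by blast
    note iff = subdivide_edge_connects[OF mg fE(1) ab fE(3) w sub]
    consider "h = f" | "h = g" | "h \<noteq> f" "h \<noteq> g" "h \<in> medges G" using h E by blast
    then show "connects ?G (medges ?G - {h})"
    proof cases
      case 1
      then have "medges ?G - {h} - {f, g} = medges G - {f}" using fE unfolding E by blast
      then show ?thesis using iff con[OF fE(1)] 1 fE by (simp add: E)
    next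
      case 2
      then have "medges ?G - {h} - {f, g} = medges G - {f}" using fE unfolding E by blast
      then show ?thesis using iff con[OF fE(1)] 2 fE by (simp add: E)
    next
      case 3
      then have "medges ?G - {h} - {g} = medges G - {h}" using fE unfolding E by blast
      then show ?thesis using iff con[OF 3(3)] 3 fE by (simp add: E)
    qed
  next
    fix v assume v: "v \<in> mverts ?G"
    define F' where "F' = {A \<in> mends ?G ` medges ?G. A \<subseteq> mverts ?G - {v}}"
    define Fv where "Fv = {A \<in> F. A \<subseteq> mverts G - {v}}"
    have F': "A \<in> F'"
      if "A \<in> insert {a, w} (insert {w, b} F)" "A \<subseteq> insert w (mverts G) - {v}" for A
      using that unfolding F'_def img V by blast
    have Fv: "linked F' x y" if "{x, y} \<in> Fv" for x y
      by (rule linked_step, rule F') (use that in \<open>auto simp: Fv_def\<close>)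
    have old: "connected_by (mverts G - {v}) {A \<in> insert {a, b} F. A \<subseteq> mverts G - {v}}"
      if "v \<noteq> w"
      using realizesD(5)[OF G, of v] v that unfolding V img0 by blast
    have Vv: "mverts ?G - {v} = insert w (mverts G - {v})" if "v \<noteq> w" using that unfolding V by blast
    have aw: "linked F' a w" if "v \<noteq> w" "v \<noteq> a"
      by (rule linked_step, rule F') (use that abV in auto)
    have wb: "linked F' w b" if "v \<noteq> w" "v \<noteq> b"
      by (rule linked_step, rule F') (use that abV in auto)
    have "connected_by (mverts ?G - {v}) F'"
    proof -
      consider "v = w" | "v = a" | "v = b" | "v \<noteq> w" "v \<noteq> a" "v \<noteq> b" by blast
      then show ?thesis
      proof cases
        case 1
        have "connected_by (mverts G) F" unfolding F_def by (rule realizesD(4)[OF G fE(1)])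
        moreover have "F \<subseteq> F'"
        proof
          fix A assume A: "A \<in> F"
          then have "A \<subseteq> mverts G" using FV by blast
          then show "A \<in> F'" using A w 1 by (intro F') auto
        qed
        ultimately have "connected_by (mverts G) F'" by (rule connected_by_mono)
        moreover have "mverts ?G - {v} = mverts G" using w unfolding V 1 by simp
        ultimately show ?thesis by simp
      next
        case 2
        have "{A \<in> insert {a, b} F. A \<subseteq> mverts G - {v}} = Fv" using 2 by (auto simp: Fv_def)
        then have "connected_by (mverts G - {v}) Fv" using old 2 neq by simp
        moreover have "b \<in> mverts G - {v}" using abV neq 2 by blast
        moreover have "linked F' b w" using wb 2 neq by (simp add: linked_sym)
        ultimately have "connected_by (insert w (mverts G - {v})) F'"
          by (rule connected_by_extend) (rule Fv)
        then show ?thesis using Vv 2 neq by simp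
      next
        case 3
        have "{A \<in> insert {a, b} F. A \<subseteq> mverts G - {v}} = Fv" using 3 by (auto simp: Fv_def)
        then have "connected_by (mverts G - {v}) Fv" using old 3 neq by simp
        moreover have "a \<in> mverts G - {v}" using abV neq 3 by blast
        moreover have "linked F' a w" using aw 3 neq by simp
        ultimately have "connected_by (insert w (mverts G - {v})) F'"
          by (rule connected_by_extend) (rule Fv)
        then show ?thesis using Vv 3 neq by simp
      next
        case 4
        have ab_link: "linked F' a b" using aw wb 4 by (blast intro: linked_trans)
        have "connected_by (mverts G - {v}) {A \<in> insert {a, b} F. A \<subseteq> mverts G - {v}}"
          using old 4 by blast
        moreover have "a \<in> mverts G - {v}" using abV 4 by blast
        moreover have "linked F' a w" using aw 4 by blast
        moreover have "linked F' x y"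
          if xy: "{x, y} \<in> {A \<in> insert {a, b} F. A \<subseteq> mverts G - {v}}" for x y
        proof (cases "{x, y} = {a, b}")
          case True
          then show ?thesis using ab_link by (auto simp: doubleton_eq_iff intro: linked_sym)
        next
          case False
          then have "{x, y} \<in> Fv" using xy unfolding Fv_def by blast
          then show ?thesis by (rule Fv)
        qed
        ultimately have "connected_by (insert w (mverts G - {v})) F'"
          by (rule connected_by_extend)
        then show ?thesis using Vv 4 by simp
      qed
    qed
    then show "connected_by (mverts ?G - {v}) {A \<in> mends ?G ` medges ?G. A \<subseteq> mverts ?G - {v}}"
      unfolding F'_def .
  qed
qed

text \<open>The graph of the term with one label less is doubled or subdivided at the same edge;
  natural numbers as vertices provide the new vertex.\<close>

lemma read_once_realized:
  fixes t :: "'e sp"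
  assumes "read_once t" "e \<notin> labels t"
  shows "\<exists>G :: (nat, 'e) mgraph. realizes G e t"
  using assms
proof (induction "card (labels t)" arbitrary: t rule: less_induct)
  case less
  from less.prems(1) show ?case
  proof (cases rule: read_once_cases)
    case (1 f)
    then show ?thesis using realizes_Leaf less.prems(2) by fastforce
  next
    case (2 f g s)
    then have labels: "labels t = insert g (labels s)" by (auto simp: labels_subst_leaf)
    then have e: "e \<notin> labels s" "g \<noteq> e" using less.prems by auto
    have "card (labels s) < card (labels t)" using labels 2(3) by simp
    then obtain G :: "(nat, 'e) mgraph" where G: "realizes G e s"
      using less.hyps 2(1) e(1) by blast
    then have "multigraph G" "f \<in> medges G" "card (mends G f) = 2"
      using 2(2) by (auto simp: realizes_def series_parallel_def)
    then obtain a b where ab: "mends G f = {a, b}" by (auto simp: card_2_iff)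
    have "finite (mverts G)" using \<open>multigraph G\<close> by (simp add: multigraph_def)
    then obtain w where w: "w \<notin> mverts G" using ex_new_if_finite infinite_UNIV_nat by blast
    show ?thesis
      using 2(4) realizes_subdivide[OF G 2(2,3) e(2) 2(1) e(1) ab w]
        realizes_double[OF G 2(2,3) e(2) 2(1) e(1)] by blast
  qed
qed

lemma realizes_G_dprime:
  assumes G: "realizes G e t" and e: "e \<notin> labels t"
  shows "(G, e) \<in> G_dprime"
proof -
  have con: "connects G (medges G - {e})" and eE: "e \<in> medges G" and mg: "multigraph G"
    using G by (auto simp: realizes_def series_parallel_def)
  have "mends G ` (medges G - {e}) \<subseteq> mends G ` medges G" by blast
  with con have "mconnected G" unfolding mconnected_def by (rule connected_by_mono)
  moreover have "\<not> is_bridge G e"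
    using con multigraph_ends[OF mg eE] unfolding is_bridge_def connected_by_def by blast
  moreover have "\<not> is_loop G f" for f using G by (auto simp: is_loop_def realizes_def)
  moreover have "card (medges G) \<ge> 2"
  proof -
    have "labels t \<noteq> {}" by (induction t) auto
    then have "card (labels t) > 0" by (simp add: card_gt_0_iff)
    then show ?thesis using G e by (simp add: realizes_def)
  qed
  moreover have "mconnected (delete_vertex G v)" if "v \<in> mverts G" for v
  proof -
    have "mverts G \<inter> (mverts G - {v}) = mverts G - {v}" by blast
    moreover have "mends G ` {f \<in> medges G. mends G f \<subseteq> mverts G - {v}} =
        {A \<in> mends G ` medges G. A \<subseteq> mverts G - {v}}" by blast
    moreover note realizesD(5)[OF G that]
    ultimately show ?thesis
      by (simp add: mconnected_def delete_vertex_def minduced_def)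
  qed
  ultimately show ?thesis
    using G eE by (simp add: G_dprime_def G_prime_def two_connected_def realizes_def)
qed


section \<open>Embeddings of simple graphs and product-joins\<close>

definition map_graph :: "('v \<Rightarrow> 'w) \<Rightarrow> 'v sgraph \<Rightarrow> 'w sgraph" where
  "map_graph \<phi> H = \<lparr>sverts = \<phi> ` sverts H, sedges = (`) \<phi> ` sedges H\<rparr>"

definition graph_embedding :: "('v \<Rightarrow> 'w) \<Rightarrow> 'v sgraph \<Rightarrow> 'w sgraph \<Rightarrow> bool" where
  "graph_embedding \<phi> H K \<longleftrightarrow>
    inj_on \<phi> (sverts H) \<and> \<phi> ` sverts H \<subseteq> sverts K \<and> (\<forall>f\<in>sedges H. \<phi> ` f \<in> sedges K)"

lemma simple_graph_edge:
  assumes "simple_graph H" "f \<in> sedges H"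
  obtains x y where "f = {x, y}" "x \<noteq> y" "x \<in> sverts H" "y \<in> sverts H"
proof -
  have "card f = 2" "f \<subseteq> sverts H" using assms by (simp_all add: simple_graph_def)
  then show thesis using that by (auto simp: card_2_iff)
qed

lemma simple_map_graph:
  assumes "simple_graph H" "inj_on \<phi> (sverts H)"
  shows "simple_graph (map_graph \<phi> H)"
  unfolding simple_graph_def
proof (intro conjI ballI)
  show "finite (sverts (map_graph \<phi> H))" using assms by (simp add: map_graph_def simple_graph_def)
  fix f assume "f \<in> sedges (map_graph \<phi> H)"
  then obtain f' where f': "f' \<in> sedges H" "f = \<phi> ` f'" by (auto simp: map_graph_def)
  then have sub: "f' \<subseteq> sverts H" and "card f' = 2" using assms by (simp_all add: simple_graph_def)
  then show "card f = 2"
    unfolding f' using inj_on_subset[OF assms(2) sub] by (simp add: card_image)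
  show "f \<subseteq> sverts (map_graph \<phi> H)" using sub f' by (auto simp: map_graph_def)
qed

lemma sconnected_map_graph:
  assumes "sconnected H"
  shows "sconnected (map_graph \<phi> H)"
  unfolding sconnected_def
proof (rule connected_by_map)
  show "connected_by (sverts H) (sedges H)" using assms by (simp add: sconnected_def)
  show "\<phi> ` sverts H = sverts (map_graph \<phi> H)" by (simp add: map_graph_def)
  fix x y assume "{x, y} \<in> sedges H"
  then have "\<phi> ` {x, y} \<in> (`) \<phi> ` sedges H" by (rule imageI)
  then have "{\<phi> x, \<phi> y} \<in> sedges (map_graph \<phi> H)" by (simp add: map_graph_def)
  then show "linked (sedges (map_graph \<phi> H)) (\<phi> x) (\<phi> y)" by (rule linked_step)
qed

lemma graph_iso_map_graph: "inj_on \<phi> (sverts H) \<Longrightarrow> graph_iso H (map_graph \<phi> H)"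
  unfolding graph_iso_def by (intro exI[of _ \<phi>]) (simp add: map_graph_def bij_betw_def)

lemma graph_isoE:
  assumes "graph_iso H K"
  obtains \<phi> where "inj_on \<phi> (sverts H)" "K = map_graph \<phi> H"
proof -
  obtain \<phi> where \<phi>: "inj_on \<phi> (sverts H)" "\<phi> ` sverts H = sverts K"
    "sedges K = (`) \<phi> ` sedges H"
    using assms unfolding graph_iso_def bij_betw_def by blast
  have "K = map_graph \<phi> H" unfolding map_graph_def \<phi>(2) \<phi>(3)[symmetric] by (cases K) simp
  with \<phi>(1) show thesis by (rule that)
qed

text \<open>The bijection is injective only on the vertices, so its inverse recovers an edge only if
  that edge consists of vertices; hence the second assumption.\<close>

lemma graph_iso_sym:
  assumes "graph_iso H K" and sub: "\<And>f. f \<in> sedges H \<Longrightarrow> f \<subseteq> sverts H"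
  shows "graph_iso K H"
proof -
  obtain \<phi> where \<phi>: "inj_on \<phi> (sverts H)" "K = map_graph \<phi> H" using assms(1) by (rule graph_isoE)
  let ?\<psi> = "inv_into (sverts H) \<phi>"
  have "?\<psi> ` \<phi> ` f = f" if "f \<in> sedges H" for f
    using inv_into_image_cancel[OF \<phi>(1) sub[OF that]] .
  then have "(\<lambda>f. ?\<psi> ` \<phi> ` f) ` sedges H = (\<lambda>f. f) ` sedges H" by (rule image_cong[OF refl])
  then have "sedges H = (`) ?\<psi> ` sedges K"
    unfolding \<phi>(2) map_graph_def by (simp add: image_comp comp_def)
  moreover have "bij_betw ?\<psi> (sverts K) (sverts H)"
    unfolding \<phi>(2) map_graph_def
    using inj_on_imp_bij_betw[OF \<phi>(1), THEN bij_betw_inv_into] by simp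
  ultimately show ?thesis unfolding graph_iso_def by blast
qed

lemma graph_embedding_comp:
  assumes "graph_embedding \<phi> H K" "graph_embedding \<psi> K L"
  shows "graph_embedding (\<psi> \<circ> \<phi>) H L"
proof -
  have \<phi>: "inj_on \<phi> (sverts H)" "\<phi> ` sverts H \<subseteq> sverts K" "\<forall>f\<in>sedges H. \<phi> ` f \<in> sedges K"
    and \<psi>: "inj_on \<psi> (sverts K)" "\<psi> ` sverts K \<subseteq> sverts L" "\<forall>f\<in>sedges K. \<psi> ` f \<in> sedges L"
    using assms by (simp_all add: graph_embedding_def)
  show ?thesis
    unfolding graph_embedding_def
  proof (intro conjI ballI)
    show "inj_on (\<psi> \<circ> \<phi>) (sverts H)"
      using \<phi>(1) inj_on_subset[OF \<psi>(1) \<phi>(2)] by (rule comp_inj_on)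
    show "(\<psi> \<circ> \<phi>) ` sverts H \<subseteq> sverts L"
      unfolding image_comp[symmetric] using image_mono[OF \<phi>(2)] \<psi>(2) by (rule subset_trans)
    fix f assume "f \<in> sedges H"
    then have "\<phi> ` f \<in> sedges K" using \<phi>(3) by blast
    then show "(\<psi> \<circ> \<phi>) ` f \<in> sedges L" unfolding image_comp[symmetric] using \<psi>(3) by blast
  qed
qed

lemma graph_embedding_map_graph: "inj_on \<phi> (sverts H) \<Longrightarrow> graph_embedding \<phi> H (map_graph \<phi> H)"
  by (simp add: graph_embedding_def map_graph_def)

lemma iso_to_subgraph_embedding:
  assumes "simple_graph H"
  shows "iso_to_subgraph H K \<longleftrightarrow> (\<exists>\<phi>. graph_embedding \<phi> H K)"
proof
  assume "iso_to_subgraph H K"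
  then obtain K' where K': "sub_graph K' K" "graph_iso H K'" by (auto simp: iso_to_subgraph_def)
  from K'(2) obtain \<phi> where "inj_on \<phi> (sverts H)" "K' = map_graph \<phi> H" by (rule graph_isoE)
  then have "graph_embedding \<phi> H K"
    using K'(1) by (auto simp: graph_embedding_def sub_graph_def map_graph_def)
  then show "\<exists>\<phi>. graph_embedding \<phi> H K" by blast
next
  assume "\<exists>\<phi>. graph_embedding \<phi> H K"
  then obtain \<phi> where \<phi>: "graph_embedding \<phi> H K" by blast
  then have inj: "inj_on \<phi> (sverts H)" by (simp add: graph_embedding_def)
  have "sub_graph (map_graph \<phi> H) K"
    using \<phi> simple_map_graph[OF assms inj]
    by (auto simp: sub_graph_def graph_embedding_def map_graph_def)
  then show "iso_to_subgraph H K"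
    using graph_iso_map_graph[OF inj] by (auto simp: iso_to_subgraph_def)
qed

lemma pj_reducible_embedding:
  assumes "pj_reducible K" "graph_embedding \<phi> H K" "simple_graph H" "sconnected H"
  shows "product_join_reducible H"
proof -
  have inj: "inj_on \<phi> (sverts H)" using assms(2) by (simp add: graph_embedding_def)
  have "sub_graph (map_graph \<phi> H) K"
    using assms(2) simple_map_graph[OF assms(3) inj]
    by (auto simp: sub_graph_def graph_embedding_def map_graph_def)
  then have "pj_reducible (map_graph \<phi> H)"
    by (rule pj_reducible.sub[OF assms(1)]) (rule sconnected_map_graph[OF assms(4)])
  moreover have "graph_iso (map_graph \<phi> H) H"
    using graph_iso_map_graph[OF inj]
    by (rule graph_iso_sym) (use assms(3) in \<open>simp add: simple_graph_def\<close>)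
  ultimately show ?thesis unfolding product_join_reducible_def by blast
qed

lemma product_join_edgesI:
  "a1 \<in> A1 \<Longrightarrow> a2 \<in> A2 \<Longrightarrow> b2 \<in> B2 \<Longrightarrow> {a2, b2} \<in> sedges H2 \<Longrightarrow>
    {(a1, a2), (a1, b2)} \<in> sedges (product_join H1 A1 B1 H2 A2 B2)"
  "a1 \<in> A1 \<Longrightarrow> a2 \<in> A2 \<Longrightarrow> b1 \<in> B1 \<Longrightarrow> {a1, b1} \<in> sedges H1 \<Longrightarrow>
    {(a1, a2), (b1, a2)} \<in> sedges (product_join H1 A1 B1 H2 A2 B2)"
  unfolding product_join_def sgraph.select_convs by blast+

lemma product_join_edgesE:
  assumes "f \<in> sedges (product_join H1 A1 B1 H2 A2 B2)"
  obtains a1 a2 b2 where "f = {(a1, a2), (a1, b2)}" "a1 \<in> A1" "a2 \<in> A2" "b2 \<in> B2"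
      "{a2, b2} \<in> sedges H2"
    | a1 a2 b1 where "f = {(a1, a2), (b1, a2)}" "a1 \<in> A1" "a2 \<in> A2" "b1 \<in> B1"
      "{a1, b1} \<in> sedges H1"
  using assms unfolding product_join_def sgraph.select_convs by blast

lemma pj_reducible_edge_subset: "pj_reducible K \<Longrightarrow> f \<in> sedges K \<Longrightarrow> f \<subseteq> sverts K"
proof (induction arbitrary: f rule: pj_reducible.induct)
  case (K2 a b)
  then show ?case by (auto simp: complete_graph_def)
next
  case (sub H K)
  then show ?case by (simp add: sub_graph_def simple_graph_def)
next
  case (join H1 A1 B1 H2 A2 B2 H)
  obtain \<phi> where "H = map_graph \<phi> (product_join H1 A1 B1 H2 A2 B2)"
    using join.hyps(7) by (rule graph_isoE)
  then obtain f' where f': "f' \<in> sedges (product_join H1 A1 B1 H2 A2 B2)" "f = \<phi> ` f'"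
    and H: "sverts H = \<phi> ` sverts (product_join H1 A1 B1 H2 A2 B2)"
    using join.prems unfolding map_graph_def by auto
  from f'(1) have "f' \<subseteq> sverts (product_join H1 A1 B1 H2 A2 B2)"
    by (cases rule: product_join_edgesE) (simp_all add: product_join_def)
  then show ?case unfolding f'(2) H by (rule image_mono)
qed

lemma product_join_reducibleE:
  assumes "product_join_reducible H"
  obtains \<rho> where "inj_on \<rho> (sverts H)" "pj_reducible (map_graph \<rho> H)"
proof -
  obtain K where K: "pj_reducible K" "graph_iso K H"
    using assms(1) unfolding product_join_reducible_def by blast
  have "graph_iso H K" using K(2) pj_reducible_edge_subset[OF K(1)] by (rule graph_iso_sym)
  then obtain \<phi> where "inj_on \<phi> (sverts H)" "K = map_graph \<phi> H" by (rule graph_isoE)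
  then show thesis using that K(1) by blast
qed

lemma product_join_reducible_embedding:
  assumes "product_join_reducible K" "graph_embedding \<phi> H K" "simple_graph H" "sconnected H"
  shows "product_join_reducible H"
proof -
  obtain \<rho> where \<rho>: "inj_on \<rho> (sverts K)" "pj_reducible (map_graph \<rho> K)"
    using assms(1) by (rule product_join_reducibleE)
  show ?thesis
    by (rule pj_reducible_embedding[OF \<rho>(2) graph_embedding_comp[OF assms(2)] assms(3,4)])
      (rule graph_embedding_map_graph[OF \<rho>(1)])
qed

lemma bipartition_map_graph:
  assumes "bipartition H A B" "inj_on \<rho> (sverts H)"
  shows "bipartition (map_graph \<rho> H) (\<rho> ` A) (\<rho> ` B)"
proof -
  have AB: "A \<union> B = sverts H" "A \<inter> B = {}" using assms(1) by (auto simp: bipartition_def)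
  then have "A \<subseteq> sverts H" "B \<subseteq> sverts H" by blast+
  then have "\<rho> ` A \<inter> \<rho> ` B = {}" using inj_on_image_Int[OF assms(2)] AB(2) by (metis image_empty)
  moreover have "\<rho> ` A \<union> \<rho> ` B = sverts (map_graph \<rho> H)"
    unfolding map_graph_def AB(1)[symmetric] by (simp add: image_Un)
  moreover have "\<exists>a\<in>\<rho> ` A. \<exists>b\<in>\<rho> ` B. f = {a, b}" if f: "f \<in> sedges (map_graph \<rho> H)" for f
  proof -
    obtain f' where f': "f' \<in> sedges H" "f = \<rho> ` f'" using f by (auto simp: map_graph_def)
    have "\<exists>a\<in>A. \<exists>b\<in>B. f' = {a, b}" using assms(1) f'(1) by (simp add: bipartition_def)
    then obtain a b where ab: "a \<in> A" "b \<in> B" "f' = {a, b}" by blast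
    have "f = {\<rho> a, \<rho> b}" unfolding f'(2) ab(3) by simp
    then show ?thesis using ab(1,2) by blast
  qed
  ultimately show ?thesis unfolding bipartition_def by simp
qed

lemma graph_embedding_product_join:
  assumes bip: "bipartition H1 A1 B1" "bipartition H2 A2 B2"
    and inj: "inj_on \<rho>1 (sverts H1)" "inj_on \<rho>2 (sverts H2)"
  shows "graph_embedding (map_prod \<rho>1 \<rho>2) (product_join H1 A1 B1 H2 A2 B2)
    (product_join (map_graph \<rho>1 H1) (\<rho>1 ` A1) (\<rho>1 ` B1) (map_graph \<rho>2 H2) (\<rho>2 ` A2) (\<rho>2 ` B2))"
  unfolding graph_embedding_def
proof (intro conjI ballI)
  have AB: "A1 \<union> B1 = sverts H1" "A2 \<union> B2 = sverts H2" using bip by (auto simp: bipartition_def)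
  have "inj_on (map_prod \<rho>1 \<rho>2) (sverts H1 \<times> sverts H2)" using inj by (rule map_prod_inj_on)
  then show "inj_on (map_prod \<rho>1 \<rho>2) (sverts (product_join H1 A1 B1 H2 A2 B2))"
    by (rule inj_on_subset) (use AB in \<open>auto simp: product_join_def\<close>)
  show "map_prod \<rho>1 \<rho>2 ` sverts (product_join H1 A1 B1 H2 A2 B2) \<subseteq> sverts (product_join
      (map_graph \<rho>1 H1) (\<rho>1 ` A1) (\<rho>1 ` B1) (map_graph \<rho>2 H2) (\<rho>2 ` A2) (\<rho>2 ` B2))"
    by (auto simp: product_join_def)
  fix f assume "f \<in> sedges (product_join H1 A1 B1 H2 A2 B2)"
  then show "map_prod \<rho>1 \<rho>2 ` f \<in> sedges (product_join
      (map_graph \<rho>1 H1) (\<rho>1 ` A1) (\<rho>1 ` B1) (map_graph \<rho>2 H2) (\<rho>2 ` A2) (\<rho>2 ` B2))"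
  proof (cases rule: product_join_edgesE)
    case (1 a1 a2 b2)
    have "\<rho>2 ` {a2, b2} \<in> (`) \<rho>2 ` sedges H2" using 1(5) by (rule imageI)
    then have "{\<rho>2 a2, \<rho>2 b2} \<in> sedges (map_graph \<rho>2 H2)"
      by (simp add: map_graph_def)
    moreover have "map_prod \<rho>1 \<rho>2 ` f = {(\<rho>1 a1, \<rho>2 a2), (\<rho>1 a1, \<rho>2 b2)}" using 1(1) by simp
    ultimately show ?thesis using 1(2-4) by (simp add: product_join_edgesI)
  next
    case (2 a1 a2 b1)
    have "\<rho>1 ` {a1, b1} \<in> (`) \<rho>1 ` sedges H1" using 2(5) by (rule imageI)
    then have "{\<rho>1 a1, \<rho>1 b1} \<in> sedges (map_graph \<rho>1 H1)"
      by (simp add: map_graph_def)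
    moreover have "map_prod \<rho>1 \<rho>2 ` f = {(\<rho>1 a1, \<rho>2 a2), (\<rho>1 b1, \<rho>2 a2)}" using 2(1) by simp
    ultimately show ?thesis using 2(2-4) by (simp add: product_join_edgesI)
  qed
qed

lemma product_join_reducible_product_join:
  fixes H1 :: "'v sgraph" and H2 :: "'w sgraph"
  assumes H1: "product_join_reducible H1" "sconnected H1" "bipartition H1 A1 B1" "finite (sverts H1)"
    and H2: "product_join_reducible H2" "sconnected H2" "bipartition H2 A2 B2" "finite (sverts H2)"
    and H: "graph_embedding \<phi> H (product_join H1 A1 B1 H2 A2 B2)" "simple_graph H" "sconnected H"
  shows "product_join_reducible H"
proof -
  obtain \<rho>1 where \<rho>1: "inj_on \<rho>1 (sverts H1)" "pj_reducible (map_graph \<rho>1 H1)"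
    using H1(1) by (rule product_join_reducibleE)
  obtain \<rho>2 where \<rho>2: "inj_on \<rho>2 (sverts H2)" "pj_reducible (map_graph \<rho>2 H2)"
    using H2(1) by (rule product_join_reducibleE)
  let ?J = "product_join (map_graph \<rho>1 H1) (\<rho>1 ` A1) (\<rho>1 ` B1) (map_graph \<rho>2 H2) (\<rho>2 ` A2) (\<rho>2 ` B2)"
  have "finite A1" "finite B1" "finite A2" "finite B2"
    using H1(3,4) H2(3,4) by (auto simp: bipartition_def intro: finite_subset)
  then have "finite (sverts ?J)" by (simp add: product_join_def)
  then obtain \<epsilon> :: "nat \<times> nat \<Rightarrow> nat" where \<epsilon>: "inj_on \<epsilon> (sverts ?J)"
    using finite_imp_inj_to_nat_seg by blast
  have "pj_reducible (map_graph \<epsilon> ?J)"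
    by (rule pj_reducible.join[OF \<rho>1(2) sconnected_map_graph[OF H1(2)]
          bipartition_map_graph[OF H1(3) \<rho>1(1)] \<rho>2(2) sconnected_map_graph[OF H2(2)]
          bipartition_map_graph[OF H2(3) \<rho>2(1)] graph_iso_map_graph[OF \<epsilon>]])
  then show ?thesis
    using graph_embedding_comp[OF graph_embedding_comp[OF H(1)
        graph_embedding_product_join[OF H1(3) H2(3) \<rho>1(1) \<rho>2(1)]]
        graph_embedding_map_graph[OF \<epsilon>]] H(2,3)
    by (rule pj_reducible_embedding)
qed

section \<open>The adjacency graph of a term\<close>

text \<open>Inclusion takes the place of adjacency in the cube: for a read-once term every tree has
  exactly one element more than every forest.\<close>

definition term_graph :: "'e sp \<Rightarrow> 'e set sgraph" where
  "term_graph t = \<lparr>sverts = forests t \<union> trees t,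
     sedges = {{S, T} | S T. S \<in> forests t \<and> T \<in> trees t \<and> S \<subseteq> T}\<rparr>"

lemma term_graph_sverts: "sverts (term_graph t) = forests t \<union> trees t"
  by (simp add: term_graph_def)

lemma term_graph_edgeI: "S \<in> forests t \<Longrightarrow> T \<in> trees t \<Longrightarrow> S \<subseteq> T \<Longrightarrow> {S, T} \<in> sedges (term_graph t)"
  unfolding term_graph_def sgraph.select_convs by blast

lemma term_graph_edgeE:
  assumes "f \<in> sedges (term_graph t)"
  obtains S T where "f = {S, T}" "S \<in> forests t" "T \<in> trees t" "S \<subseteq> T"
  using assms unfolding term_graph_def sgraph.select_convs by blast

lemma forests_trees_disjoint: "read_once t \<Longrightarrow> forests t \<inter> trees t = {}"
  using card_forests_trees[of t] by (force simp: disjoint_iff)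

lemma bipartition_term_graph:
  "read_once t \<Longrightarrow> bipartition (term_graph t) (forests t) (trees t)"
  unfolding bipartition_def term_graph_sverts
  by (intro conjI ballI forests_trees_disjoint refl) (auto elim!: term_graph_edgeE)

lemma finite_forests_trees: "finite (forests t)" "finite (trees t)"
  using forests_trees_labels[of t] by (auto intro: finite_subset)

lemma simple_term_graph:
  assumes "read_once t"
  shows "simple_graph (term_graph t)"
  unfolding simple_graph_def
proof (intro conjI ballI)
  show "finite (sverts (term_graph t))" by (simp add: term_graph_sverts finite_forests_trees)
  fix f assume "f \<in> sedges (term_graph t)"
  then obtain S T where ST: "f = {S, T}" "S \<in> forests t" "T \<in> trees t"
    by (rule term_graph_edgeE)
  moreover from this have "S \<noteq> T" using forests_trees_disjoint[OF assms] by blast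
  ultimately show "f \<subseteq> sverts (term_graph t)" "card f = 2" by (simp_all add: term_graph_sverts)
qed

lemma sconnected_term_graph_dual:
  assumes "read_once t" "sconnected (term_graph t)"
  shows "sconnected (term_graph (dual t))"
  unfolding sconnected_def
proof (rule connected_by_map)
  let ?c = "\<lambda>S. labels t - S"
  show "connected_by (sverts (term_graph t)) (sedges (term_graph t))"
    using assms(2) by (simp add: sconnected_def)
  show "?c ` sverts (term_graph t) = sverts (term_graph (dual t))"
    using forests_trees_dual[OF assms(1)] by (simp add: term_graph_sverts image_Un Un_commute)
  fix S T assume "{S, T} \<in> sedges (term_graph t)"
  then obtain S' T' where ST: "{S, T} = {S', T'}" "S' \<in> forests t" "T' \<in> trees t" "S' \<subseteq> T'"
    by (rule term_graph_edgeE)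
  then have "{?c T', ?c S'} \<in> sedges (term_graph (dual t))"
    using forests_trees_dual[OF assms(1)] by (intro term_graph_edgeI) auto
  then have "linked (sedges (term_graph (dual t))) (?c T') (?c S')" by (rule linked_step)
  then show "linked (sedges (term_graph (dual t))) (?c S) (?c T)"
    using ST(1) by (auto simp: doubleton_eq_iff intro: linked_sym)
qed

text \<open>Complementation reverses inclusion and exchanges the parts, so adjacency is
  preserved.\<close>

lemma term_graph_dual_embedding:
  assumes "read_once t"
  shows "graph_embedding (\<lambda>S. labels t - S) (term_graph (dual t)) (term_graph t)"
  unfolding graph_embedding_def
proof (intro conjI ballI)
  let ?c = "\<lambda>S. labels t - S"
  have dual: "forests t = ?c ` trees (dual t)" "trees t = ?c ` forests (dual t)"
    using forests_trees_dual[of "dual t"] assms by simp_all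
  have "sverts (term_graph (dual t)) \<subseteq> Pow (labels t)"
    using forests_trees_labels[of "dual t"] by (simp add: term_graph_sverts)
  then show "inj_on ?c (sverts (term_graph (dual t)))"
    by (intro inj_onI) blast
  show "?c ` sverts (term_graph (dual t)) \<subseteq> sverts (term_graph t)"
    by (auto simp: term_graph_sverts dual)
  fix f assume "f \<in> sedges (term_graph (dual t))"
  then obtain S T where ST: "f = {S, T}" "S \<in> forests (dual t)" "T \<in> trees (dual t)" "S \<subseteq> T"
    by (rule term_graph_edgeE)
  then have "{?c T, ?c S} \<in> sedges (term_graph t)"
    by (intro term_graph_edgeI) (auto simp: dual)
  moreover have "?c ` f = {?c T, ?c S}" unfolding ST(1) by (simp add: insert_commute)
  ultimately show "?c ` f \<in> sedges (term_graph t)" by (simp only:)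
qed

text \<open>One constituent can be moved freely while the other is a forest. From a pair of forests
  every vertex is reached by first adjusting the side that has to end as a forest and then the other
  side.\<close>

lemma sconnected_term_graph_Parallel:
  assumes "sconnected (term_graph s)" "sconnected (term_graph t)"
  shows "sconnected (term_graph (Parallel s t))"
proof -
  let ?F = "sedges (term_graph (Parallel s t))"
  have right: "linked ?F (S \<union> T) (S \<union> T')"
    if "S \<in> forests s" "T \<in> sverts (term_graph t)" "T' \<in> sverts (term_graph t)" for S T T'
  proof (rule linked_map[where \<phi> = "\<lambda>X. S \<union> X"])
    show "linked (sedges (term_graph t)) T T'"
      using assms(2) that by (simp add: sconnected_def connected_by_def)
    fix X Y assume "{X, Y} \<in> sedges (term_graph t)"
    then obtain X' Y' where XY: "{X, Y} = {X', Y'}" "X' \<in> forests t" "Y' \<in> trees t" "X' \<subseteq> Y'"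
      by (rule term_graph_edgeE)
    then have "{S \<union> X', S \<union> Y'} \<in> ?F"
      using that(1) by (intro term_graph_edgeI) (auto intro!: jointI)
    then have "linked ?F (S \<union> X') (S \<union> Y')" by (rule linked_step)
    then show "linked ?F (S \<union> X) (S \<union> Y)"
      using XY(1) by (auto simp: doubleton_eq_iff intro: linked_sym)
  qed
  have left: "linked ?F (S \<union> T) (S' \<union> T)"
    if "T \<in> forests t" "S \<in> sverts (term_graph s)" "S' \<in> sverts (term_graph s)" for S S' T
  proof (rule linked_map[where \<phi> = "\<lambda>X. X \<union> T"])
    show "linked (sedges (term_graph s)) S S'"
      using assms(1) that by (simp add: sconnected_def connected_by_def)
    fix X Y assume "{X, Y} \<in> sedges (term_graph s)"
    then obtain X' Y' where XY: "{X, Y} = {X', Y'}" "X' \<in> forests s" "Y' \<in> trees s" "X' \<subseteq> Y'"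
      by (rule term_graph_edgeE)
    then have "{X' \<union> T, Y' \<union> T} \<in> ?F"
      using that(1) by (intro term_graph_edgeI) (auto intro!: jointI)
    then have "linked ?F (X' \<union> T) (Y' \<union> T)" by (rule linked_step)
    then show "linked ?F (X \<union> T) (Y \<union> T)"
      using XY(1) by (auto simp: doubleton_eq_iff intro: linked_sym)
  qed
  obtain S0 T0 where S0: "S0 \<in> forests s" and T0: "T0 \<in> forests t"
    using forests_trees_nonempty[of s] forests_trees_nonempty[of t] by blast
  show ?thesis
    unfolding sconnected_def
  proof (rule connected_byI)
    show "S0 \<union> T0 \<in> sverts (term_graph (Parallel s t))"
      using S0 T0 by (simp add: term_graph_sverts jointI)
    fix U assume "U \<in> sverts (term_graph (Parallel s t))"
    then have "U \<in> joint (forests s) (forests t \<union> trees t) \<or> U \<in> joint (trees s) (forests t)"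
      by (auto simp: term_graph_sverts joint_def)
    then show "linked ?F (S0 \<union> T0) U"
    proof
      assume "U \<in> joint (forests s) (forests t \<union> trees t)"
      then obtain S T where U: "U = S \<union> T" "S \<in> forests s" "T \<in> forests t \<union> trees t" by (rule jointE)
      have "linked ?F (S0 \<union> T0) (S \<union> T0)"
        using left[OF T0] S0 U(2) by (simp add: term_graph_sverts)
      moreover have "linked ?F (S \<union> T0) (S \<union> T)"
        using right[OF U(2)] T0 U(3) by (simp add: term_graph_sverts)
      ultimately show ?thesis unfolding U(1) by (rule linked_trans)
    next
      assume "U \<in> joint (trees s) (forests t)"
      then obtain S T where U: "U = S \<union> T" "S \<in> trees s" "T \<in> forests t" by (rule jointE)
      have "linked ?F (S0 \<union> T0) (S0 \<union> T)"
        using right[OF S0] T0 U(3) by (simp add: term_graph_sverts)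
      moreover have "linked ?F (S0 \<union> T) (S \<union> T)"
        using left[OF U(3)] S0 U(2) by (simp add: term_graph_sverts)
      ultimately show ?thesis unfolding U(1) by (rule linked_trans)
    qed
  qed
qed

text \<open>Intersecting with the two label sets splits a union into its constituents. Along an edge
  both constituents are nested; the one that stays a forest keeps its size and hence does not
  change, exactly as in a product-join along the forest parts.\<close>

lemma term_graph_Parallel_embedding:
  assumes "read_once (Parallel s t)"
  shows "graph_embedding (\<lambda>U. (U \<inter> labels s, U \<inter> labels t)) (term_graph (Parallel s t))
    (product_join (term_graph s) (forests s) (trees s) (term_graph t) (forests t) (trees t))"
    (is "graph_embedding ?\<phi> _ ?J")
  unfolding graph_embedding_def
proof (intro conjI ballI)
  have ro: "read_once s" "read_once t" and dis: "labels s \<inter> labels t = {}" using assms by simp_all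
  have \<phi>: "?\<phi> (S \<union> T) = (S, T)" if "S \<in> forests s \<union> trees s" "T \<in> forests t \<union> trees t" for S T
  proof -
    have "S \<subseteq> labels s" "T \<subseteq> labels t"
      using that forests_trees_labels[of s] forests_trees_labels[of t] by blast+
    then have "(S \<union> T) \<inter> labels s = S" "(S \<union> T) \<inter> labels t = T" using dis by blast+
    then show ?thesis by simp
  qed
  have verts: "\<exists>S T. U = S \<union> T \<and> (S, T) \<in> sverts ?J"
    if "U \<in> sverts (term_graph (Parallel s t))" for U
    using that by (auto simp: term_graph_sverts product_join_def joint_def)
  have J: "S \<in> forests s \<union> trees s \<and> T \<in> forests t \<union> trees t" if "(S, T) \<in> sverts ?J" for S T
    using that by (auto simp: product_join_def)
  show "inj_on ?\<phi> (sverts (term_graph (Parallel s t)))"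
  proof (rule inj_onI)
    fix U U' assume U: "U \<in> sverts (term_graph (Parallel s t))"
      "U' \<in> sverts (term_graph (Parallel s t))" "?\<phi> U = ?\<phi> U'"
    obtain S T where ST: "U = S \<union> T" "(S, T) \<in> sverts ?J" using verts[OF U(1)] by blast
    obtain S' T' where ST': "U' = S' \<union> T'" "(S', T') \<in> sverts ?J" using verts[OF U(2)] by blast
    have "(S, T) = (S', T')" using U(3) \<phi> J[OF ST(2)] J[OF ST'(2)] ST(1) ST'(1) by metis
    then show "U = U'" using ST(1) ST'(1) by simp
  qed
  show "?\<phi> ` sverts (term_graph (Parallel s t)) \<subseteq> sverts ?J"
  proof (rule image_subsetI)
    fix U assume "U \<in> sverts (term_graph (Parallel s t))"
    then obtain S T where ST: "U = S \<union> T" "(S, T) \<in> sverts ?J" using verts by blast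
    have "?\<phi> U = (S, T)" unfolding ST(1) using J[OF ST(2)] by (intro \<phi>) simp_all
    then show "?\<phi> U \<in> sverts ?J" using ST(2) by (simp only:)
  qed
  fix f assume "f \<in> sedges (term_graph (Parallel s t))"
  then obtain U U' where f: "f = {U, U'}" "U \<in> forests (Parallel s t)" "U' \<in> trees (Parallel s t)"
    "U \<subseteq> U'" by (rule term_graph_edgeE)
  obtain S T where ST: "U = S \<union> T" "S \<in> forests s" "T \<in> forests t"
    using f(2) by (auto elim: jointE)
  have \<phi>U: "?\<phi> U = (S, T)" unfolding ST(1) using ST(2,3) by (intro \<phi>) simp_all
  have img: "?\<phi> ` f = {?\<phi> U, ?\<phi> U'}" unfolding f(1) by simp
  have eq: "S = S'" if "S' \<in> forests r" "S \<in> forests r" "S \<subseteq> S'" "read_once r" for S S' and r :: "'a sp"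
  proof (rule card_subset_eq)
    show "finite S'" using forests_labels[OF that(1)] by (rule finite_subset) simp
    show "card S = card S'" using card_forests_trees[OF that(4)] that(1,2) by simp
  qed fact
  from f(3) have "U' \<in> joint (forests s) (trees t) \<or> U' \<in> joint (trees s) (forests t)" by simp
  then show "?\<phi> ` f \<in> sedges ?J"
  proof
    assume "U' \<in> joint (forests s) (trees t)"
    then obtain S' T' where ST': "U' = S' \<union> T'" "S' \<in> forests s" "T' \<in> trees t" by (rule jointE)
    have \<phi>U': "?\<phi> U' = (S', T')" unfolding ST'(1) using ST'(2,3) by (intro \<phi>) simp_all
    have sub: "S \<subseteq> S'" "T \<subseteq> T'" using \<phi>U \<phi>U' f(4) by auto
    have "S = S'" using eq[OF ST'(2) ST(2) sub(1) ro(1)] .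
    moreover have "{T, T'} \<in> sedges (term_graph t)" using ST(3) ST'(3) sub(2) by (rule term_graph_edgeI)
    ultimately show ?thesis
      unfolding img \<phi>U \<phi>U' using ST(2,3) ST'(3) product_join_edgesI(1) by metis
  next
    assume "U' \<in> joint (trees s) (forests t)"
    then obtain S' T' where ST': "U' = S' \<union> T'" "S' \<in> trees s" "T' \<in> forests t" by (rule jointE)
    have \<phi>U': "?\<phi> U' = (S', T')" unfolding ST'(1) using ST'(2,3) by (intro \<phi>) simp_all
    have sub: "S \<subseteq> S'" "T \<subseteq> T'" using \<phi>U \<phi>U' f(4) by auto
    have "T = T'" using eq[OF ST'(3) ST(3) sub(2) ro(2)] .
    moreover have "{S, S'} \<in> sedges (term_graph s)" using ST(2) ST'(2) sub(1) by (rule term_graph_edgeI)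
    ultimately show ?thesis
      unfolding img \<phi>U \<phi>U' using ST(2,3) ST'(2) product_join_edgesI(2) by metis
  qed
qed

text \<open>The dual of a series composition is a parallel composition of duals, whose parts are no
  subterms but have smaller size; hence the induction on \<open>size t\<close>.\<close>

lemma term_graph_reducible:
  fixes t :: "'e sp"
  shows "read_once t \<Longrightarrow> sconnected (term_graph t) \<and> product_join_reducible (term_graph t)"
proof (induction "size t" arbitrary: t rule: less_induct)
  case less
  have Par: "sconnected (term_graph (Parallel r s)) \<and> product_join_reducible (term_graph (Parallel r s))"
    if rs: "size r < size t" "size s < size t" "read_once (Parallel r s)"
    for r s :: "'e sp"
  proof -
    have r: "sconnected (term_graph r)" "product_join_reducible (term_graph r)" "read_once r"
      and s: "sconnected (term_graph s)" "product_join_reducible (term_graph s)" "read_once s"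
      using less.hyps rs by simp_all
    have con: "sconnected (term_graph (Parallel r s))" using r(1) s(1)
      by (rule sconnected_term_graph_Parallel)
    have fin: "finite (sverts (term_graph x))" for x :: "'e sp"
      by (simp add: term_graph_sverts finite_forests_trees)
    show ?thesis
      using con product_join_reducible_product_join[OF r(2,1) bipartition_term_graph[OF r(3)] fin
          s(2,1) bipartition_term_graph[OF s(3)] fin term_graph_Parallel_embedding[OF rs(3)]
          simple_term_graph[OF rs(3)] con] by blast
  qed
  show ?case
  proof (cases t)
    case (Leaf f)
    let ?V = "{0, 1 :: nat}"
    have verts: "sverts (term_graph t) = {{}, {f}}" by (auto simp: term_graph_sverts Leaf)
    have edge: "h = {{}, {f}}" if h: "h \<in> sedges (term_graph t)" for h
    proof -
      obtain S T where ST: "h = {S, T}" "S \<in> forests t" "T \<in> trees t"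
        using h by (rule term_graph_edgeE)
      then have "S = {}" "T = {f}" by (simp_all add: Leaf)
      then show ?thesis using ST(1) by (simp only:)
    qed
    have "{{}, {f}} \<in> sedges (term_graph t)" unfolding Leaf by (rule term_graph_edgeI) simp_all
    then have "linked (sedges (term_graph t)) {} {f}" by (rule linked_step)
    then have con: "sconnected (term_graph t)"
      unfolding sconnected_def verts by (intro connected_byI[of "{}"]) auto
    have "graph_embedding (\<lambda>S. if S = {} then 0 else 1) (term_graph t) (complete_graph ?V)"
      (is "graph_embedding ?\<phi> _ _")
      unfolding graph_embedding_def verts
    proof (intro conjI ballI)
      fix h assume "h \<in> sedges (term_graph t)"
      then have "h = {{}, {f}}" by (rule edge)
      then have "?\<phi> ` h = {?\<phi> {}, ?\<phi> {f}}" by (simp only: image_insert image_empty)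
      then have "?\<phi> ` h = {0, 1}" by (simp only: if_True if_False simp_thms insert_not_empty)
      moreover have "{0, 1} \<in> sedges (complete_graph ?V)" by (auto simp: complete_graph_def)
      ultimately show "?\<phi> ` h \<in> sedges (complete_graph ?V)" by (simp only:)
    qed (simp_all add: inj_on_def complete_graph_def)
    then have "product_join_reducible (term_graph t)"
      using pj_reducible_embedding[OF pj_reducible.K2[of 0 1]] simple_term_graph[OF less.prems] con
      by simp
    with con show ?thesis by blast
  next
    case (Parallel r s)
    then show ?thesis using Par[of r s] less.prems by simp
  next
    case (Series r s)
    then have "read_once (dual t)" "dual t = Parallel (dual r) (dual s)" using less.prems by simp_all
    then have d: "sconnected (term_graph (dual t))" "product_join_reducible (term_graph (dual t))"
      using Par[of "dual r" "dual s"] Series by simp_all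
    have con: "sconnected (term_graph t)"
      using sconnected_term_graph_dual[of "dual t"] d(1) less.prems by simp
    moreover have "product_join_reducible (term_graph t)"
      using product_join_reducible_embedding[OF d(2) _ simple_term_graph[OF less.prems] con]
        term_graph_dual_embedding[of "dual t"] less.prems by simp
    ultimately show ?thesis by blast
  qed
qed

section \<open>Embedding product-join-reducible graphs into terms\<close>

text \<open>It is recorded which part goes to the forests, because a product-join treats the two
  parts of a factor differently.\<close>

definition term_embedding :: "('v \<Rightarrow> 'e set) \<Rightarrow> 'v sgraph \<Rightarrow> 'v set \<Rightarrow> 'v set \<Rightarrow> 'e sp \<Rightarrow> bool" where
  "term_embedding \<phi> H A B t \<longleftrightarrow> inj_on \<phi> (A \<union> B) \<and>
     (\<forall>a\<in>A. \<phi> a \<in> forests t) \<and> (\<forall>b\<in>B. \<phi> b \<in> trees t) \<and>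
     (\<forall>a\<in>A. \<forall>b\<in>B. {a, b} \<in> sedges H \<longrightarrow> \<phi> a \<subseteq> \<phi> b)"

definition embeds_in :: "'v sgraph \<Rightarrow> 'v set \<Rightarrow> 'v set \<Rightarrow> 'e sp \<Rightarrow> bool" where
  "embeds_in H A B t \<longleftrightarrow> (\<exists>\<phi>. term_embedding \<phi> H A B t)"

lemma term_embeddingD:
  assumes "term_embedding \<phi> H A B t"
  shows "inj_on \<phi> (A \<union> B)" "a \<in> A \<Longrightarrow> \<phi> a \<in> forests t" "b \<in> B \<Longrightarrow> \<phi> b \<in> trees t"
    "a \<in> A \<Longrightarrow> b \<in> B \<Longrightarrow> {a, b} \<in> sedges H \<Longrightarrow> \<phi> a \<subseteq> \<phi> b"
  using assms unfolding term_embedding_def by simp_all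

lemma embeds_inI:
  assumes "inj_on \<phi> (A \<union> B)" "\<And>a. a \<in> A \<Longrightarrow> \<phi> a \<in> forests t" "\<And>b. b \<in> B \<Longrightarrow> \<phi> b \<in> trees t"
    and "\<And>a b. a \<in> A \<Longrightarrow> b \<in> B \<Longrightarrow> {a, b} \<in> sedges H \<Longrightarrow> \<phi> a \<subseteq> \<phi> b"
  shows "embeds_in H A B t"
proof -
  have "term_embedding \<phi> H A B t"
    unfolding term_embedding_def by (intro conjI ballI impI assms)
  then show ?thesis unfolding embeds_in_def by blast
qed

lemma embeds_in_mono:
  assumes "embeds_in H A B t" "A' \<subseteq> A" "B' \<subseteq> B" "sedges H' \<subseteq> sedges H"
  shows "embeds_in H' A' B' t"
proof -
  obtain \<phi> where "term_embedding \<phi> H A B t"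
    using assms(1) unfolding embeds_in_def by blast
  note \<phi> = term_embeddingD[OF this]
  have "inj_on \<phi> (A' \<union> B')" using \<phi>(1) by (rule inj_on_subset) (use assms in blast)
  then show ?thesis by (rule embeds_inI) (use \<phi>(2-4) assms(2-4) in blast)+
qed

text \<open>Complements in \<open>labels t\<close> reverse all inclusions, so the part that was sent
  to trees now goes to forests.\<close>

lemma embeds_in_dual:
  assumes "embeds_in H A B t" "read_once t"
  shows "embeds_in H B A (dual t)"
proof -
  obtain \<phi> where "term_embedding \<phi> H A B t"
    using assms(1) unfolding embeds_in_def by blast
  note \<phi> = term_embeddingD[OF this]
  have sub: "\<phi> x \<subseteq> labels t" if "x \<in> A \<union> B" for x
    using that \<phi>(2,3) forests_labels trees_labels by blast
  show ?thesis
  proof (rule embeds_inI[of "\<lambda>x. labels t - \<phi> x"])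
    show "inj_on (\<lambda>x. labels t - \<phi> x) (B \<union> A)"
    proof (rule inj_onI)
      fix x y assume xy: "x \<in> B \<union> A" "y \<in> B \<union> A" "labels t - \<phi> x = labels t - \<phi> y"
      have "\<phi> x = labels t - (labels t - \<phi> x)" "\<phi> y = labels t - (labels t - \<phi> y)"
        using sub[of x] sub[of y] xy(1,2) by blast+
      then have "\<phi> x = \<phi> y" using xy(3) by metis
      then show "x = y" using \<phi>(1) xy(1,2) by (auto dest: inj_onD)
    qed
    show "labels t - \<phi> a \<in> forests (dual t)" if "a \<in> B" for a
      using \<phi>(3)[OF that] forests_trees_dual[OF assms(2)] by blast
    show "labels t - \<phi> b \<in> trees (dual t)" if "b \<in> A" for b
      using \<phi>(2)[OF that] forests_trees_dual[OF assms(2)] by blast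
    fix b a assume ba: "b \<in> B" "a \<in> A" "{b, a} \<in> sedges H"
    then have "{a, b} \<in> sedges H" by (simp only: insert_commute)
    then have "\<phi> a \<subseteq> \<phi> b" using \<phi>(4) ba by blast
    then show "labels t - \<phi> b \<subseteq> labels t - \<phi> a" by blast
  qed
qed

lemma embeds_in_map:
  assumes "embeds_in H A B t" "inj h"
  shows "embeds_in H A B (map_sp h t)"
proof -
  obtain \<phi> where "term_embedding \<phi> H A B t"
    using assms(1) unfolding embeds_in_def by blast
  note \<phi> = term_embeddingD[OF this]
  show ?thesis
  proof (rule embeds_inI[of "\<lambda>x. h ` \<phi> x"])
    show "inj_on (\<lambda>x. h ` \<phi> x) (A \<union> B)"
      using \<phi>(1) inj_image_eq_iff[OF assms(2)] by (simp add: inj_on_def)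
    show "h ` \<phi> a \<in> forests (map_sp h t)" if "a \<in> A" for a
      using \<phi>(2)[OF that] forests_trees_map[of h t] by simp
    show "h ` \<phi> b \<in> trees (map_sp h t)" if "b \<in> B" for b
      using \<phi>(3)[OF that] forests_trees_map[of h t] by simp
    show "h ` \<phi> a \<subseteq> h ` \<phi> b" if "a \<in> A" "b \<in> B" "{a, b} \<in> sedges H" for a b
      using \<phi>(4)[OF that] by (rule image_mono)
  qed
qed

text \<open>A pair is sent to the union of the images of its coordinates; disjointness of the label
  sets allows both coordinates to be recovered.\<close>

lemma embeds_in_product_join:
  assumes 1: "embeds_in H1 A1 B1 s" and 2: "embeds_in H2 A2 B2 t"
    and bip: "A1 \<inter> B1 = {}" "A2 \<inter> B2 = {}" and dis: "labels s \<inter> labels t = {}"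
  shows "embeds_in (product_join H1 A1 B1 H2 A2 B2)
    (A1 \<times> A2) (A1 \<times> B2 \<union> B1 \<times> A2) (Parallel s t)"
proof -
  let ?J = "product_join H1 A1 B1 H2 A2 B2"
  obtain \<phi> where "term_embedding \<phi> H1 A1 B1 s"
    using 1 unfolding embeds_in_def by blast
  note \<phi> = term_embeddingD[OF this]
  obtain \<psi> where "term_embedding \<psi> H2 A2 B2 t"
    using 2 unfolding embeds_in_def by blast
  note \<psi> = term_embeddingD[OF this]
  have sub: "\<phi> x \<subseteq> labels s" "\<psi> y \<subseteq> labels t" if "x \<in> A1 \<union> B1" "y \<in> A2 \<union> B2" for x y
    using that \<phi>(2,3) \<psi>(2,3) forests_labels trees_labels by blast+
  define \<chi> where "\<chi> z = \<phi> (fst z) \<union> \<psi> (snd z)" for z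
  have parts: "\<chi> (x, y) \<inter> labels s = \<phi> x" "\<chi> (x, y) \<inter> labels t = \<psi> y"
    if "x \<in> A1 \<union> B1" "y \<in> A2 \<union> B2" for x y
    using sub[OF that] dis by (auto simp: \<chi>_def)
  show ?thesis
  proof (rule embeds_inI[of \<chi>])
    have "inj_on \<chi> ((A1 \<union> B1) \<times> (A2 \<union> B2))"
    proof (rule inj_onI)
      fix z z' assume z: "z \<in> (A1 \<union> B1) \<times> (A2 \<union> B2)" "z' \<in> (A1 \<union> B1) \<times> (A2 \<union> B2)" "\<chi> z = \<chi> z'"
      obtain x y x' y' where xy: "z = (x, y)" "z' = (x', y')" by (metis surj_pair)
      then have in_sets: "x \<in> A1 \<union> B1" "y \<in> A2 \<union> B2" "x' \<in> A1 \<union> B1" "y' \<in> A2 \<union> B2"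
        using z(1,2) by simp_all
      have "\<phi> x = \<phi> x'" "\<psi> y = \<psi> y'"
        using parts[OF in_sets(1,2)] parts[OF in_sets(3,4)] z(3) xy by simp_all
      then have "x = x'" "y = y'"
        using inj_onD[OF \<phi>(1)] inj_onD[OF \<psi>(1)] in_sets by blast+
      then show "z = z'" using xy by simp
    qed
    then show "inj_on \<chi> (A1 \<times> A2 \<union> (A1 \<times> B2 \<union> B1 \<times> A2))" by (rule inj_on_subset) blast
    show "\<chi> z \<in> forests (Parallel s t)" if "z \<in> A1 \<times> A2" for z
      using that \<phi>(2) \<psi>(2) by (auto simp: \<chi>_def intro!: jointI)
    show "\<chi> z \<in> trees (Parallel s t)" if "z \<in> A1 \<times> B2 \<union> B1 \<times> A2" for z
    proof -
      have "\<phi> (fst z) \<in> forests s \<and> \<psi> (snd z) \<in> trees t \<or> \<phi> (fst z) \<in> trees s \<and> \<psi> (snd z) \<in> forests t"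
        using that \<phi>(2,3) \<psi>(2,3) by auto
      then show ?thesis unfolding \<chi>_def trees.simps using jointI by blast
    qed
    fix p q assume p: "p \<in> A1 \<times> A2" and q: "q \<in> A1 \<times> B2 \<union> B1 \<times> A2" and pq: "{p, q} \<in> sedges ?J"
    have "p \<noteq> q" using p q bip by auto
    \<comment> \<open>An edge is an unordered pair. That \<open>q\<close> is not in the first part
      fixes which end is which.\<close>
    have "q \<notin> A1 \<times> A2" using q bip by auto
    from pq show "\<chi> p \<subseteq> \<chi> q"
    proof (cases rule: product_join_edgesE)
      case (1 a1 a2 b2)
      then have "p = (a1, a2)" "q = (a1, b2)"
        using \<open>q \<notin> A1 \<times> A2\<close> by (auto simp: doubleton_eq_iff)
      then show ?thesis using \<psi>(4)[OF 1(3,4,5)] by (auto simp: \<chi>_def)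
    next
      case (2 a1 a2 b1)
      then have "p = (a1, a2)" "q = (b1, a2)"
        using \<open>q \<notin> A1 \<times> A2\<close> by (auto simp: doubleton_eq_iff)
      then show ?thesis using \<phi>(4)[OF 2(2,4,5)] by (auto simp: \<chi>_def)
    qed
  qed
qed

lemma bipartition_product_join:
  assumes "A1 \<inter> B1 = {}" "A2 \<inter> B2 = {}"
  shows "bipartition (product_join H1 A1 B1 H2 A2 B2) (A1 \<times> A2) (A1 \<times> B2 \<union> B1 \<times> A2)"
  unfolding bipartition_def
proof (intro conjI ballI)
  show "A1 \<times> A2 \<inter> (A1 \<times> B2 \<union> B1 \<times> A2) = {}" using assms by blast
  fix f assume "f \<in> sedges (product_join H1 A1 B1 H2 A2 B2)"
  then show "\<exists>a\<in>A1 \<times> A2. \<exists>b\<in>A1 \<times> B2 \<union> B1 \<times> A2. f = {a, b}"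
    by (cases rule: product_join_edgesE) blast+
qed (simp add: product_join_def)

lemma embeds_in_map_graph:
  assumes "embeds_in H A B t" "bipartition H A B" "inj_on \<rho> (sverts H)"
  shows "embeds_in (map_graph \<rho> H) (\<rho> ` A) (\<rho> ` B) t"
proof -
  obtain \<phi> where "term_embedding \<phi> H A B t"
    using assms(1) unfolding embeds_in_def by blast
  note \<phi> = term_embeddingD[OF this]
  have V: "A \<union> B = sverts H" "A \<inter> B = {}" using assms(2) by (simp_all add: bipartition_def)
  let ?\<psi> = "inv_into (A \<union> B) \<rho>"
  have inj: "inj_on \<rho> (A \<union> B)" using assms(3) V by simp
  have inv: "?\<psi> (\<rho> x) = x" if "x \<in> A \<union> B" for x using inj that by (rule inv_into_f_f)
  show ?thesis
  proof (rule embeds_inI[of "\<lambda>y. \<phi> (?\<psi> y)"])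
    show "inj_on (\<lambda>y. \<phi> (?\<psi> y)) (\<rho> ` A \<union> \<rho> ` B)"
      unfolding image_Un[symmetric]
    proof (rule inj_onI)
      fix y y' assume y: "y \<in> \<rho> ` (A \<union> B)" "y' \<in> \<rho> ` (A \<union> B)" "\<phi> (?\<psi> y) = \<phi> (?\<psi> y')"
      obtain x x' where x: "x \<in> A \<union> B" "y = \<rho> x" "x' \<in> A \<union> B" "y' = \<rho> x'" using y(1,2) by blast
      have "\<phi> x = \<phi> x'" using y(3) inv[OF x(1)] inv[OF x(3)] x(2,4) by simp
      then show "y = y'" using inj_onD[OF \<phi>(1) _ x(1,3)] x(2,4) by simp
    qed
    show "\<phi> (?\<psi> y) \<in> forests t" if "y \<in> \<rho> ` A" for y using that \<phi>(2) inv by auto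
    show "\<phi> (?\<psi> y) \<in> trees t" if "y \<in> \<rho> ` B" for y using that \<phi>(3) inv by auto
    fix y z assume yz: "y \<in> \<rho> ` A" "z \<in> \<rho> ` B" "{y, z} \<in> sedges (map_graph \<rho> H)"
    obtain a b where ab: "a \<in> A" "y = \<rho> a" "b \<in> B" "z = \<rho> b" using yz(1,2) by blast
    obtain f where f: "f \<in> sedges H" "{y, z} = \<rho> ` f" using yz(3) by (auto simp: map_graph_def)
    have "\<exists>a\<in>A. \<exists>b\<in>B. f = {a, b}" using assms(2) f(1) by (simp add: bipartition_def)
    then have "f \<subseteq> A \<union> B" by blast
    moreover have "\<rho> ` f = \<rho> ` {a, b}" using f(2) ab by simp
    ultimately have "f = {a, b}" using inj_on_image_eq_iff[OF inj, of f "{a, b}"] ab(1,3) by blast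
    then have "\<phi> a \<subseteq> \<phi> b" using \<phi>(4) ab(1,3) f(1) by blast
    then show "\<phi> (?\<psi> y) \<subseteq> \<phi> (?\<psi> z)" using inv ab by simp
  qed
qed

text \<open>Crossing an edge switches sides in both bipartitions, so whether they agree at a vertex
  is constant along walks.\<close>

lemma bipartition_unique:
  assumes con: "sconnected H" and AB: "bipartition H A B" "bipartition H A' B'"
  shows "A' = A \<and> B' = B \<or> A' = B \<and> B' = A"
proof -
  have V: "A \<union> B = sverts H" "A \<inter> B = {}" "A' \<union> B' = sverts H" "A' \<inter> B' = {}"
    using AB by (simp_all add: bipartition_def)
  have edge: "x \<in> A \<longleftrightarrow> y \<in> B" "x \<in> A' \<longleftrightarrow> y \<in> B'" "y \<in> A \<longleftrightarrow> x \<in> B" "y \<in> A' \<longleftrightarrow> x \<in> B'"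
    if xy: "{x, y} \<in> sedges H" for x y
  proof -
    have "\<exists>a\<in>A. \<exists>b\<in>B. {x, y} = {a, b}" "\<exists>a\<in>A'. \<exists>b\<in>B'. {x, y} = {a, b}"
      using AB xy by (simp_all add: bipartition_def)
    then have "x \<in> A \<and> y \<in> B \<or> y \<in> A \<and> x \<in> B" "x \<in> A' \<and> y \<in> B' \<or> y \<in> A' \<and> x \<in> B'"
      by (auto simp: doubleton_eq_iff)
    then show "x \<in> A \<longleftrightarrow> y \<in> B" "x \<in> A' \<longleftrightarrow> y \<in> B'" "y \<in> A \<longleftrightarrow> x \<in> B" "y \<in> A' \<longleftrightarrow> x \<in> B'"
      using V(2,4) by blast+
  qed
  obtain r where r: "r \<in> sverts H" using con by (auto simp: sconnected_def connected_by_def)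
  have same: "(x \<in> A \<longleftrightarrow> x \<in> A') \<longleftrightarrow> (r \<in> A \<longleftrightarrow> r \<in> A')" if "x \<in> sverts H" for x
  proof -
    have "linked (sedges H) r x" using con r that by (simp add: sconnected_def connected_by_def)
    then have "x \<in> sverts H \<and> ((x \<in> A \<longleftrightarrow> x \<in> A') \<longleftrightarrow> (r \<in> A \<longleftrightarrow> r \<in> A'))"
    proof (induction rule: linked_induct)
      case (step x y)
      then have "y \<in> sverts H" using edge(1,3)[OF step(2)] V(1) by blast
      then show ?case using step(3) edge[OF step(2)] V by blast
    qed (use r in simp)
    then show ?thesis by blast
  qed
  show ?thesis
  proof (cases "r \<in> A \<longleftrightarrow> r \<in> A'")
    case True
    then have "\<forall>x\<in>sverts H. x \<in> A \<longleftrightarrow> x \<in> A'" using same by blast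
    then have "A' = A \<and> B' = B" using V by blast
    then show ?thesis by blast
  next
    case False
    then have "\<forall>x\<in>sverts H. x \<in> A \<longleftrightarrow> x \<notin> A'" using same by blast
    then have "A' = B \<and> B' = A" using V by blast
    then show ?thesis by blast
  qed
qed

text \<open>A product-join may use either part of a factor. If the given embedding sends the wrong
  one to the forests, the dual term corrects it.\<close>

lemma embeds_in_any_bipartition:
  fixes t :: "'e sp"
  assumes "sconnected H" "bipartition H A B" "bipartition H A' B'" "embeds_in H A' B' t" "read_once t"
  shows "\<exists>t' :: 'e sp. read_once t' \<and> embeds_in H A B t'"
  using bipartition_unique[OF assms(1-3)]
proof
  assume "A' = A \<and> B' = B"
  then show ?thesis using assms(4,5) by blast
next
  assume "A' = B \<and> B' = A"
  then have "embeds_in H A B (dual t)" using embeds_in_dual[OF assms(4,5)] by simp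
  then show ?thesis using assms(5) by (intro exI[of _ "dual t"]) simp
qed

lemma pj_reducible_embeds_in:
  "pj_reducible H \<Longrightarrow>
    \<exists>A B (t :: nat sp). bipartition H A B \<and> read_once t \<and> embeds_in H A B t"
proof (induction rule: pj_reducible.induct)
  case (K2 a b)
  let ?H = "complete_graph {a, b}"
  have edge: "f = {a, b}" if "f \<in> sedges ?H" for f
    using that by (auto simp: complete_graph_def)
  have "bipartition ?H {a} {b}"
    unfolding bipartition_def using K2 edge by (auto simp: complete_graph_def)
  moreover have "embeds_in ?H {a} {b} (Leaf (0::nat))"
    by (rule embeds_inI[of "\<lambda>x. if x = a then {} else {0}"]) (use K2 in \<open>auto simp: inj_on_def\<close>)
  ultimately show ?case by (intro exI[of _ "{a}"] exI[of _ "{b}"] exI[of _ "Leaf 0"]) simp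
next
  case (sub H K)
  then obtain A B and t :: "nat sp" where t: "bipartition H A B" "read_once t" "embeds_in H A B t"
    by blast
  have K: "simple_graph K" "sverts K \<subseteq> sverts H" "sedges K \<subseteq> sedges H"
    using sub(2) by (simp_all add: sub_graph_def)
  have V: "A \<union> B = sverts H" "A \<inter> B = {}" using t(1) by (simp_all add: bipartition_def)
  have "bipartition K (A \<inter> sverts K) (B \<inter> sverts K)"
    unfolding bipartition_def
  proof (intro conjI ballI)
    fix f assume f: "f \<in> sedges K"
    then have "\<exists>a\<in>A. \<exists>b\<in>B. f = {a, b}" using t(1) K(3) unfolding bipartition_def by blast
    moreover have "f \<subseteq> sverts K" using K(1) f by (simp add: simple_graph_def)
    ultimately show "\<exists>a\<in>A \<inter> sverts K. \<exists>b\<in>B \<inter> sverts K. f = {a, b}" by blast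
  qed (use V K(2) in blast)+
  moreover have "embeds_in K (A \<inter> sverts K) (B \<inter> sverts K) t"
    by (rule embeds_in_mono[OF t(3) _ _ K(3)]) blast+
  ultimately show ?case using t(2) by blast
next
  case (join H1 A1 B1 H2 A2 B2 H)
  let ?J = "product_join H1 A1 B1 H2 A2 B2"
  obtain s :: "nat sp" where s: "read_once s" "embeds_in H1 A1 B1 s"
    using join.IH(1) embeds_in_any_bipartition[OF join.hyps(2,3)] by blast
  obtain t :: "nat sp" where t: "read_once t" "embeds_in H2 A2 B2 t"
    using join.IH(2) embeds_in_any_bipartition[OF join.hyps(5,6)] by blast
  \<comment> \<open>Even and odd numbers keep the labels of the two factors apart.\<close>
  let ?f = "\<lambda>n::nat. 2 * n" and ?g = "\<lambda>n::nat. Suc (2 * n)"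
  have inj: "inj ?f" "inj ?g" by (simp_all add: inj_on_def)
  have bip: "A1 \<inter> B1 = {}" "A2 \<inter> B2 = {}" using join.hyps(3,6) by (simp_all add: bipartition_def)
  let ?t = "Parallel (map_sp ?f s) (map_sp ?g t)"
  have dis: "labels (map_sp ?f s) \<inter> labels (map_sp ?g t) = {}"
  proof -
    have "2 * m \<noteq> Suc (2 * n)" for m n :: nat by presburger
    then show ?thesis unfolding sp.set_map by blast
  qed
  have "read_once (map_sp ?f s)" "read_once (map_sp ?g t)"
    using s(1) t(1) read_once_map[OF inj_on_subset[OF inj(1) subset_UNIV]]
      read_once_map[OF inj_on_subset[OF inj(2) subset_UNIV]] by blast+
  then have "read_once ?t" using dis by simp
  moreover have J: "embeds_in ?J (A1 \<times> A2) (A1 \<times> B2 \<union> B1 \<times> A2) ?t"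
    by (rule embeds_in_product_join[OF embeds_in_map[OF s(2) inj(1)] embeds_in_map[OF t(2) inj(2)]
          bip dis])
  moreover note bipJ = bipartition_product_join[OF bip, of H1 H2]
  moreover obtain \<rho> where \<rho>: "inj_on \<rho> (sverts ?J)" "H = map_graph \<rho> ?J"
    using join.hyps(7) by (rule graph_isoE)
  ultimately show ?case
    using bipartition_map_graph[OF bipJ \<rho>(1)] embeds_in_map_graph[OF J bipJ \<rho>(1)] by blast
qed

lemma product_join_reducible_embeds_in:
  assumes "product_join_reducible H"
  shows "\<exists>A B (t :: nat sp). bipartition H A B \<and> read_once t \<and> embeds_in H A B t"
proof -
  obtain K where K: "pj_reducible K" "graph_iso K H"
    using assms unfolding product_join_reducible_def by blast
  obtain \<rho> where \<rho>: "inj_on \<rho> (sverts K)" "H = map_graph \<rho> K" using K(2) by (rule graph_isoE)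
  obtain A B and t :: "nat sp" where "bipartition K A B" "read_once t" "embeds_in K A B t"
    using pj_reducible_embeds_in[OF K(1)] by blast
  then show ?thesis
    unfolding \<rho>(2) using bipartition_map_graph[OF _ \<rho>(1)] embeds_in_map_graph[OF _ _ \<rho>(1)] by blast
qed

lemma embeds_in_product_join_reducible:
  assumes H: "simple_graph H" "sconnected H" "bipartition H A B"
    and t: "read_once t" "embeds_in H A B t"
  shows "product_join_reducible H"
proof -
  obtain \<phi> where "term_embedding \<phi> H A B t"
    using t(2) unfolding embeds_in_def by blast
  note \<phi> = term_embeddingD[OF this]
  have V: "A \<union> B = sverts H" using H(3) by (simp add: bipartition_def)
  have "graph_embedding \<phi> H (term_graph t)"
    unfolding graph_embedding_def
  proof (intro conjI ballI)
    show "inj_on \<phi> (sverts H)" using \<phi>(1) V by simp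
    show "\<phi> ` sverts H \<subseteq> sverts (term_graph t)"
      unfolding V[symmetric] term_graph_sverts using \<phi>(2,3) by blast
    fix f assume f: "f \<in> sedges H"
    then have "\<exists>a\<in>A. \<exists>b\<in>B. f = {a, b}" using H(3) by (simp add: bipartition_def)
    then obtain a b where ab: "a \<in> A" "b \<in> B" "f = {a, b}" by blast
    then have "{\<phi> a, \<phi> b} \<in> sedges (term_graph t)" using \<phi>(2-4) f by (intro term_graph_edgeI) blast+
    then show "\<phi> ` f \<in> sedges (term_graph t)" unfolding ab(3) by simp
  qed
  then show ?thesis
    using product_join_reducible_embedding H(1,2) term_graph_reducible[OF t(1)] by blast
qed

section \<open>Terms and tree graphs\<close>

lemma subset_sym_diff_1:
  assumes "finite S" "S \<subseteq> T" "card T = Suc (card S)"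
  shows "card (sym_diff S T) = 1"
proof -
  have eq: "sym_diff S T = T - S" using assms(2) by blast
  have "card (T - S) = card T - card S" using assms(1,2) by (rule card_Diff_subset)
  then show ?thesis unfolding eq using assms(3) by linarith
qed

lemma sym_diff_1_subset:
  assumes "card (sym_diff S T) = 1"
  shows "S \<subseteq> T \<or> T \<subseteq> S" "S \<noteq> T"
proof -
  obtain z where z: "sym_diff S T = {z}" using assms by (auto simp: card_1_singleton_iff)
  have "u = z" if "u \<in> sym_diff S T" for u using that unfolding z by simp
  then show "S \<subseteq> T \<or> T \<subseteq> S" by blast
  have "z \<in> sym_diff S T" unfolding z by simp
  then show "S \<noteq> T" by blast
qed

lemma tree_graph_sverts: "sverts (tree_graph G e) = X_contract G e \<union> X_delete G e"
  by (auto simp: tree_graph_def sinduced_def hypercube_def X_contract_def X_delete_def)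

lemma tree_graph_edge:
  assumes "{S, T} \<in> sedges (tree_graph G e)"
  shows "card (sym_diff S T) = 1"
proof -
  have "{S, T} \<in> sedges (hypercube (medges G - {e}))"
    using assms unfolding tree_graph_def sinduced_def sgraph.select_convs by blast
  then obtain S' T' where ST: "{S, T} = {S', T'}" "card (sym_diff S' T') = 1"
    unfolding hypercube_def sgraph.select_convs by blast
  have comm: "sym_diff T' S' = sym_diff S' T'" by (rule Un_commute)
  from ST(1) have "S = S' \<and> T = T' \<or> S = T' \<and> T = S'" unfolding doubleton_eq_iff .
  then show ?thesis using ST(2) comm by metis
qed

lemma tree_graph_edgeI:
  assumes "S \<in> X_contract G e" "T \<in> X_delete G e" "card (sym_diff S T) = 1"
  shows "{S, T} \<in> sedges (tree_graph G e)"
proof -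
  have "S \<subseteq> medges G - {e}" "T \<subseteq> medges G - {e}"
    using assms(1,2) by (auto simp: X_contract_def X_delete_def)
  then have "{S, T} \<in> sedges (hypercube (medges G - {e}))"
    unfolding hypercube_def sgraph.select_convs using assms(3) by blast
  then show ?thesis using assms(1,2) unfolding tree_graph_def sinduced_def by simp
qed

text \<open>Adjacent vertices are sent to a forest inside a tree; their sizes differ by one, so they
  are adjacent in the cube.\<close>

lemma embeds_in_realized:
  assumes H: "simple_graph H" "bipartition H A B" and t: "read_once t" "embeds_in H A B t"
    and G: "X_contract G e = forests t" "X_delete G e = trees t"
  shows "iso_to_subgraph H (tree_graph G e)"
proof -
  obtain \<phi> where "term_embedding \<phi> H A B t"
    using t(2) unfolding embeds_in_def by blast
  note \<phi> = term_embeddingD[OF this]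
  have V: "A \<union> B = sverts H" using H(2) by (simp add: bipartition_def)
  have "graph_embedding \<phi> H (tree_graph G e)"
    unfolding graph_embedding_def
  proof (intro conjI ballI)
    show "inj_on \<phi> (sverts H)" using \<phi>(1) V by simp
    show "\<phi> ` sverts H \<subseteq> sverts (tree_graph G e)"
      unfolding tree_graph_sverts G V[symmetric] using \<phi>(2,3) by blast
    fix f assume f: "f \<in> sedges H"
    then have "\<exists>a\<in>A. \<exists>b\<in>B. f = {a, b}" using H(2) by (simp add: bipartition_def)
    then obtain a b where ab: "a \<in> A" "b \<in> B" "f = {a, b}" by blast
    have forest: "\<phi> a \<in> forests t" and tree: "\<phi> b \<in> trees t" using \<phi>(2,3) ab by blast+
    have sub: "\<phi> a \<subseteq> \<phi> b" using \<phi>(4)[OF ab(1,2)] f ab(3) by simp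
    have fin: "finite (\<phi> a)" using forests_labels[OF forest] by (rule finite_subset) simp
    have "card (\<phi> b) = Suc (card (\<phi> a))" using card_forests_trees[OF t(1)] forest tree by simp
    with fin sub have "card (sym_diff (\<phi> a) (\<phi> b)) = 1" by (rule subset_sym_diff_1)
    then have "{\<phi> a, \<phi> b} \<in> sedges (tree_graph G e)"
      using forest tree unfolding G[symmetric] by (intro tree_graph_edgeI)
    then show "\<phi> ` f \<in> sedges (tree_graph G e)" unfolding ab(3) by simp
  qed
  then show ?thesis using iso_to_subgraph_embedding[OF H(1)] by blast
qed

text \<open>By connectivity all vertices of \<open>H\<close> agree outside the labels of the term, so this common part
  can be dropped.\<close>

lemma decomposed_embeds_in:
  fixes H :: "'a sgraph" and G :: "('v, 'e) mgraph"
  assumes H: "simple_graph H" "sconnected H" "iso_to_subgraph H (tree_graph G e)"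
    and dec: "decomposed_at G e"
  shows "\<exists>A B (t :: 'e sp). bipartition H A B \<and> read_once t \<and> embeds_in H A B t"
proof -
  obtain t R n where t: "read_once t" and dis: "labels t \<inter> \<Union> R = {}"
    and R: "\<forall>r\<in>R. finite r \<and> card r = n"
    and X: "X_contract G e = joint (forests t) R" "X_delete G e = joint (trees t) R"
    using dec unfolding decomposes_def by blast
  obtain \<phi> where \<phi>: "graph_embedding \<phi> H (tree_graph G e)"
    using H(3) iso_to_subgraph_embedding[OF H(1)] by blast
  let ?L = "labels t"
  define A where "A = {x \<in> sverts H. \<phi> x \<inter> ?L \<in> forests t}"
  define B where "B = {x \<in> sverts H. \<phi> x \<inter> ?L \<in> trees t}"
  have split: "x \<in> A \<union> B \<and> \<phi> x - ?L \<in> R" if x: "x \<in> sverts H" for x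
  proof -
    have "\<phi> x \<in> sverts (tree_graph G e)" using \<phi> x unfolding graph_embedding_def by blast
    then have "\<phi> x \<in> joint (forests t \<union> trees t) R"
      unfolding tree_graph_sverts X joint_def by blast
    then obtain S r where Sr: "\<phi> x = S \<union> r" "S \<in> forests t \<union> trees t" "r \<in> R" by (rule jointE)
    have "S \<subseteq> ?L" using Sr(2) forests_trees_labels[of t] by blast
    moreover have "r \<inter> ?L = {}" using dis Sr(3) by blast
    ultimately have "\<phi> x \<inter> ?L = S" "\<phi> x - ?L = r" unfolding Sr(1) by blast+
    then show ?thesis using Sr(2,3) x unfolding A_def B_def by auto
  qed
  have card: "finite (\<phi> x) \<and> card (\<phi> x) = card (\<phi> x \<inter> ?L) + n" if x: "x \<in> sverts H" for x
  proof -
    have fin: "finite (\<phi> x - ?L)" "card (\<phi> x - ?L) = n" using split[OF x] R by blast+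
    have "finite (\<phi> x \<inter> ?L)" by simp
    then have "finite (\<phi> x \<inter> ?L \<union> (\<phi> x - ?L))"
        "card (\<phi> x \<inter> ?L \<union> (\<phi> x - ?L)) = card (\<phi> x \<inter> ?L) + n"
      using fin by (simp, subst card_Un_disjoint) auto
    moreover have "\<phi> x \<inter> ?L \<union> (\<phi> x - ?L) = \<phi> x" by blast
    ultimately show ?thesis by simp
  qed
  \<comment> \<open>Outside the labels all images have the same size \<open>n\<close>, so total
    sizes differ by one between the two candidate parts. This makes the parts disjoint and puts the
    ends of an edge on different sides.\<close>
  have cardA: "card (\<phi> x) = rank t + n" if "x \<in> A" for x
    using card[of x] card_forests_trees[OF t] that by (simp add: A_def)
  have cardB: "card (\<phi> x) = Suc (rank t + n)" if "x \<in> B" for x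
    using card[of x] card_forests_trees[OF t] that by (simp add: B_def)
  have AV: "A \<union> B = sverts H" "A \<inter> B = {}"
  proof -
    show "A \<union> B = sverts H" using split by (auto simp: A_def B_def)
    have False if "x \<in> A" "x \<in> B" for x using cardA[OF that(1)] cardB[OF that(2)] by simp
    then show "A \<inter> B = {}" by blast
  qed
  have edge: "\<phi> x \<subseteq> \<phi> y \<or> \<phi> y \<subseteq> \<phi> x" "card (\<phi> x) \<noteq> card (\<phi> y)"
    if xy: "{x, y} \<in> sedges H" for x y
  proof -
    have V: "x \<in> sverts H" "y \<in> sverts H" using H(1) xy by (auto simp: simple_graph_def)
    have "\<phi> ` {x, y} \<in> sedges (tree_graph G e)" using \<phi> xy unfolding graph_embedding_def by blast
    then have 1: "card (sym_diff (\<phi> x) (\<phi> y)) = 1" by (intro tree_graph_edge) simp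
    show sub: "\<phi> x \<subseteq> \<phi> y \<or> \<phi> y \<subseteq> \<phi> x" by (rule sym_diff_1_subset(1)[OF 1])
    show "card (\<phi> x) \<noteq> card (\<phi> y)"
      using sub sym_diff_1_subset(2)[OF 1] card[OF V(1)] card[OF V(2)]
      by (metis card_subset_eq)
  qed
  have "bipartition H A B"
    unfolding bipartition_def
  proof (intro conjI ballI AV)
    fix f assume f: "f \<in> sedges H"
    obtain x y where xy: "f = {x, y}" "x \<in> sverts H" "y \<in> sverts H"
      using H(1) f by (rule simple_graph_edge)
    have "card (\<phi> x) \<noteq> card (\<phi> y)" using edge(2) f xy(1) by simp
    then have "\<not> (x \<in> A \<and> y \<in> A)" "\<not> (x \<in> B \<and> y \<in> B)"
      using cardA[of x] cardA[of y] cardB[of x] cardB[of y] by fastforce+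
    moreover have "x \<in> A \<union> B" "y \<in> A \<union> B" using xy(2,3) AV(1) by simp_all
    ultimately have "x \<in> A \<and> y \<in> B \<or> y \<in> A \<and> x \<in> B" by blast
    moreover have "{y, x} = {x, y}" by blast
    ultimately show "\<exists>a\<in>A. \<exists>b\<in>B. f = {a, b}" unfolding xy(1) by metis
  qed
  moreover have "embeds_in H A B t"
  proof (rule embeds_inI[of "\<lambda>x. \<phi> x \<inter> ?L"])
    obtain r where r: "r \<in> sverts H" using H(2) by (auto simp: sconnected_def connected_by_def)
    have const: "\<phi> x - ?L = \<phi> r - ?L" if x: "x \<in> sverts H" for x
    proof -
      have "linked (sedges H) r x" using H(2) r x by (simp add: sconnected_def connected_by_def)
      then show ?thesis
      proof (induction rule: linked_induct)
        case (step x y)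
        have V: "x \<in> sverts H" "y \<in> sverts H" using H(1) step(2) by (auto simp: simple_graph_def)
        have R': "finite (\<phi> x - ?L)" "card (\<phi> x - ?L) = n" "finite (\<phi> y - ?L)" "card (\<phi> y - ?L) = n"
          using split[OF V(1)] split[OF V(2)] R by blast+
        \<comment> \<open>Adjacent images are nested, hence so are their constituents in
          \<open>R\<close>; having equal finite size, these coincide.\<close>
        have "\<phi> x - ?L \<subseteq> \<phi> y - ?L \<or> \<phi> y - ?L \<subseteq> \<phi> x - ?L" using edge(1)[OF step(2)] by blast
        then have "\<phi> x - ?L = \<phi> y - ?L" using R' by (metis card_subset_eq)
        then show ?case using step(3) by simp
      qed simp
    qed
    show "inj_on (\<lambda>x. \<phi> x \<inter> ?L) (A \<union> B)"
      unfolding AV(1)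
    proof (rule inj_onI)
      fix x y assume xy: "x \<in> sverts H" "y \<in> sverts H" "\<phi> x \<inter> ?L = \<phi> y \<inter> ?L"
      have "\<phi> x - ?L = \<phi> y - ?L" using const xy(1,2) by simp
      then have "\<phi> x = \<phi> y" using xy(3) by blast
      moreover have "inj_on \<phi> (sverts H)" using \<phi> by (simp add: graph_embedding_def)
      ultimately show "x = y" using xy(1,2) by (auto dest: inj_onD)
    qed
    show "\<phi> a \<inter> ?L \<in> forests t" if "a \<in> A" for a using that by (simp add: A_def)
    show "\<phi> b \<inter> ?L \<in> trees t" if "b \<in> B" for b using that by (simp add: B_def)
    fix a b assume ab: "a \<in> A" "b \<in> B" "{a, b} \<in> sedges H"
    \<comment> \<open>One of the two nested images contains the other, and the sizes decide the
      direction.\<close>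
    have "\<not> \<phi> b \<subseteq> \<phi> a"
    proof
      assume "\<phi> b \<subseteq> \<phi> a"
      moreover have "finite (\<phi> a)" using card ab(1) by (simp add: A_def)
      ultimately have "card (\<phi> b) \<le> card (\<phi> a)" by (intro card_mono)
      then show False using cardA[OF ab(1)] cardB[OF ab(2)] by simp
    qed
    then show "\<phi> a \<inter> ?L \<subseteq> \<phi> b \<inter> ?L" using edge(1)[OF ab(3)] by blast
  qed
  ultimately show ?thesis using t by (intro exI[of _ A] exI[of _ B] exI[of _ t]) simp
qed

theorem theorem4p3:
  fixes H :: "'a sgraph"
  assumes "simple_graph H" and "sconnected H"
  shows "(product_join_reducible H \<longleftrightarrow>
           (\<exists>(G :: (nat, nat) mgraph) e. (G, e) \<in> G_prime \<and> iso_to_subgraph H (tree_graph G e)))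
       \<and> (product_join_reducible H \<longleftrightarrow>
           (\<exists>(G :: (nat, nat) mgraph) e. (G, e) \<in> G_dprime \<and> iso_to_subgraph H (tree_graph G e)))"
proof -
  \<comment> \<open>The implications form the circle from (b) to (a), from (a) to (c), and from (c)
    back to (b).\<close>
  have reducible: "product_join_reducible H"
    if "(G, e) \<in> G_prime" "iso_to_subgraph H (tree_graph G e)" for G :: "(nat, nat) mgraph" and e
    using decomposed_embeds_in[OF assms that(2) G_prime_decomposed_at[OF that(1)]]
      embeds_in_product_join_reducible[OF assms] by blast
  have realizable: "\<exists>(G :: (nat, nat) mgraph) e. (G, e) \<in> G_dprime \<and> iso_to_subgraph H (tree_graph G e)"
    if H: "product_join_reducible H"
  proof -
    obtain A B and t :: "nat sp" where t: "bipartition H A B" "read_once t" "embeds_in H A B t"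
      using product_join_reducible_embeds_in[OF H] by blast
    obtain e where e: "e \<notin> labels t" using ex_new_if_finite[OF infinite_UNIV_nat finite_labels] by blast
    obtain G :: "(nat, nat) mgraph" where G: "realizes G e t" using read_once_realized[OF t(2) e] by blast
    have "iso_to_subgraph H (tree_graph G e)"
      by (rule embeds_in_realized[OF assms(1) t realizesD(6,7)[OF G]])
    then show ?thesis using realizes_G_dprime[OF G e] by blast
  qed
  have "(G, e) \<in> G_prime" if "(G, e) \<in> G_dprime" for G :: "(nat, nat) mgraph" and e
    using that by (simp add: G_dprime_def)
  then show ?thesis using reducible realizable by blast
qed

end
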